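(* Let $\Omega\subset\mathbb{R}^2$ be a bounded, simply connected domain with sufficiently smooth boundary $\Gamma=\partial\Omega$, outward unit normal $\mathbf n$. Let $\lambda,\mu$ be constants with $\mu>0$, $\lambda+\mu>0$, and let $\rho>0$, $\rho_f>0$, $\omega>0$, $k>0$. Fix $R>0$ with $\overline\Omega\subset B_R:=\{x:|x|<R\}$, and set $\Gamma_R=\{x:|x|=R\}$, $\Omega_R=B_R\setminus\overline\Omega$. Assume that $\Gamma$ and $(\mu,\lambda,\rho)$ are such that there are no traction free solutions. Then, for a given incident field $p^{inc}$, the nonlocal boundary value problem: find $\mathbf u\in\left(C^2(\Omega)\cap C^1(\overline\Omega)\right)^2$ and $p\in C^2(\Omega_R)\cap C^1(\overline{\Omega_R})$ such that $$\Delta^*\mathbf u+\rho\omega^2\mathbf u=\mathbf 0\ \text{in }\Omega,\qquad \Delta p+k^2p=0\ \text{in }\Omega_R,$$ $$\omega^2\rho_f\,\mathbf u\cdot\mathbf n=\frac{\partial}{\partial\mathbf n}(p+p^{inc})\ \text{on }\Gamma,\qquad \mathbf T\mathbf u=-\mathbf n(p+p^{inc})\ \text{on }\Gamma,\qquad \frac{\partial p}{\partial\mathbf n}=Sp\ \text{on }\Gamma_R,$$ has at most one solution.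
   Context: $\Delta^*=\mu\Delta+(\lambda+\mu)\nabla\nabla\cdot$ and the stress operator is $\mathbf T\mathbf u=2\mu\frac{\partial\mathbf u}{\partial\mathbf n}+\lambda\mathbf n\,\nabla\cdot\mathbf u+\mu\,\mathbf n\times\operatorname{curl}\mathbf u$. A traction free solution is a nontrivial $\mathbf u_0$ with $\Delta^*\mathbf u_0+\rho\omega^2\mathbf u_0=\mathbf 0$ in $\Omega$, $\mathbf T\mathbf u_0=\mathbf 0$ on $\Gamma$ and $\mathbf u_0\cdot\mathbf n=0$ on $\Gamma$. In polar coordinates $(r,\theta)$, with $H_n^{(1)}$ the Hankel function of the first kind of order $n$, the DtN map on $\Gamma_R$ is $$S\varphi(\theta)=\sum_{n\in\mathbb Z}\frac{k\,{H_n^{(1)}}'(kR)}{2\pi H_n^{(1)}(kR)}\int_0^{2\pi}\varphi(R,\phi)e^{in(\theta-\phi)}\,d\phi .$$ *)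

theory Defs
  imports "HOL-Analysis.Analysis"
begin

text \<open>The plane is real^2 with coordinates x$1, x$2. Time-harmonic fields are
complex valued: scalar fields real^2 => complex, vector fields real^2 => complex^2.\<close>

definition pd :: "2 \<Rightarrow> (real^2 \<Rightarrow> complex) \<Rightarrow> real^2 \<Rightarrow> complex" where
  "pd i f x = frechet_derivative f (at x) (axis i 1)"

definition comp :: "(real^2 \<Rightarrow> complex^2) \<Rightarrow> 2 \<Rightarrow> real^2 \<Rightarrow> complex" where
  "comp u i = (\<lambda>y. u y $ i)"

text \<open>C^1(S), C^2(S) for an open set S.\<close>
definition C1_on :: "(real^2) set \<Rightarrow> (real^2 \<Rightarrow> complex) \<Rightarrow> bool" where
  "C1_on S f \<longleftrightarrow> f differentiable_on S \<and> (\<forall>i. continuous_on S (pd i f))"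

definition C2_on :: "(real^2) set \<Rightarrow> (real^2 \<Rightarrow> complex) \<Rightarrow> bool" where
  "C2_on S f \<longleftrightarrow> C1_on S f \<and> (\<forall>i. C1_on S (pd i f))"

definition C1_closure :: "(real^2) set \<Rightarrow> (real^2 \<Rightarrow> complex) \<Rightarrow> bool" where
  "C1_closure S f \<longleftrightarrow> C1_on S f \<and> continuous_on (closure S) f \<and>
     (\<forall>i. \<exists>g. continuous_on (closure S) g \<and> (\<forall>x\<in>S. g x = pd i f x))"

definition bpd :: "(real^2) set \<Rightarrow> 2 \<Rightarrow> (real^2 \<Rightarrow> complex) \<Rightarrow> real^2 \<Rightarrow> complex" where
  "bpd S i f x = Lim (at x within S) (pd i f)"

definition laplacian :: "(real^2 \<Rightarrow> complex) \<Rightarrow> real^2 \<Rightarrow> complex" where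
  "laplacian f x = (\<Sum>j\<in>UNIV. pd j (pd j f) x)"

definition divergence :: "(real^2 \<Rightarrow> complex^2) \<Rightarrow> real^2 \<Rightarrow> complex" where
  "divergence u x = (\<Sum>j\<in>UNIV. pd j (comp u j) x)"

definition lame :: "real \<Rightarrow> real \<Rightarrow> (real^2 \<Rightarrow> complex^2) \<Rightarrow> real^2 \<Rightarrow> complex^2" where
  "lame lam mu u x = (\<chi> i. of_real mu * laplacian (comp u i) x
                         + of_real (lam + mu) * pd i (divergence u) x)"

text \<open>Stress (traction) operator on the boundary of S, with unit normal nv:
  T u = 2 mu du/dn + lambda n div u + mu n x curl u, where in 2D
  curl u = d1 u2 - d2 u1 and n x curl u = (n2 curl u, - n1 curl u).
  Derivatives are the boundary values of the partial derivatives from inside S.\<close>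
definition traction :: "real \<Rightarrow> real \<Rightarrow> (real^2) set \<Rightarrow> real^2 \<Rightarrow> (real^2 \<Rightarrow> complex^2)
    \<Rightarrow> real^2 \<Rightarrow> complex^2" where
  "traction lam mu S nv u x =
    (let d = (\<lambda>i j. bpd S j (comp u i) x);
         dv = d 1 1 + d 2 2;
         c = d 2 1 - d 1 2;
         dn = (\<lambda>i. \<Sum>j\<in>UNIV. of_real (nv $ j) * d i j);
         nc = vector [of_real (nv $ 2) * c, - of_real (nv $ 1) * c] :: complex^2
     in (\<chi> i. 2 * of_real mu * dn i + of_real lam * of_real (nv $ i) * dv + of_real mu * nc $ i))"

definition ndot :: "complex^2 \<Rightarrow> real^2 \<Rightarrow> complex" where
  "ndot v nv = (\<Sum>j\<in>UNIV. v $ j * of_real (nv $ j))"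

definition C2_curve_domain :: "(real^2) set \<Rightarrow> (real \<Rightarrow> real^2) \<Rightarrow> (real \<Rightarrow> real^2) \<Rightarrow> real \<Rightarrow> bool" where
  "C2_curve_domain \<Omega> \<gamma> \<gamma>1 L \<longleftrightarrow> L > 0 \<and> (\<forall>t. \<gamma> (t + L) = \<gamma> t) \<and>
     (\<exists>\<gamma>2. (\<forall>t. (\<gamma> has_vector_derivative \<gamma>1 t) (at t) \<and> (\<gamma>1 has_vector_derivative \<gamma>2 t) (at t))
          \<and> continuous_on UNIV \<gamma>2) \<and>
     (\<forall>t. \<gamma>1 t \<noteq> 0) \<and> inj_on \<gamma> {0..<L} \<and> \<Omega> = inside (\<gamma> ` {0..L})"

definition outward_unit_normal :: "(real^2) set \<Rightarrow> (real \<Rightarrow> real^2) \<Rightarrow> (real \<Rightarrow> real^2) \<Rightarrow> (real^2 \<Rightarrow> real^2) \<Rightarrow> bool" where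
  "outward_unit_normal \<Omega> \<gamma> \<gamma>1 nv \<longleftrightarrow>
     (\<forall>t. norm (nv (\<gamma> t)) = 1 \<and> nv (\<gamma> t) \<bullet> \<gamma>1 t = 0 \<and>
          (\<exists>e>0. \<forall>s. 0 < s \<and> s < e \<longrightarrow> \<gamma> t - s *\<^sub>R nv (\<gamma> t) \<in> \<Omega>))"

definition besselJ :: "real \<Rightarrow> real \<Rightarrow> real" where
  "besselJ \<nu> x = (\<Sum>m. (-1)^m * rGamma (real m + \<nu> + 1) / fact m * (x/2) powr (2 * real m + \<nu>))"

definition besselY :: "int \<Rightarrow> real \<Rightarrow> real" where
  "besselY n x = Lim (at (real_of_int n))
      (\<lambda>\<nu>. (besselJ \<nu> x * cos (\<nu> * pi) - besselJ (-\<nu>) x) / sin (\<nu> * pi))"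

definition hankel1 :: "int \<Rightarrow> real \<Rightarrow> complex" where
  "hankel1 n x = Complex (besselJ (real_of_int n) x) (besselY n x)"

definition polar_pt :: "real \<Rightarrow> real \<Rightarrow> real^2" where
  "polar_pt r \<theta> = vector [r * cos \<theta>, r * sin \<theta>]"

definition dtn_term :: "real \<Rightarrow> real \<Rightarrow> (real^2 \<Rightarrow> complex) \<Rightarrow> int \<Rightarrow> real \<Rightarrow> complex" where
  "dtn_term k R \<phi> n \<theta> =
     of_real k * vector_derivative (hankel1 n) (at (k * R)) / (2 * of_real pi * hankel1 n (k * R))
     * integral {0..2*pi} (\<lambda>\<psi>. \<phi> (polar_pt R \<psi>) * cis (real_of_int n * (\<theta> - \<psi>)))"

text \<open>phi satisfies dphi/dn = S phi on Gamma_R: the symmetric partial sums of the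
series defining S phi converge to the normal derivative g at every point.\<close>
definition dtn_condition :: "real \<Rightarrow> real \<Rightarrow> (real^2 \<Rightarrow> complex) \<Rightarrow> (real^2 \<Rightarrow> complex) \<Rightarrow> bool" where
  "dtn_condition k R \<phi> g \<longleftrightarrow>
     (\<forall>\<theta>. (\<lambda>N. \<Sum>n\<in>{-int N..int N}. dtn_term k R \<phi> n \<theta>) \<longlonglongrightarrow> g (polar_pt R \<theta>))"

definition vec_C2_C1bar :: "(real^2) set \<Rightarrow> (real^2 \<Rightarrow> complex^2) \<Rightarrow> bool" where
  "vec_C2_C1bar S u \<longleftrightarrow> (\<forall>i. C2_on S (comp u i) \<and> C1_closure S (comp u i))"

definition traction_free_solution ::
  "real \<Rightarrow> real \<Rightarrow> real \<Rightarrow> real \<Rightarrow> (real^2) set \<Rightarrow> (real^2 \<Rightarrow> real^2) \<Rightarrow> (real^2 \<Rightarrow> complex^2) \<Rightarrow> bool" where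
  "traction_free_solution lam mu \<rho> \<omega> \<Omega> nv u0 \<longleftrightarrow>
     vec_C2_C1bar \<Omega> u0 \<and>
     (\<forall>x\<in>\<Omega>. lame lam mu u0 x + (\<rho> * \<omega>^2) *\<^sub>R u0 x = 0) \<and>
     (\<forall>x\<in>frontier \<Omega>. traction lam mu \<Omega> (nv x) u0 x = 0) \<and>
     (\<forall>x\<in>frontier \<Omega>. ndot (u0 x) (nv x) = 0) \<and>
     (\<exists>x\<in>\<Omega>. u0 x \<noteq> 0)"

definition fsi_solution ::
  "real \<Rightarrow> real \<Rightarrow> real \<Rightarrow> real \<Rightarrow> real \<Rightarrow> real \<Rightarrow> real \<Rightarrow> (real^2) set \<Rightarrow> (real^2 \<Rightarrow> real^2)
   \<Rightarrow> (real^2 \<Rightarrow> complex) \<Rightarrow> (real^2 \<Rightarrow> complex^2) \<Rightarrow> (real^2 \<Rightarrow> complex) \<Rightarrow> bool" where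
  "fsi_solution lam mu \<rho> \<rho>f \<omega> k R \<Omega> nv pinc u p \<longleftrightarrow>
     (let \<Omega>R = ball 0 R - closure \<Omega> in
     vec_C2_C1bar \<Omega> u \<and> C2_on \<Omega>R p \<and> C1_closure \<Omega>R p \<and>
     (\<forall>x\<in>\<Omega>. lame lam mu u x + (\<rho> * \<omega>^2) *\<^sub>R u x = 0) \<and>
     (\<forall>x\<in>\<Omega>R. laplacian p x + of_real (k^2) * p x = 0) \<and>
     (\<forall>x\<in>frontier \<Omega>. of_real (\<omega>^2 * \<rho>f) * ndot (u x) (nv x)
         = (\<Sum>j\<in>UNIV. of_real (nv x $ j) * (bpd \<Omega>R j p x + pd j pinc x))) \<and>
     (\<forall>x\<in>frontier \<Omega>. traction lam mu \<Omega> (nv x) u x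
         = - (\<chi> j. of_real (nv x $ j) * (p x + pinc x))) \<and>
     dtn_condition k R p (\<lambda>x. \<Sum>j\<in>UNIV. of_real (x $ j / R) * bpd \<Omega>R j p x))"

end

theory Submission
  imports Defs "HOL-Complex_Analysis.Complex_Analysis"
begin

text \<open>
  Let \<open>u\<close>, \<open>p\<close> be the difference of two solutions. The fields \<open>Im (\<sigma>(u) \<cdot> cnj u)\<close> in \<open>\<Omega>\<close> and
  \<open>Im (cnj p \<nabla>p)\<close> in \<open>\<Omega>\<^sub>R\<close> are divergence free, and the transmission conditions match their fluxes
  through \<open>\<Gamma>\<close> up to the factor \<open>\<rho>\<^sub>f \<omega>\<^sup>2\<close>; hence the flux of \<open>Im (cnj p \<nabla>p)\<close> through \<open>\<Gamma>\<^sub>R\<close> vanishes.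
  By Parseval this flux is a sum of squared moduli of the Fourier coefficients of \<open>p\<close> on \<open>\<Gamma>\<^sub>R\<close> weighted by
  \<open>Im (H\<^sub>n'/H\<^sub>n)\<close>, which is positive by the Wronskian of \<open>J\<^sub>n\<close> and \<open>Y\<^sub>n\<close>. So \<open>p\<close> and \<open>Sp\<close> vanish
  on \<open>\<Gamma>\<^sub>R\<close>, the ordinary differential equations for the Fourier modes give \<open>p = 0\<close> near \<open>\<Gamma>\<^sub>R\<close>, and unique
  continuation gives \<open>p = 0\<close>. Then \<open>u\<close> is traction free and thus zero.

  The divergence theorem is replaced by closed forms: on a simply connected domain they are exact by the
  Riemann mapping theorem, and in \<open>\<Omega>\<^sub>R\<close> their integral over a loop depends on its winding number
  only. The boundary \<open>\<Gamma>\<close> is reached as the limit of the offset curves \<open>c - \<i> s c'\<close>.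
\<close>

section \<open>Bessel and Hankel functions\<close>

text \<open>Two gaps between the hypotheses and the classical argument shape the proof. The fields
  are C^2 only inside their domains and C^1 up to the boundary, so nothing involving second
  derivatives can be stated on the boundary; every such identity is proved on nearby curves in a
  form with first derivatives only, and then extends by continuity. The DtN condition asserts
  pointwise convergence of symmetric partial sums, while the flux needs convergence in the mean; a
  linear bound in n on H_n'/H_n closes the gap, because p is C^1 on the circle and so n times its
  Fourier coefficients is square summable. The Hankel function is defined by a limit in the order,
  and its derivative in the argument would exchange two limits. The order is therefore made complex:
  Weber's quotient has a removable singularity at each integer, and the mean over a circle of orders
  replaces the missing value. Both fluxes are imaginary parts because k and
  \<open>\<rho> * \<omega>^2\<close> are real, which leaves real divergences. The orientation of the
  boundary parametrisation is not known; signs depending on it cancel or enter through a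
  modulus.\<close>

definition bessel_series :: "complex \<Rightarrow> complex \<Rightarrow> complex" where
  "bessel_series \<nu> t = (\<Sum>m. (-1)^m * rGamma (of_nat m + \<nu> + 1) / fact m * t^m)"

text \<open>\<open>bessel_series\<close> is J_nu freed of its factor (z/2)^nu, with t = z^2/4, so
  that it is entire in the order as well as in t. A bound uniform in m and in the order feeds every
  M-test below. Finitely many m keep the argument in a compact ball; beyond them
  \<open>rGamma z = z * rGamma (z + 1)\<close> with |z| \<ge> 1 keeps the modulus from
  growing.\<close>

lemma rGamma_shift_bounded:
  fixes A :: real
  obtains K where "K > 0"
    "\<And>\<nu>::complex. \<And>m. norm \<nu> \<le> A \<Longrightarrow> norm (rGamma (of_nat m + \<nu> + 1)) \<le> K"
proof -
  define M where "M = nat \<lceil>\<bar>A\<bar>\<rceil>"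
  have MA: "A \<le> real M" unfolding M_def by linarith
  have "bounded (rGamma ` cball (0::complex) (\<bar>A\<bar> + real M + 3))"
    by (intro compact_imp_bounded compact_continuous_image continuous_intros) auto
  then obtain K where K: "K > 0" "\<And>z::complex. norm z \<le> \<bar>A\<bar> + real M + 3 \<Longrightarrow> norm (rGamma z) \<le> K"
    unfolding bounded_pos by (auto simp: mem_cball_0)
  have "norm (rGamma (of_nat m + \<nu> + 1)) \<le> K" if \<nu>: "norm \<nu> \<le> A" for \<nu> :: complex and m
  proof (induction m)
    case 0
    have "norm (\<nu> + 1) \<le> A + 1" using norm_triangle_ineq[of \<nu> 1] \<nu> by simp
    then show ?case by (intro K(2)) simp
  next
    case (Suc m)
    show ?case
    proof (cases "m \<le> M")
      case True
      have "norm (of_nat (Suc m) + \<nu> + 1) \<le> real (Suc m) + norm \<nu> + 1"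
        by (metis (no_types, opaque_lifting) norm_of_nat norm_one norm_triangle_mono order_refl)
      then show ?thesis using True \<nu> by (intro K(2)) simp
    next
      case False
      define z where "z = of_nat m + \<nu> + 1"
      have "norm (of_nat (m + 1) - (- \<nu>)) \<ge> norm (of_nat (m+1) :: complex) - norm (- \<nu>)"
        by (rule norm_triangle_ineq2)
      then have "norm z \<ge> real (m + 1) - norm \<nu>"
        unfolding z_def norm_of_nat norm_minus_cancel by (simp add: algebra_simps)
      then have z1: "norm z \<ge> 1" using False \<nu> MA by linarith
      have "norm (rGamma z) = norm z * norm (rGamma (z + 1))"
        by (metis norm_mult rGamma_plus1)
      moreover have "norm (rGamma z) \<le> K" using Suc.IH unfolding z_def .
      ultimately have "norm (rGamma (z + 1)) \<le> K"
        using z1 mult_right_mono[OF z1, of "norm (rGamma (z+1))"] by simp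
      then show ?thesis by (simp add: z_def algebra_simps)
    qed
  qed
  with K(1) that show thesis by blast
qed

lemma summable_bessel_majorant: "summable (\<lambda>m. K / fact m * (B::real)^m)"
  using summable_mult[OF summable_exp_generic[of B], of K]
  by (simp add: field_simps)

lemma norm_bessel_term_le:
  assumes "norm (rGamma (of_nat m + \<nu> + 1)) \<le> K" "norm t \<le> B"
  shows "norm ((-1)^m * rGamma (of_nat m + \<nu> + 1) / fact m * t^m :: complex) \<le> K / fact m * B^m"
proof -
  have "K \<ge> 0" using assms(1) norm_ge_zero order_trans by blast
  then show ?thesis
    unfolding norm_mult norm_divide norm_power
    by (simp, intro mult_mono divide_right_mono assms power_mono) auto
qed

lemma summable_bessel_series:
  "summable (\<lambda>m. (-1)^m * rGamma (of_nat m + \<nu> + 1) / fact m * t^m :: complex)"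
proof -
  obtain K where K: "\<And>\<nu>'::complex. \<And>m. norm \<nu>' \<le> norm \<nu> \<Longrightarrow> norm (rGamma (of_nat m + \<nu>' + 1)) \<le> K"
    using rGamma_shift_bounded[of "norm \<nu>"] by metis
  show ?thesis
    by (rule summable_comparison_test'[OF summable_bessel_majorant[of K "norm t"]])
       (rule norm_bessel_term_le[OF K order_refl], simp)
qed

lemma bessel_series_0: "bessel_series \<nu> 0 = rGamma (\<nu> + 1)"
  unfolding bessel_series_def by (subst powser_zero) simp

lemma has_field_derivative_bessel_series:
  "(bessel_series \<nu> has_field_derivative - bessel_series (\<nu> + 1) t) (at t)"
proof -
  let ?c = "\<lambda>m. (-1)^m * rGamma (of_nat m + \<nu> + 1) / fact m :: complex"
  have "((\<lambda>t. \<Sum>m. ?c m * t^m) has_field_derivative (\<Sum>m. diffs ?c m * t^m)) (at t)"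
    by (rule termdiffs_strong_converges_everywhere) (rule summable_bessel_series)
  moreover have "diffs ?c m = - ((-1)^m * rGamma (of_nat m + (\<nu> + 1) + 1) / fact m)" for m
    by (simp add: diffs_def algebra_simps del: of_nat_Suc) (simp add: field_simps)
  ultimately show ?thesis
    using summable_bessel_series[of "\<nu> + 1" t]
    by (simp add: bessel_series_def [abs_def] suminf_minus algebra_simps)
qed

lemmas has_field_derivative_bessel_series' [derivative_intros] =
  DERIV_chain2[OF has_field_derivative_bessel_series]

text \<open>This is J_{nu-1} + J_{nu+1} = (2 nu / z) J_nu without the powers of z. Termwise it is
  \<open>rGamma (m + \<nu>) = (m + \<nu>) * rGamma (m + \<nu> + 1)\<close>: the summand \<nu> gives
  the middle series, the summand m lowers the factorial and shifts the index.\<close>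

lemma bessel_series_recurrence:
  "bessel_series (\<nu> - 1) t = \<nu> * bessel_series \<nu> t - t * bessel_series (\<nu> + 1) t"
proof -
  let ?c = "\<lambda>\<nu> m. (-1)^m * rGamma (of_nat m + \<nu> + 1) / fact m :: complex"
  have sm: "(\<lambda>m. ?c \<nu> m * t^m) sums bessel_series \<nu> t" for \<nu>
    unfolding bessel_series_def using summable_bessel_series by (rule summable_sums)
  define g where "g m = (case m of 0 \<Rightarrow> 0 | Suc j \<Rightarrow> t * (?c (\<nu>+1) j * t^j))" for m
  have "(\<lambda>j. t * (?c (\<nu>+1) j * t^j)) sums (t * bessel_series (\<nu> + 1) t)"
    by (intro sums_mult sm)
  then have "(\<lambda>j. g (Suc j)) sums (t * bessel_series (\<nu> + 1) t)"
    by (simp add: g_def)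
  from sums_Suc[OF this] have 1: "g sums (t * bessel_series (\<nu> + 1) t)" by (simp add: g_def [of 0])
  have "?c (\<nu> - 1) m * t^m = \<nu> * (?c \<nu> m * t^m) - g m" for m
  proof (cases m)
    case 0
    then show ?thesis using rGamma_plus1[of \<nu>] by (simp add: g_def)
  next
    case (Suc j)
    have "rGamma (of_nat m + \<nu>) = (of_nat m + \<nu>) * rGamma (of_nat m + \<nu> + 1)"
      by (rule rGamma_plus1[symmetric])
    then have "?c (\<nu> - 1) m * t^m = \<nu> * (?c \<nu> m * t^m) + of_nat m * (?c \<nu> m * t^m)"
      by (simp add: algebra_simps add_divide_distrib)
    also have "of_nat m * (?c \<nu> m * t^m) = - g m"
      unfolding Suc g_def
      by (simp del: of_nat_Suc add: algebra_simps) (simp add: field_simps)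
    finally show ?thesis by simp
  qed
  then have "(\<lambda>m. ?c (\<nu> - 1) m * t^m) sums (\<nu> * bessel_series \<nu> t - t * bessel_series (\<nu> + 1) t)"
    using sums_diff[OF sums_mult[OF sm[of \<nu>], of \<nu>] 1] by simp
  then show ?thesis using sm[of "\<nu> - 1"] sums_unique2 by blast
qed

text \<open>A Wronskian identity in disguise. The recurrence makes the derivative in t vanish, so
  the expression is constant; at t = 0 it is a product of two reciprocal Gammas, which Euler's
  reflection formula evaluates. Setting t = 0 is possible because the singular powers of z have been
  removed.\<close>

lemma bessel_series_cross_product:
  "t * bessel_series (\<nu> + 1) t * bessel_series (-\<nu>) t + bessel_series \<nu> t * bessel_series (-\<nu> - 1) t
     = - sin (of_real pi * \<nu>) / of_real pi"
proof -
  define D where "D t = t * bessel_series (\<nu> + 1) t * bessel_series (-\<nu>) t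
      + bessel_series \<nu> t * bessel_series (-\<nu> - 1) t" for t
  have D: "(D has_field_derivative 0) (at t)" for t
  proof -
    let ?a0 = "bessel_series \<nu> t" and ?a1 = "bessel_series (\<nu> + 1) t" and ?a2 = "bessel_series (\<nu> + 1 + 1) t"
    let ?b0 = "bessel_series (-\<nu>) t" and ?b1 = "bessel_series (-\<nu> + 1) t" and ?bm = "bessel_series (-\<nu> - 1) t"
    have a: "?a0 = (\<nu> + 1) * ?a1 - t * ?a2"
      using bessel_series_recurrence[of "\<nu> + 1" t] by simp
    have b: "?bm = - \<nu> * ?b0 - t * ?b1"
      using bessel_series_recurrence[of "-\<nu>" t] by simp
    have "(D has_field_derivative (?a1 * ?b0 - t * ?a2 * ?b0 - t * ?a1 * ?b1
        - ?a1 * ?bm - ?a0 * ?b0)) (at t)"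
      unfolding D_def [abs_def]
      by (auto intro!: derivative_eq_intros simp: algebra_simps)
    also have "?a1 * ?b0 - t * ?a2 * ?b0 - t * ?a1 * ?b1 - ?a1 * ?bm - ?a0 * ?b0 = 0"
      unfolding b using a by algebra
    finally show ?thesis .
  qed
  have "D t = D 0"
    using has_field_derivative_zero_constant[of UNIV D] D by (metis UNIV_I convex_UNIV)
  also have "\<dots> = rGamma (-\<nu>) * rGamma (1 - (-\<nu>))"
    by (simp add: D_def bessel_series_0 algebra_simps)
  also have "\<dots> = - sin (of_real pi * \<nu>) / of_real pi"
    unfolding rGamma_reflection_complex by simp
  finally show ?thesis unfolding D_def .
qed

text \<open>The series form of J_{-n} = (-1)^n J_n. Both sides obey the three-term recurrence, so a
  two-step induction works; the case n = 1 is the recurrence at order 0.\<close>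

lemma bessel_series_neg_nat: "bessel_series (- of_nat n) t = (-t)^n * bessel_series (of_nat n) t"
proof (induction n rule: less_induct)
  case (less n)
  consider "n = 0" | "n = 1" | m where "n = Suc (Suc m)" by (metis One_nat_def not0_implies_Suc)
  then show ?case
  proof cases
    case 1 then show ?thesis by simp
  next
    case 2
    then show ?thesis using bessel_series_recurrence[of 0 t] by simp
  next
    case (3 m)
    have 1: "bessel_series (- of_nat n) t = - of_nat (Suc m) * bessel_series (- of_nat (Suc m)) t - t * bessel_series (- of_nat m) t"
      using bessel_series_recurrence[of "- of_nat (Suc m)" t] 3 by (simp add: algebra_simps)
    have 2: "bessel_series (of_nat m) t = of_nat (Suc m) * bessel_series (of_nat (Suc m)) t - t * bessel_series (of_nat n) t"
      using bessel_series_recurrence[of "of_nat (Suc m)" t] 3 by (simp add: algebra_simps)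
    have 3: "bessel_series (- of_nat (Suc m)) t = (-t)^Suc m * bessel_series (of_nat (Suc m)) t"
      "bessel_series (- of_nat m) t = (-t)^m * bessel_series (of_nat m) t"
      by (rule less.IH, simp add: 3)+
    show ?thesis
      unfolding 1 3 2 using \<open>n = Suc (Suc m)\<close> by (simp add: algebra_simps)
  qed
qed

text \<open>Joint continuity in order and argument is what later permits differentiation under an
  integral over orders.\<close>

lemma continuous_on_bessel_series:
  "continuous_on UNIV (\<lambda>(\<nu>, t). bessel_series \<nu> t)"
proof -
  have "continuous_on (ball 0 A \<times> ball 0 A) (\<lambda>(\<nu>, t). bessel_series \<nu> t)" for A
  proof -
    obtain K where K: "\<And>\<nu>'::complex. \<And>m. norm \<nu>' \<le> A \<Longrightarrow> norm (rGamma (of_nat m + \<nu>' + 1)) \<le> K"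
      using rGamma_shift_bounded[of A] by metis
    have "uniform_limit (ball (0::complex) A \<times> ball (0::complex) A)
       (\<lambda>n x. \<Sum>m<n. (-1)^m * rGamma (of_nat m + fst x + 1) / fact m * snd x^m)
       (\<lambda>x. \<Sum>m. (-1)^m * rGamma (of_nat m + fst x + 1) / fact m * snd x^m) sequentially"
      by (rule Weierstrass_m_test_ev[OF always_eventually summable_bessel_majorant[of K A]])
         (intro allI ballI norm_bessel_term_le K; auto)
    then have "continuous_on (ball 0 A \<times> ball 0 A) (\<lambda>x. bessel_series (fst x) (snd x))"
      unfolding bessel_series_def
      by (rule uniform_limit_theorem[rotated])
         (auto intro!: always_eventually continuous_intros
            continuous_on_compose2[OF continuous_on_rGamma[of UNIV]])
    then show ?thesis by (simp add: split_beta)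
  qed
  then have "continuous_on (\<Union>n::nat. ball 0 (real n) \<times> ball 0 (real n)) (\<lambda>(\<nu>, t). bessel_series \<nu> t)"
    by (intro continuous_on_open_UN) (auto intro: open_Times)
  moreover have "(\<Union>n::nat. ball 0 (real n) \<times> ball 0 (real n)) = (UNIV :: (complex \<times> complex) set)"
  proof -
    have "\<exists>n::nat. norm a < real n \<and> norm b < real n" for a b :: complex
    proof -
      obtain n where "max (norm a) (norm b) < real n" using reals_Archimedean2 by blast
      then show ?thesis by auto
    qed
    then show ?thesis by (auto simp: set_eq_iff)
  qed
  ultimately show ?thesis by simp
qed

lemma continuous_on_bessel_series' [continuous_intros]:
  assumes "continuous_on S f" "continuous_on S g"
  shows "continuous_on S (\<lambda>x. bessel_series (f x) (g x))"
proof -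
  have "continuous_on S (\<lambda>x. (f x, g x))" using assms by (intro continuous_intros)
  from continuous_on_compose2[OF continuous_on_bessel_series this] show ?thesis by simp
qed

lemma holomorphic_bessel_series: "(\<lambda>\<nu>. bessel_series \<nu> t) holomorphic_on UNIV"
proof (rule holomorphic_on_subset[of _ "\<Union>n::nat. ball 0 (real n)"])
  show "(\<lambda>\<nu>. bessel_series \<nu> t) holomorphic_on (\<Union>n::nat. ball 0 (real n))"
  proof (rule holomorphic_on_UN_open)
    fix n :: nat
    obtain K where K: "\<And>\<nu>'::complex. \<And>m. norm \<nu>' \<le> real n \<Longrightarrow> norm (rGamma (of_nat m + \<nu>' + 1)) \<le> K"
      using rGamma_shift_bounded[of "real n"] by metis
    have ul: "uniform_limit (cball 0 (real n))
       (\<lambda>N \<nu>. \<Sum>m<N. (-1)^m * rGamma (of_nat m + \<nu> + 1) / fact m * t^m)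
       (\<lambda>\<nu>. bessel_series \<nu> t) sequentially"
      unfolding bessel_series_def
      by (rule Weierstrass_m_test_ev[OF always_eventually summable_bessel_majorant[of K "norm t"]])
         (intro allI ballI norm_bessel_term_le K; auto)
    have "\<forall>\<^sub>F N in sequentially. continuous_on (cball 0 (real n)) (\<lambda>\<nu>. \<Sum>m<N. (-1)^m * rGamma (of_nat m + \<nu> + 1) / fact m * t^m) \<and>
         (\<lambda>\<nu>. \<Sum>m<N. (-1)^m * rGamma (of_nat m + \<nu> + 1) / fact m * t^m) holomorphic_on ball 0 (real n)"
      by (intro always_eventually allI conjI holomorphic_on_imp_continuous_on holomorphic_intros) auto
    from holomorphic_uniform_limit[OF this ul] show "(\<lambda>\<nu>. bessel_series \<nu> t) holomorphic_on ball 0 (real n)"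
      by simp
  qed auto
  show "UNIV \<subseteq> (\<Union>n::nat. ball (0::complex) (real n))"
    by (auto simp: reals_Archimedean2)
qed

lemma holomorphic_bessel_series' [holomorphic_intros]:
  "f holomorphic_on S \<Longrightarrow> (\<lambda>\<nu>. bessel_series (f \<nu>) t) holomorphic_on S"
  using holomorphic_on_compose_gen[OF _ holomorphic_bessel_series, of f S t]
  by (simp add: o_def)

section \<open>Cylinder functions of complex order\<close>

definition bessel_J :: "complex \<Rightarrow> complex \<Rightarrow> complex" where
  "bessel_J \<nu> z = exp (\<nu> * Ln (z / 2)) * bessel_series \<nu> (z\<^sup>2 / 4)"

text \<open>Both functions use the principal logarithm and are studied for Re z > 0. At an integer
  order the quotient is a division by 0 and evaluates to 0; only its limit is meaningful
  there.\<close>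

definition weber_Y :: "complex \<Rightarrow> complex \<Rightarrow> complex" where
  "weber_Y \<nu> z = (bessel_J \<nu> z * cos (of_real pi * \<nu>) - bessel_J (-\<nu>) z) / sin (of_real pi * \<nu>)"

lemma Re_pos_not_nonpos_Reals [simp]: "Re z > 0 \<Longrightarrow> z / 2 \<notin> \<real>\<^sub>\<le>\<^sub>0" "Re z > 0 \<Longrightarrow> z \<noteq> 0"
  by (auto elim!: nonpos_Reals_cases simp: complex_eq_iff)

lemma bessel_J_shift:
  assumes "Re z > 0"
  shows "exp ((\<nu> + 1) * Ln (z / 2)) = exp (\<nu> * Ln (z / 2)) * (z / 2)"
    "exp ((\<nu> - 1) * Ln (z / 2)) = exp (\<nu> * Ln (z / 2)) / (z / 2)"
  using assms by (auto simp: algebra_simps exp_add exp_diff)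

lemma bessel_J_recurrence:
  assumes z: "Re z > 0"
  shows "bessel_J (\<nu> - 1) z = 2 * \<nu> / z * bessel_J \<nu> z - bessel_J (\<nu> + 1) z"
proof -
  have "z \<noteq> 0" using z by auto
  then show ?thesis
    unfolding bessel_J_def bessel_J_shift[OF z] bessel_series_recurrence[of \<nu> "z\<^sup>2/4"]
    by (simp add: field_simps power2_eq_square)
qed

lemma has_field_derivative_bessel_J:
  assumes z: "Re z > 0"
  shows "(bessel_J \<nu> has_field_derivative (\<nu> / z * bessel_J \<nu> z - bessel_J (\<nu> + 1) z)) (at z)"
proof -
  have "z \<noteq> 0" using z by auto
  have "((\<lambda>z. exp (\<nu> * Ln (z / 2))) has_field_derivative exp (\<nu> * Ln (z / 2)) * (\<nu> / z)) (at z)"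
    using z \<open>z \<noteq> 0\<close> by (auto intro!: derivative_eq_intros simp: field_simps)
  moreover have "((\<lambda>z. bessel_series \<nu> (z\<^sup>2 / 4)) has_field_derivative - bessel_series (\<nu> + 1) (z\<^sup>2 / 4) * (z / 2)) (at z)"
    by (auto intro!: derivative_eq_intros)
  ultimately have "(bessel_J \<nu> has_field_derivative exp (\<nu> * Ln (z / 2)) * (\<nu> / z) * bessel_series \<nu> (z\<^sup>2 / 4)
      + (- bessel_series (\<nu> + 1) (z\<^sup>2 / 4) * (z / 2)) * exp (\<nu> * Ln (z / 2))) (at z)"
    unfolding bessel_J_def [abs_def] by (rule DERIV_mult)
  then show ?thesis
    by (rule DERIV_cong) (unfold bessel_J_def bessel_J_shift[OF z], simp add: algebra_simps)
qed

lemma bessel_J_cross_product: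
  assumes z: "Re z > 0"
  shows "bessel_J (\<nu> + 1) z * bessel_J (-\<nu>) z + bessel_J \<nu> z * bessel_J (-\<nu> - 1) z
     = - 2 * sin (of_real pi * \<nu>) / (of_real pi * z)"
proof -
  have nz: "z \<noteq> 0" using z by auto
  define e where "e = exp (\<nu> * Ln (z / 2))"
  have e: "e \<noteq> 0" "exp ((-\<nu>) * Ln (z / 2)) = 1 / e" by (auto simp: e_def exp_minus field_simps)
  have "bessel_J (\<nu> + 1) z * bessel_J (-\<nu>) z + bessel_J \<nu> z * bessel_J (-\<nu> - 1) z
      = 2 / z * ((z\<^sup>2/4) * bessel_series (\<nu> + 1) (z\<^sup>2/4) * bessel_series (-\<nu>) (z\<^sup>2/4)
         + bessel_series \<nu> (z\<^sup>2/4) * bessel_series (-\<nu> - 1) (z\<^sup>2/4))"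
    unfolding bessel_J_def bessel_J_shift[OF z] e e_def[symmetric]
    using nz e(1) by (simp add: field_simps power2_eq_square)
  also have "\<dots> = - 2 * sin (of_real pi * \<nu>) / (of_real pi * z)"
    unfolding bessel_series_cross_product by (simp add: field_simps)
  finally show ?thesis .
qed

lemma bessel_J_neg_int:
  assumes z: "Re z > 0"
  shows "bessel_J (- of_int n) z = cos (of_real pi * of_int n) * bessel_J (of_int n) z"
proof -
  have nat: "bessel_J (- of_nat m) z = (-1)^m * bessel_J (of_nat m) z" for m
  proof -
    have nz: "z \<noteq> 0" using z by auto
    have e: "exp (of_nat m * Ln (z / 2)) = (z / 2)^m"
      using nz by (simp add: exp_of_nat_mult)
    have "(-(z\<^sup>2/4))^m = (-1)^m * ((z / 2)^m * (z / 2)^m)"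
      by (simp add: power_mult_distrib [symmetric] power2_eq_square)
    then show ?thesis
      unfolding bessel_J_def bessel_series_neg_nat
      using nz by (simp add: exp_minus e field_simps)
  qed
  have c: "cos (of_real pi * of_nat m) = (-1 :: complex)^m" for m
    by (metis cos_npi cos_of_real mult.commute of_real_minus of_real_mult of_real_of_nat_eq of_real_power of_real_1)
  show ?thesis
  proof (cases n)
    case (nonneg m)
    then show ?thesis using nat[of m] c[of m] by simp
  next
    case (neg m)
    have "(-1::complex)^Suc m * (-1)^Suc m = 1" by (simp flip: power_mult_distrib)
    with neg show ?thesis using nat[of "Suc m"] c[of "Suc m"] by (simp del: power_Suc of_nat_Suc add: mult.assoc [symmetric])
  qed
qed

lemma sin_pi_eq_0: "sin (of_real pi * \<nu>) = 0 \<longleftrightarrow> (\<nu>::complex) \<in> \<int>"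
proof -
  have "sin (of_real pi * \<nu>) = 0 \<longleftrightarrow> (\<exists>n::int. of_real pi * \<nu> = of_real (real_of_int n * pi))"
    unfolding Complex_Transcendental.sin_eq_0 ..
  also have "\<dots> \<longleftrightarrow> (\<exists>n::int. \<nu> = of_int n)"
    by (intro ex_cong1) (auto simp: mult.commute)
  finally show ?thesis by (auto simp: Ints_def)
qed

lemma sin_cos_pi_add_1:
  "sin (of_real pi * (\<nu> + 1)) = - sin (of_real pi * \<nu> :: complex)"
  "cos (of_real pi * (\<nu> + 1)) = - cos (of_real pi * \<nu> :: complex)"
  by (simp_all add: distrib_left sin_add cos_add sin_of_real cos_of_real)

text \<open>A shift of the order by one flips the signs of both sine and cosine, hence the plus sign
  before J_{-nu-1}. This is why Y obeys the same relations as J although the orders in J_{-nu} run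
  backwards.\<close>

lemma weber_Y_add_1:
  "weber_Y (\<nu> + 1) z = (bessel_J (\<nu> + 1) z * cos (of_real pi * \<nu>) + bessel_J (-\<nu> - 1) z) / sin (of_real pi * \<nu>)"
proof -
  have "- (\<nu> + 1) = - \<nu> - 1" by simp
  then show ?thesis
    unfolding weber_Y_def sin_cos_pi_add_1 by (simp add: divide_simps)
qed

lemma has_field_derivative_weber_Y:
  assumes z: "Re z > 0" and \<nu>: "\<nu> \<notin> \<int>"
  shows "(weber_Y \<nu> has_field_derivative (\<nu> / z * weber_Y \<nu> z - weber_Y (\<nu> + 1) z)) (at z)"
proof -
  have s: "sin (of_real pi * \<nu>) \<noteq> 0" using \<nu> sin_pi_eq_0 by blast
  have nz: "z \<noteq> 0" using z by auto
  have r: "bessel_J (-\<nu> + 1) z = - 2 * \<nu> / z * bessel_J (-\<nu>) z - bessel_J (-\<nu> - 1) z"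
    using bessel_J_recurrence[OF z, of "-\<nu>"] by simp
  have "(weber_Y \<nu> has_field_derivative
     ((\<nu> / z * bessel_J \<nu> z - bessel_J (\<nu> + 1) z) * cos (of_real pi * \<nu>)
        - (- \<nu> / z * bessel_J (- \<nu>) z - bessel_J (- \<nu> + 1) z)) / sin (of_real pi * \<nu>)) (at z)"
    unfolding weber_Y_def [abs_def]
    by (intro DERIV_cdivide DERIV_diff DERIV_cmult_right has_field_derivative_bessel_J z)
  then show ?thesis
    by (rule DERIV_cong) (unfold weber_Y_add_1, unfold weber_Y_def r, use s nz in \<open>simp add: field_simps\<close>)
qed

lemma weber_Y_recurrence:
  assumes z: "Re z > 0" and \<nu>: "\<nu> \<notin> \<int>"
  shows "weber_Y (\<nu> + 2) z = 2 * (\<nu> + 1) / z * weber_Y (\<nu> + 1) z - weber_Y \<nu> z"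
proof -
  have s: "sin (of_real pi * \<nu>) \<noteq> 0" using \<nu> sin_pi_eq_0 by blast
  have nz: "z \<noteq> 0" using z by auto
  have a: "bessel_J (\<nu> + 1 + 1) z = 2 * (\<nu> + 1) / z * bessel_J (\<nu> + 1) z - bessel_J \<nu> z"
    using bessel_J_recurrence[OF z, of "\<nu> + 1"] by simp
  have b: "bessel_J (-\<nu> - 1 - 1) z = - 2 * (\<nu> + 1) / z * bessel_J (-\<nu> - 1) z - bessel_J (-\<nu>) z"
    using bessel_J_recurrence[OF z, of "-\<nu> - 1"] by (simp add: algebra_simps)
  have "weber_Y (\<nu> + 2) z = weber_Y (\<nu> + 1 + 1) z" by (simp add: add.assoc)
  also have "\<dots> = - (bessel_J (\<nu> + 1 + 1) z * (- cos (of_real pi * \<nu>)) + bessel_J (-\<nu> - 1 - 1) z) / sin (of_real pi * \<nu>)"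
    unfolding weber_Y_add_1[of "\<nu> + 1"] sin_cos_pi_add_1
    by (simp add: divide_simps)
  also have "\<dots> = 2 * (\<nu> + 1) / z * weber_Y (\<nu> + 1) z - weber_Y \<nu> z"
    unfolding weber_Y_add_1 a b using s nz by (simp add: weber_Y_def field_simps)
  finally show ?thesis .
qed

lemma weber_Y_cross_product:
  assumes z: "Re z > 0" and \<nu>: "\<nu> \<notin> \<int>"
  shows "bessel_J (\<nu> + 1) z * weber_Y \<nu> z - bessel_J \<nu> z * weber_Y (\<nu> + 1) z = 2 / (of_real pi * z)"
proof -
  have s: "sin (of_real pi * \<nu>) \<noteq> 0" using \<nu> sin_pi_eq_0 by blast
  have "bessel_J (\<nu> + 1) z * weber_Y \<nu> z - bessel_J \<nu> z * weber_Y (\<nu> + 1) z =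
     - (bessel_J (\<nu> + 1) z * bessel_J (-\<nu>) z + bessel_J \<nu> z * bessel_J (-\<nu> - 1) z) / sin (of_real pi * \<nu>)"
    unfolding weber_Y_add_1 unfolding weber_Y_def using s by (simp add: divide_simps) (simp add: algebra_simps)
  also have "\<dots> = 2 / (of_real pi * z)"
    unfolding bessel_J_cross_product[OF z] using s by simp
  finally show ?thesis .
qed

section \<open>Integer orders: Y_n as a mean over complex orders\<close>

lemma holomorphic_bessel_J [holomorphic_intros]:
  "f holomorphic_on S \<Longrightarrow> (\<lambda>\<nu>. bessel_J (f \<nu>) z) holomorphic_on S"
  unfolding bessel_J_def by (intro holomorphic_intros)

text \<open>Y_n, written as the mean of Weber's quotient over the circle of radius 1/2 around n. By
  the mean value property this is the value at the removable singularity, but the circle avoids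
  every integer, so derivatives in z pass under the integral without any limit in the order.\<close>

definition neumann_Y :: "int \<Rightarrow> complex \<Rightarrow> complex" where
  "neumann_Y n z = integral {0..1} (\<lambda>s. weber_Y (of_int n + exp (2 * of_real pi * \<i> * of_real s) / 2) z)"

lemma mean_value_circle:
  assumes "f holomorphic_on ball a 1"
  shows "((\<lambda>s. f (a + exp (2 * of_real pi * \<i> * of_real s) / 2)) has_integral f a) {0..1}"
proof -
  have "((\<lambda>u. f u / (u - a)) has_contour_integral (2 * of_real pi * \<i> * f a)) (circlepath a (1/2))"
    by (rule Cauchy_integral_circlepath)
       (auto intro!: holomorphic_on_imp_continuous_on holomorphic_on_subset[OF assms])
  then have "((\<lambda>s. f (circlepath a (1/2) s) / (circlepath a (1/2) s - a) *
        (2 * of_real pi * \<i> * (1/2) * exp (2 * of_real pi * \<i> * of_real s))) has_integral (2 * of_real pi * \<i> * f a)) {0..1}"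
    unfolding has_contour_integral_def
    by (rule has_integral_eq[rotated]) (simp add: vector_derivative_circlepath01)
  then have "((\<lambda>s. (2 * of_real pi * \<i>) * f (a + exp (2 * of_real pi * \<i> * of_real s) / 2)) has_integral (2 * of_real pi * \<i> * f a)) {0..1}"
    by (rule has_integral_eq[rotated]) (simp add: circlepath field_simps)
  from has_integral_mult_right[OF this, of "1 / (2 * of_real pi * \<i>)"] show ?thesis by simp
qed

lemma not_Ints_near_int:
  assumes "(\<nu>::complex) \<noteq> of_int n" "norm (\<nu> - of_int n) < 1"
  shows "\<nu> \<notin> \<int>"
proof
  assume "\<nu> \<in> \<int>"
  then obtain m where m: "\<nu> = of_int m" by (auto elim: Ints_cases)
  with assms(2) have "\<bar>real_of_int (m - n)\<bar> < 1"
    by (metis norm_of_int of_int_diff)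
  then have "m = n" by linarith
  with m assms(1) show False by simp
qed

lemma weber_Y_extension:
  assumes z: "Re z > 0"
  obtains G where "G holomorphic_on ball (of_int n) 1"
    "\<And>\<nu>. \<nu> \<in> ball (of_int n) 1 \<Longrightarrow> \<nu> \<noteq> of_int n \<Longrightarrow> G \<nu> = weber_Y \<nu> z"
    "G (of_int n) = neumann_Y n z"
proof -
  let ?a = "of_int n :: complex"
  define N where "N \<nu> = bessel_J \<nu> z * cos (of_real pi * \<nu>) - bessel_J (-\<nu>) z" for \<nu>
  define S where "S \<nu> = sin (of_real pi * \<nu>)" for \<nu> :: complex
  \<comment> \<open>q f is the difference quotient of f at n, completed by the derivative. Numerator
    and denominator of Weber's quotient both vanish at n, so q N / q S is the same quotient with the
    common zero cancelled.\<close>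
  define q where "q f \<nu> = (if \<nu> = ?a then deriv f ?a else (f \<nu> - f ?a) / (\<nu> - ?a))" for f \<nu>
  have hol: "q N holomorphic_on ball ?a 1" "q S holomorphic_on ball ?a 1"
    unfolding q_def [abs_def] N_def [abs_def] S_def [abs_def]
    by (intro pole_lemma_open holomorphic_intros open_ball)+
  have S0: "S ?a = 0" unfolding S_def by (simp add: sin_pi_eq_0)
  have c2: "cos (of_real pi * ?a) * cos (of_real pi * ?a) = 1"
    using sin_cos_squared_add[of "of_real pi * ?a"] S0 unfolding S_def by (simp add: power2_eq_square)
  have N0: "N ?a = 0" unfolding N_def bessel_J_neg_int[OF z] by simp
  have dS: "deriv S ?a = of_real pi * cos (of_real pi * ?a)"
    unfolding S_def [abs_def] by (rule DERIV_imp_deriv) (auto intro!: derivative_eq_intros)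
  \<comment> \<open>The zero of the sine at n is simple, its derivative pi cos (pi n) having square
    pi^2, and it is the only zero in the disc of radius 1.\<close>
  have qS: "q S \<nu> \<noteq> 0" if "\<nu> \<in> ball ?a 1" for \<nu>
  proof (cases "\<nu> = ?a")
    case True
    then show ?thesis unfolding q_def using dS c2 by auto
  next
    case False
    then have "\<nu> \<notin> \<int>" using that by (intro not_Ints_near_int) (auto simp: dist_norm norm_minus_commute)
    then show ?thesis unfolding q_def S0 using False by (simp add: S_def sin_pi_eq_0)
  qed
  define G where "G \<nu> = q N \<nu> / q S \<nu>" for \<nu>
  have G: "G holomorphic_on ball ?a 1"
    unfolding G_def [abs_def] by (intro holomorphic_intros hol qS)
  have eq: "G \<nu> = weber_Y \<nu> z" if "\<nu> \<noteq> ?a" for \<nu>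
    using that unfolding G_def q_def N0 S0 by (simp add: weber_Y_def N_def S_def)
  have "G ?a = integral {0..1} (\<lambda>s. G (?a + exp (2 * of_real pi * \<i> * of_real s) / 2))"
    using mean_value_circle[OF G] by (simp add: integral_unique)
  also have "\<dots> = neumann_Y n z"
    unfolding neumann_Y_def by (intro integral_cong eq) auto
  finally show thesis using that G eq by blast
qed

lemma weber_Y_tendsto:
  assumes z: "Re z > 0"
  shows "((\<lambda>\<nu>. weber_Y \<nu> z) \<longlongrightarrow> neumann_Y n z) (at (of_int n))"
proof -
  obtain G where G: "G holomorphic_on ball (of_int n) 1"
    "\<And>\<nu>. \<nu> \<in> ball (of_int n) 1 \<Longrightarrow> \<nu> \<noteq> of_int n \<Longrightarrow> G \<nu> = weber_Y \<nu> z"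
    "G (of_int n) = neumann_Y n z"
    using weber_Y_extension[OF z, of n] by blast
  have "isCont G (of_int n)"
    using holomorphic_on_imp_continuous_on[OF G(1)] by (simp add: continuous_on_eq_continuous_at)
  then have "(G \<longlongrightarrow> neumann_Y n z) (at (of_int n))" using G(3) by (simp add: isCont_def)
  moreover have "\<forall>\<^sub>F \<nu> in at (of_int n). G \<nu> = weber_Y \<nu> z"
  proof -
    have "\<forall>\<^sub>F \<nu> in at (of_int n :: complex). \<nu> \<in> ball (of_int n) 1" 
      using eventually_at_ball[of 1 "of_int n :: complex" UNIV] by simp
    moreover have "\<forall>\<^sub>F \<nu> in at (of_int n :: complex). \<nu> \<noteq> of_int n" by (rule eventually_neq_at_within)
    ultimately show ?thesis by eventually_elim (rule G(2))
  qed
  ultimately show ?thesis using tendsto_cong by force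
qed

lemma not_Ints_at_int: "\<forall>\<^sub>F \<nu> in at (of_int n :: complex). \<nu> \<notin> \<int>"
proof -
  have "\<forall>\<^sub>F \<nu> in at (of_int n :: complex). \<nu> \<in> ball (of_int n) 1" 
      using eventually_at_ball[of 1 "of_int n :: complex" UNIV] by simp
  moreover have "\<forall>\<^sub>F \<nu> in at (of_int n :: complex). \<nu> \<noteq> of_int n" by (rule eventually_neq_at_within)
  ultimately show ?thesis
  proof eventually_elim
    case (elim \<nu>)
    then show ?case using not_Ints_near_int[of \<nu> n] by (auto simp: dist_norm norm_minus_commute)
  qed
qed

lemma bessel_J_tendsto: "((\<lambda>\<nu>. bessel_J (\<nu> + c) z) \<longlongrightarrow> bessel_J (a + c) z) (at a)"
proof -
  have "(\<lambda>\<nu>. bessel_J (\<nu> + c) z) holomorphic_on UNIV" by (intro holomorphic_intros)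
  then show ?thesis
    using holomorphic_on_imp_continuous_on continuous_on_eq_continuous_at isCont_def by blast
qed

lemma weber_Y_tendsto_add:
  assumes z: "Re z > 0"
  shows "((\<lambda>\<nu>. weber_Y (\<nu> + of_int m) z) \<longlongrightarrow> neumann_Y (n + m) z) (at (of_int n))"
  using LIM_offset[OF weber_Y_tendsto[OF z, of "n + m"], of "of_int m"] by simp

text \<open>Weber's relation holds at the non-integer orders near n and survives the limit; the
  cross product below is treated in the same way.\<close>

lemma neumann_Y_recurrence:
  assumes z: "Re z > 0"
  shows "neumann_Y (n + 2) z = 2 * (of_int n + 1) / z * neumann_Y (n + 1) z - neumann_Y n z"
proof -
  have "((\<lambda>\<nu>. 2 * (\<nu> + 1) / z * weber_Y (\<nu> + of_int 1) z - weber_Y (\<nu> + of_int 0) z)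
      \<longlongrightarrow> 2 * (of_int n + 1) / z * neumann_Y (n + 1) z - neumann_Y (n + 0) z) (at (of_int n))"
    using z by (intro tendsto_intros weber_Y_tendsto_add) auto
  moreover have "\<forall>\<^sub>F \<nu> in at (of_int n). 2 * (\<nu> + 1) / z * weber_Y (\<nu> + of_int 1) z - weber_Y (\<nu> + of_int 0) z
      = weber_Y (\<nu> + of_int 2) z"
    using not_Ints_at_int by eventually_elim (use weber_Y_recurrence[OF z] in simp)
  ultimately have "((\<lambda>\<nu>. weber_Y (\<nu> + of_int 2) z) \<longlongrightarrow> 2 * (of_int n + 1) / z * neumann_Y (n + 1) z - neumann_Y (n + 0) z) (at (of_int n))"
    by (rule Lim_transform_eventually)
  with weber_Y_tendsto_add[OF z, of 2 n] show ?thesis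
    by (metis LIM_unique add.right_neutral)
qed

lemma neumann_Y_cross_product:
  assumes z: "Re z > 0"
  shows "bessel_J (of_int n + 1) z * neumann_Y n z - bessel_J (of_int n) z * neumann_Y (n + 1) z = 2 / (of_real pi * z)"
proof -
  have "((\<lambda>\<nu>. bessel_J (\<nu> + 1) z * weber_Y (\<nu> + of_int 0) z - bessel_J (\<nu> + 0) z * weber_Y (\<nu> + of_int 1) z)
      \<longlongrightarrow> bessel_J (of_int n + 1) z * neumann_Y (n + 0) z - bessel_J (of_int n + 0) z * neumann_Y (n + 1) z) (at (of_int n))"
    using z by (intro tendsto_intros weber_Y_tendsto_add bessel_J_tendsto) auto
  moreover have "\<forall>\<^sub>F \<nu> in at (of_int n). bessel_J (\<nu> + 1) z * weber_Y (\<nu> + of_int 0) z - bessel_J (\<nu> + 0) z * weber_Y (\<nu> + of_int 1) z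
      = 2 / (of_real pi * z)"
    using not_Ints_at_int by eventually_elim (use weber_Y_cross_product[OF z] in simp)
  ultimately have "((\<lambda>\<nu>. 2 / (of_real pi * z)) \<longlongrightarrow> bessel_J (of_int n + 1) z * neumann_Y (n + 0) z - bessel_J (of_int n + 0) z * neumann_Y (n + 1) z) (at (of_int n :: complex))"
    by (rule Lim_transform_eventually)
  then show ?thesis by (metis LIM_unique add.right_neutral tendsto_const)
qed

lemma continuous_on_weber_Y_circle:
  fixes n :: int
  shows "continuous_on ({z. Re z > 0} \<times> {0..1})
     (\<lambda>(z, s). weber_Y (of_int n + exp (2 * of_real pi * \<i> * of_real s) / 2) z)"
proof -
  have "sin (of_real pi * (of_int n + exp (2 * of_real pi * \<i> * of_real s) / 2)) \<noteq> 0" for s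
    unfolding sin_pi_eq_0 by (rule not_Ints_near_int[of _ n]) (auto simp: norm_divide)
  then show ?thesis
    unfolding weber_Y_def bessel_J_def split_beta
    by (intro continuous_intros) auto
qed

text \<open>The Leibniz rule uses the derivative of Weber's quotient on the circle of orders, where
  it is regular. Moving the circle by 1 turns the mean of Y_{nu+1} into
  \<open>neumann_Y (n + 1)\<close>.\<close>

lemma has_field_derivative_neumann_Y:
  assumes z: "Re z > 0"
  shows "(neumann_Y n has_field_derivative (of_int n / z * neumann_Y n z - neumann_Y (n + 1) z)) (at z)"
proof -
  define c where "c s = of_int n + exp (2 * of_real pi * \<i> * of_real s) / 2" for s
  define c' where "c' s = of_int (n + 1) + exp (2 * of_real pi * \<i> * of_real s) / 2" for s
  have c': "c s + 1 = c' s" for s by (simp add: c_def c'_def)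
  have cI: "c s \<notin> \<int>" for s
    by (rule not_Ints_near_int[of _ n]) (auto simp: norm_divide c_def)
  let ?U = "{z. Re z > 0}"
  have U: "open ?U" "convex ?U" by (auto simp: open_halfspace_Re_gt convex_halfspace_Re_gt)
  note cont = continuous_on_weber_Y_circle[of n, folded c_def] continuous_on_weber_Y_circle[of "n + 1", folded c'_def]
  have "((\<lambda>z. integral (cbox 0 1) (\<lambda>s. weber_Y (c s) z)) has_field_derivative
      integral (cbox 0 1) (\<lambda>s. c s / z * weber_Y (c s) z - weber_Y (c' s) z)) (at z within ?U)"
  proof (rule leibniz_rule_field_derivative)
    show "((\<lambda>z. weber_Y (c s) z) has_field_derivative c s / z * weber_Y (c s) z - weber_Y (c' s) z) (at z within ?U)"
      if "z \<in> ?U" for z s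
      using has_field_derivative_weber_Y[of z "c s", OF _ cI] that unfolding c'
      by (auto intro: has_field_derivative_at_within)
    show "(\<lambda>s. weber_Y (c s) z) integrable_on cbox 0 1" if "z \<in> ?U" for z
    proof (rule integrable_continuous)
      have "continuous_on (cbox 0 1) (\<lambda>s. (z, s))" by (intro continuous_intros)
      from continuous_on_compose2[OF cont(1) this] that show "continuous_on (cbox 0 1) (\<lambda>s. weber_Y (c s) z)" by auto
    qed
    show "continuous_on (?U \<times> cbox 0 1) (\<lambda>(z, s). c s / z * weber_Y (c s) z - weber_Y (c' s) z)"
    proof -
      have "continuous_on (?U \<times> cbox 0 1) (\<lambda>x. c (snd x) / fst x * weber_Y (c (snd x)) (fst x) - weber_Y (c' (snd x)) (fst x))"
        using cont unfolding split_beta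
        by (intro continuous_intros) (auto simp: c_def intro!: continuous_intros)
      then show ?thesis by (simp add: split_beta)
    qed
  qed (use z U in auto)
  then have "(neumann_Y n has_field_derivative
      integral {0..1} (\<lambda>s. c s / z * weber_Y (c s) z - weber_Y (c' s) z)) (at z)"
    using U z at_within_open[of z ?U] by (simp add: neumann_Y_def [abs_def] c_def)
  also have "integral {0..1} (\<lambda>s. c s / z * weber_Y (c s) z - weber_Y (c' s) z)
     = of_int n / z * neumann_Y n z - neumann_Y (n + 1) z"
  proof -
    obtain G where G: "G holomorphic_on ball (of_int n) 1"
      "\<And>\<nu>. \<nu> \<in> ball (of_int n) 1 \<Longrightarrow> \<nu> \<noteq> of_int n \<Longrightarrow> G \<nu> = weber_Y \<nu> z"
      "G (of_int n) = neumann_Y n z"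
      using weber_Y_extension[OF z, of n] by blast
    \<comment> \<open>The order varies along the circle and cannot be pulled out of the integral as
      n. The mean value property is applied to \<nu> G(\<nu>) / z instead, whose value at the centre
      is n Y_n / z.\<close>
    have "((\<lambda>s. c s / z * G (c s)) has_integral of_int n / z * G (of_int n)) {0..1}"
      unfolding c_def by (rule mean_value_circle) (use z in \<open>intro holomorphic_intros G; auto\<close>)
    then have 1: "((\<lambda>s. c s / z * weber_Y (c s) z) has_integral of_int n / z * neumann_Y n z) {0..1}"
      unfolding G(3)
      by (rule has_integral_eq[rotated]) (subst G(2); auto simp: c_def norm_divide dist_norm)
    have "continuous_on {0..1} (\<lambda>s. (z, s))" by (intro continuous_intros)
    from continuous_on_compose2[OF cont(2) this] z have "continuous_on {0..1} (\<lambda>s. weber_Y (c' s) z)" by auto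
    then have 2: "((\<lambda>s. weber_Y (c' s) z) has_integral neumann_Y (n + 1) z) {0..1}"
      unfolding neumann_Y_def c'_def by (intro integrable_integral integrable_continuous_real)
    show ?thesis using has_integral_diff[OF 1 2] by (simp add: integral_unique)
  qed
  finally show ?thesis .
qed

section \<open>Return to the real Bessel, Neumann and Hankel functions\<close>

lemma of_real_besselJ:
  assumes x: "x > 0"
  shows "complex_of_real (besselJ \<nu> x) = bessel_J (of_real \<nu>) (of_real x)"
proof -
  define c where "c m = (-1)^m * rGamma (real m + \<nu> + 1) / fact m * (x\<^sup>2/4)^m" for m
  have cc: "complex_of_real (c m) = (-1)^m * rGamma (of_nat m + of_real \<nu> + 1) / fact m * ((of_real x)\<^sup>2/4)^m" for m
  proof -
    have "complex_of_real (rGamma (real m + \<nu> + 1)) = rGamma (of_nat m + of_real \<nu> + 1)"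
      by (simp flip: rGamma_complex_of_real)
    then show ?thesis by (simp add: c_def)
  qed
  have "summable (\<lambda>m. complex_of_real (c m))"
    unfolding cc by (rule summable_bessel_series)
  then have sm: "summable c" by (simp add: summable_of_real_iff)
  have e: "c m * (x/2) powr \<nu> = (-1)^m * rGamma (real m + \<nu> + 1) / fact m * (x/2) powr (2 * real m + \<nu>)" for m
  proof -
    have "(x/2) powr (2 * real m) = (x/2)^(2*m)"
      using x powr_realpow[of "x/2" "2*m"] by simp
    also have "\<dots> = (x\<^sup>2/4)^m" by (simp add: power_mult power_divide)
    finally show ?thesis by (simp add: c_def powr_add)
  qed
  have "besselJ \<nu> x = (\<Sum>m. c m * (x/2) powr \<nu>)"
    unfolding besselJ_def e ..
  also have "\<dots> = (\<Sum>m. c m) * (x/2) powr \<nu>" by (rule suminf_mult2[OF sm, symmetric])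
  finally have "complex_of_real (besselJ \<nu> x) = of_real (\<Sum>m. c m) * of_real ((x/2) powr \<nu>)" by simp
  also have "complex_of_real (\<Sum>m. c m) = bessel_series (of_real \<nu>) ((of_real x)\<^sup>2/4)"
    unfolding bessel_series_def cc[symmetric] by (rule suminf_of_real[OF sm])
  also have "complex_of_real ((x/2) powr \<nu>) = exp (of_real \<nu> * Ln (of_real x / 2))"
  proof -
    have "Ln (of_real x / 2) = of_real (ln (x/2))"
      using Ln_of_real[of "x/2"] x by simp
    then show ?thesis using x by (simp add: powr_def flip: exp_of_real)
  qed
  finally show ?thesis by (simp add: bessel_J_def)
qed

text \<open>The limit over real orders is the restriction of the complex limit to the real axis.
  Being a limit of real numbers, the mean \<open>neumann_Y\<close> is itself real at real
  arguments.\<close>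

lemma besselY_eq:
  assumes x: "x > 0"
  shows "complex_of_real (besselY n x) = neumann_Y n (of_real x)"
proof -
  define f where "f \<nu> = (besselJ \<nu> x * cos (\<nu> * pi) - besselJ (-\<nu>) x) / sin (\<nu> * pi)" for \<nu>
  have f: "complex_of_real (f \<nu>) = weber_Y (of_real \<nu>) (of_real x)" for \<nu>
    unfolding f_def weber_Y_def
    by (simp add: of_real_besselJ[OF x] mult.commute[of _ pi] flip: sin_of_real cos_of_real)
  have "filterlim complex_of_real (at (of_int n)) (at (real_of_int n))"
  proof (rule filterlim_atI)
    show "(complex_of_real \<longlongrightarrow> complex_of_int n) (at (real_of_int n))"
      by (rule tendsto_eq_intros refl)+ simp
    show "\<forall>\<^sub>F \<nu> in at (real_of_int n). complex_of_real \<nu> \<noteq> of_int n"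
      using eventually_neq_at_within[of "real_of_int n"]
      by eventually_elim (metis of_real_eq_iff of_real_of_int_eq)
  qed
  from filterlim_compose[OF weber_Y_tendsto this, of "of_real x"] x
  have lim: "((\<lambda>\<nu>. complex_of_real (f \<nu>)) \<longlongrightarrow> neumann_Y n (of_real x)) (at (real_of_int n))"
    by (simp add: f)
  have "(f \<longlongrightarrow> Re (neumann_Y n (of_real x))) (at (real_of_int n))"
    using tendsto_Re[OF lim] by simp
  then have 1: "besselY n x = Re (neumann_Y n (of_real x))"
    unfolding besselY_def f_def by (intro tendsto_Lim) auto
  have "((\<lambda>\<nu>. 0) \<longlongrightarrow> Im (neumann_Y n (of_real x))) (at (real_of_int n))"
    using tendsto_Im[OF lim] by simp
  then have "Im (neumann_Y n (of_real x)) = 0"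
    using LIM_unique tendsto_const by blast
  with 1 show ?thesis by (simp add: complex_eq_iff)
qed

lemma hankel1_eq:
  assumes "x > 0"
  shows "hankel1 n x = bessel_J (of_int n) (of_real x) + \<i> * neumann_Y n (of_real x)"
proof -
  have "bessel_J (of_int n) (of_real x) = of_real (besselJ (of_int n) x)"
    using of_real_besselJ[OF assms, of "of_int n"] by simp
  then show ?thesis
    unfolding hankel1_def besselY_eq[OF assms, symmetric] by (simp add: complex_eq_iff)
qed

lemma has_vector_derivative_hankel1:
  assumes x: "x > 0"
  shows "(hankel1 n has_vector_derivative (of_int n / of_real x * hankel1 n x - hankel1 (n + 1) x)) (at x)"
proof -
  have "((\<lambda>z. bessel_J (of_int n) z + \<i> * neumann_Y n z) has_field_derivative
     (of_int n / of_real x * bessel_J (of_int n) (of_real x) - bessel_J (of_int n + 1) (of_real x))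
     + \<i> * (of_int n / of_real x * neumann_Y n (of_real x) - neumann_Y (n + 1) (of_real x))) (at (of_real x))"
    using x by (intro DERIV_add DERIV_cmult has_field_derivative_bessel_J has_field_derivative_neumann_Y) auto
  then have "((\<lambda>x. bessel_J (of_int n) (of_real x) + \<i> * neumann_Y n (of_real x)) has_vector_derivative
     (of_int n / of_real x * hankel1 n x - hankel1 (n + 1) x)) (at x)"
    by (intro has_vector_derivative_real_field) (simp add: hankel1_eq x algebra_simps)
  then show ?thesis
    by (rule has_vector_derivative_transform_within_open[where S = "{0<..}"])
       (use x in \<open>auto simp: hankel1_eq\<close>)
qed

lemma hankel1_recurrence:
  assumes x: "x > 0"
  shows "hankel1 (n + 2) x = 2 * (of_int n + 1) / of_real x * hankel1 (n + 1) x - hankel1 n x"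
proof -
  have "bessel_J (of_int n + 2) (of_real x) = 2 * (of_int n + 1) / of_real x * bessel_J (of_int n + 1) (of_real x) - bessel_J (of_int n) (of_real x)"
    using bessel_J_recurrence[of "of_real x" "of_int n + 1"] x by (simp add: add.assoc)
  then show ?thesis
    using neumann_Y_recurrence[of "of_real x" n] x
    by (simp add: hankel1_eq) (simp add: field_simps)
qed

lemma hankel1_cross_product:
  assumes x: "x > 0"
  shows "Re (hankel1 (n + 1) x) * Im (hankel1 n x) - Re (hankel1 n x) * Im (hankel1 (n + 1) x) = 2 / (pi * x)"
proof -
  have "complex_of_real (besselJ (of_int (n + 1)) x * besselY n x - besselJ (of_int n) x * besselY (n + 1) x) = of_real (2 / (pi * x))"
    using neumann_Y_cross_product[of "of_real x" n] x
    by (simp add: of_real_besselJ besselY_eq)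
  then show ?thesis by (simp add: hankel1_def del: of_real_diff of_real_mult of_real_divide)
qed

lemma hankel1_nonzero: "x > 0 \<Longrightarrow> hankel1 n x \<noteq> 0"
  using hankel1_cross_product[of x n] by auto

section \<open>The symbol of the DtN map: sign and growth\<close>

definition dtn_symbol :: "int \<Rightarrow> real \<Rightarrow> complex" where
  "dtn_symbol n x = vector_derivative (hankel1 n) (at x) / hankel1 n x"

lemma dtn_symbol_eq:
  "x > 0 \<Longrightarrow> dtn_symbol n x = of_int n / of_real x - hankel1 (n + 1) x / hankel1 n x"
  unfolding dtn_symbol_def
  using vector_derivative_at[OF has_vector_derivative_hankel1, of x n] hankel1_nonzero[of x n]
  by (simp add: diff_divide_distrib)

text \<open>Since n / x is real, the imaginary part comes from - H_{n+1} / H_n, where it is the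
  cross product of J and Y divided by |H_n|^2. Positivity expresses that every mode radiates
  outwards.\<close>

lemma Im_dtn_symbol_pos:
  assumes x: "x > 0"
  shows "Im (dtn_symbol n x) > 0"
proof -
  have "Im (of_int n / complex_of_real x) = 0"
    by (metis Im_complex_of_real of_real_divide of_real_of_int_eq)
  then have "Im (dtn_symbol n x) = (2 / (pi * x)) / (norm (hankel1 n x))\<^sup>2"
    unfolding dtn_symbol_eq[OF x] hankel1_cross_product[OF x, of n, symmetric] cmod_power2
    by (simp add: Im_divide diff_divide_distrib)
  then show ?thesis using x hankel1_nonzero[OF x, of n] by simp
qed

text \<open>What counts is uniformity in n: J_n is the bounded solution against which the growth of
  Y_n is measured. The factor (x/2)^n / n! is one term of exp (x/2), and Gamma (m + n + 1) \<ge> n!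
  leaves exp (x^2/4) for the series.\<close>

lemma besselJ_nat_bounded:
  assumes x: "x > 0"
  shows "\<bar>besselJ (real n) x\<bar> \<le> exp (x / 2) * exp (x\<^sup>2 / 4)"
proof -
  have rG: "norm (rGamma (of_nat m + of_nat n + 1) :: complex) \<le> 1 / fact n" for m
  proof -
    have "rGamma (of_nat m + of_nat n + 1 :: complex) = inverse (fact (m + n))"
      using rGamma_of_int[of "int (m + n + 1)", where ?'a = complex]
      by (simp add: add_ac nat_add_distrib)
    moreover have "(fact n :: real) \<le> fact (m + n)" by (rule fact_mono) simp
    ultimately show ?thesis by (simp add: norm_inverse le_imp_inverse_le flip: inverse_eq_divide)
  qed
  let ?t = "(of_real x)\<^sup>2 / 4 :: complex"
  have t: "norm ?t = x\<^sup>2 / 4" by (simp add: norm_divide norm_power)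
  have "norm (bessel_series (of_nat n) ?t) \<le> (\<Sum>m. 1 / fact n / fact m * (x\<^sup>2/4)^m)"
    unfolding bessel_series_def
    by (intro norm_suminf_le norm_bessel_term_le summable_bessel_majorant rG eq_refl[OF t])
  also have "\<dots> = 1 / fact n * exp (x\<^sup>2/4)"
  proof -
    have "(\<lambda>m. 1 / fact n * ((x\<^sup>2/4)^m /\<^sub>R fact m)) sums (1 / fact n * exp (x\<^sup>2/4))"
      by (intro sums_mult exp_converges)
    then show ?thesis by (simp add: sums_iff field_simps)
  qed
  finally have 1: "norm (bessel_series (of_nat n) ?t) \<le> 1 / fact n * exp (x\<^sup>2/4)" .
  have "norm (exp (of_nat n * Ln (of_real x / 2))) = (x/2)^n"
    using x by (simp add: exp_of_nat_mult norm_power norm_divide)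
  with 1 have "norm (bessel_J (of_nat n) (of_real x)) \<le> (x/2)^n * (1 / fact n * exp (x\<^sup>2/4))"
    unfolding bessel_J_def norm_mult using x by (intro mult_mono) auto
  also have "\<dots> = (x/2)^n / fact n * exp (x\<^sup>2/4)" by simp
  also have "(x/2)^n / fact n \<le> exp (x/2)"
  proof -
    have "(\<Sum>m\<in>{n}. (x/2)^m /\<^sub>R fact m) \<le> (\<Sum>m. (x/2)^m /\<^sub>R fact m)"
      using x by (intro sum_le_suminf summable_exp_generic) auto
    then show ?thesis unfolding exp_def by (simp add: field_simps)
  qed
  finally show ?thesis
    using of_real_besselJ[OF x, of "real n"] norm_of_real[of "besselJ (real n) x", where ?'a = complex] by simp
qed

lemma abs_besselJ_neg_int: "x > 0 \<Longrightarrow> \<bar>besselJ (- of_int n) x\<bar> = \<bar>besselJ (of_int n) x\<bar>"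
proof -
  assume x: "x > 0"
  have "complex_of_real (besselJ (- of_int n) x) = cos (of_real pi * of_int n) * of_real (besselJ (of_int n) x)"
    using bessel_J_neg_int[of "of_real x" n] x of_real_besselJ[OF x, of "- of_int n"] of_real_besselJ[OF x, of "of_int n"]
    by simp
  also have "cos (of_real pi * of_int n) = complex_of_real (cos (pi * of_int n))"
    by (metis cos_of_real of_real_mult of_real_of_int_eq)
  also have "\<dots> * of_real (besselJ (of_int n) x) = of_real (cos (pi * of_int n) * besselJ (of_int n) x)"
    by simp
  finally have "besselJ (- of_int n) x = cos (pi * of_int n) * besselJ (of_int n) x"
    by (rule of_real_eq_iff[THEN iffD1])
  moreover have "\<bar>cos (pi * of_int n)\<bar> = 1"
  proof -
    have "sin (pi * of_int n) = 0" using sin_times_pi_eq_0[of "of_int n"] by (simp add: mult.commute)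
    then have "(cos (pi * of_int n))\<^sup>2 = 1" using sin_cos_squared_add[of "pi * of_int n"] by simp
    then show ?thesis by (auto simp: power2_eq_1_iff)
  qed
  ultimately show ?thesis by (simp add: abs_mult)
qed

text \<open>A solution of the three-term recurrence that stays away from the bounded solution
  \<^term>\<open>j\<close> must eventually grow, because a decreasing solution would tend to zero and
  so would the cross product.\<close>

lemma recurrence_ratio_bounded:
  fixes j y :: "nat \<Rightarrow> real" and x :: real
  assumes x: "x > 0" and J: "\<And>n. \<bar>j n\<bar> \<le> B"
    and rec: "\<And>n. \<bar>y (n + 2)\<bar> \<ge> 2 * real (n + 1) / x * \<bar>y (n + 1)\<bar> - \<bar>y n\<bar>"
    and cross: "\<And>n. \<bar>j (n + 1) * y n - j n * y (n + 1)\<bar> \<ge> w" and w: "w > 0"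
  obtains C where "\<And>n. norm (Complex (j n) (y n)) \<le> C * norm (Complex (j (n + 1)) (y (n + 1)))"
proof -
  obtain N :: nat where N: "real N > x" using reals_Archimedean2 by blast
  \<comment> \<open>From N > x on, the recurrence coefficient is at least 2, so that one
    non-decreasing step of |y| forces all later ones.\<close>
  have coef: "2 * real (n + 1) / x \<ge> 2" if "n \<ge> N" for n
    using that N x by (simp add: field_simps)
  have B0: "B \<ge> 0" using J[of 0] by linarith
  have "\<exists>n\<ge>N. \<bar>y (n + 1)\<bar> \<ge> \<bar>y n\<bar>"
  proof (rule ccontr)
    assume "\<not> ?thesis"
    then have dec: "\<bar>y (n + 1)\<bar> < \<bar>y n\<bar>" if "n \<ge> N" for n using that by force
    have M: "\<bar>y (N + k)\<bar> \<le> \<bar>y N\<bar>" for k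
    proof (induction k)
      case (Suc k)
      then show ?case using dec[of "N + k"] by simp
    qed simp
    have small: "2 * real (n + 1) / x * \<bar>y (n + 1)\<bar> \<le> 2 * \<bar>y N\<bar>" if "n \<ge> N" for n
    proof -
      have "\<bar>y (n + 2)\<bar> \<le> \<bar>y N\<bar>" "\<bar>y n\<bar> \<le> \<bar>y N\<bar>"
        using M[of "n + 2 - N"] M[of "n - N"] that by auto
      with rec[of n] show ?thesis by linarith
    qed
    \<comment> \<open>Large enough that 2 B x |y N| / (k + 1), the bound for the cross product at n
      + 1, falls below w.\<close>
    obtain k :: nat where k: "real k > (2 * B * x * \<bar>y N\<bar>) / w" using reals_Archimedean2 by blast
    define n where "n = N + k"
    have yn: "\<bar>y (m + 1)\<bar> \<le> x * \<bar>y N\<bar> / real (k + 1)" if "m \<ge> n" for m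
    proof -
      have "\<bar>y (m + 1)\<bar> \<le> x * \<bar>y N\<bar> / real (m + 1)"
        using small[of m] that x by (simp add: n_def field_simps)
      also have "\<dots> \<le> x * \<bar>y N\<bar> / real (k + 1)"
        using that x by (intro divide_left_mono) (auto simp: n_def)
      finally show ?thesis .
    qed
    have "w \<le> \<bar>j (n + 1 + 1)\<bar> * \<bar>y (n + 1)\<bar> + \<bar>j (n + 1)\<bar> * \<bar>y (n + 1 + 1)\<bar>"
      using cross[of "n + 1"] abs_triangle_ineq4[of "j (n+1+1) * y (n+1)" "j (n+1) * y (n+1+1)"]
      by (simp add: abs_mult)
    also have "\<dots> \<le> B * (x * \<bar>y N\<bar> / real (k + 1)) + B * (x * \<bar>y N\<bar> / real (k + 1))"
      using yn[of n] yn[of "n + 1"] J B0 by (intro add_mono mult_mono) auto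
    also have "\<dots> = 2 * B * x * \<bar>y N\<bar> / real (k + 1)" by simp
    also have "\<dots> < w"
    proof -
      have "2 * B * x * \<bar>y N\<bar> < w * real k" using k w by (simp add: field_simps)
      also have "\<dots> \<le> w * real (k + 1)" using w by simp
      finally show ?thesis by (simp add: field_simps)
    qed
    finally show False by simp
  qed
  then obtain n0 where n0: "n0 \<ge> N" "\<bar>y (n0 + 1)\<bar> \<ge> \<bar>y n0\<bar>" by blast
  have inc: "\<bar>y (n0 + k + 1)\<bar> \<ge> \<bar>y (n0 + k)\<bar>" for k
  proof (induction k)
    case 0
    then show ?case using n0 by simp
  next
    case (Suc k)
    have "2 * \<bar>y (n0 + k + 1)\<bar> \<le> 2 * real (n0 + k + 1) / x * \<bar>y (n0 + k + 1)\<bar>"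
      using coef[of "n0 + k"] n0 by (intro mult_right_mono) auto
    with rec[of "n0 + k"] Suc show ?case by simp
  qed
  have y1: "\<bar>y (n0 + 1)\<bar> > 0"
  proof (rule ccontr)
    assume "\<not> ?thesis"
    with n0 have "y (n0 + 1) = 0" "y n0 = 0" by auto
    with cross[of n0] w show False by simp
  qed
  have low: "\<bar>y (n0 + 1)\<bar> \<le> \<bar>y (n0 + 1 + k)\<bar>" for k
  proof (induction k)
    case (Suc k)
    then show ?case using inc[of "k + 1"] by simp
  qed simp
  define h where "h n = Complex (j n) (y n)" for n
  have hn: "norm (h n) \<le> \<bar>j n\<bar> + \<bar>y n\<bar>" for n unfolding h_def
    by (metis cmod_le complex.sel)
  have hy: "\<bar>y n\<bar> \<le> norm (h n)" for n unfolding h_def by (metis abs_Im_le_cmod complex.sel(2))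
  have hpos: "norm (h n) > 0" for n
  proof -
    have "j n \<noteq> 0 \<or> y n \<noteq> 0" using cross[of n] w by auto
    then show ?thesis unfolding h_def zero_less_norm_iff Complex_eq_0 by blast
  qed
  \<comment> \<open>From n0 on |y| never falls below |y (n0 + 1)|, so B / |y (n0 + 1)| times |y (n +
    1)| covers |j n|; the summand 1 covers |y n|.\<close>
  define C1 where "C1 = B / \<bar>y (n0 + 1)\<bar> + 1"
  have big: "norm (h n) \<le> C1 * norm (h (n + 1))" if "n \<ge> n0" for n
  proof -
    define k where "k = n - n0"
    have k: "n = n0 + k" using that by (simp add: k_def)
    have "norm (h n) \<le> B + \<bar>y n\<bar>" using hn[of n] J[of n] by linarith
    also have "\<dots> \<le> B / \<bar>y (n0 + 1)\<bar> * \<bar>y (n + 1)\<bar> + \<bar>y (n + 1)\<bar>"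
    proof (rule add_mono)
      show "B \<le> B / \<bar>y (n0 + 1)\<bar> * \<bar>y (n + 1)\<bar>"
      proof -
        have "\<bar>y (n0 + 1)\<bar> \<le> \<bar>y (n + 1)\<bar>" using low[of k] by (simp add: k add_ac)
        then have "B * \<bar>y (n0 + 1)\<bar> \<le> B * \<bar>y (n + 1)\<bar>" by (rule mult_left_mono[OF _ B0])
        then show ?thesis using y1 by (simp add: pos_le_divide_eq)
      qed
      show "\<bar>y n\<bar> \<le> \<bar>y (n + 1)\<bar>" using inc[of k] by (simp add: k)
    qed
    also have "\<dots> = C1 * \<bar>y (n + 1)\<bar>" by (simp add: C1_def algebra_simps)
    also have "\<dots> \<le> C1 * norm (h (n + 1))"
      using hy[of "n + 1"] B0 by (intro mult_left_mono) (auto simp: C1_def)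
    finally show ?thesis .
  qed
  \<comment> \<open>For the finitely many indices before n0 the sum of all ratios dominates each of
    them.\<close>
  define C2 where "C2 = (\<Sum>n<n0. norm (h n) / norm (h (n + 1)))"
  have small: "norm (h n) \<le> C2 * norm (h (n + 1))" if "n < n0" for n
  proof -
    have "norm (h n) / norm (h (n + 1)) \<le> C2"
      unfolding C2_def using that by (intro member_le_sum) auto
    then show ?thesis using hpos[of "n + 1"] by (simp add: field_simps)
  qed
  have C: "C1 \<ge> 0" "C2 \<ge> 0" using B0 by (auto simp: C1_def C2_def intro: sum_nonneg)
  have "norm (h n) \<le> (C1 + C2) * norm (h (n + 1))" for n
  proof (cases "n < n0")
    case True
    have "C2 * norm (h (n + 1)) \<le> (C1 + C2) * norm (h (n + 1))"
      using C by (intro mult_right_mono) auto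
    with small[OF True] show ?thesis by linarith
  next
    case False
    have "C1 * norm (h (n + 1)) \<le> (C1 + C2) * norm (h (n + 1))"
      using C by (intro mult_right_mono) auto
    with big[of n] False show ?thesis by linarith
  qed
  then show thesis using that unfolding h_def by blast
qed

text \<open>Says that a normal derivative of a radiating field costs no more than a tangential one.
  The quotient of H at the neighbouring order closer to 0 by H_n is bounded, for n > 0 and n < 0
  separately; what remains of the symbol is n / x up to sign.\<close>

lemma dtn_symbol_linear_bound:
  assumes x: "x > 0"
  obtains C where "C \<ge> 0" "\<And>n. norm (dtn_symbol n x) \<le> C * (1 + \<bar>real_of_int n\<bar>)"
proof -
  define B where "B = exp (x / 2) * exp (x\<^sup>2 / 4)"
  define w where "w = 2 / (pi * x)"
  have w: "w > 0" using x by (simp add: w_def)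
  have Jb: "\<bar>besselJ (of_int n) x\<bar> \<le> B" for n
  proof (cases n)
    case (nonneg m)
    then show ?thesis using besselJ_nat_bounded[OF x, of m] by (simp add: B_def)
  next
    case (neg m)
    then show ?thesis using besselJ_nat_bounded[OF x, of "Suc m"] abs_besselJ_neg_int[OF x, of "int (Suc m)"]
      by (simp add: B_def)
  qed
  have H: "hankel1 n x = Complex (besselJ (of_int n) x) (besselY n x)" for n by (simp add: hankel1_def)
  have recY: "besselY (n + 2) x = 2 * (of_int n + 1) / x * besselY (n + 1) x - besselY n x" for n
  proof -
    have "2 * (of_int n + 1) / complex_of_real x = of_real (2 * (of_int n + 1) / x)" by simp
    from hankel1_recurrence[OF x, of n, unfolded this]
    have "Im (hankel1 (n + 2) x) = Im (of_real (2 * (of_int n + 1) / x) * hankel1 (n + 1) x - hankel1 n x)" by simp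
    then show ?thesis by (simp add: H del: of_real_divide of_real_mult of_real_add)
  qed
  obtain Cp where Cp: "\<And>n. norm (Complex (besselJ (of_int (int n)) x) (besselY (int n) x))
         \<le> Cp * norm (Complex (besselJ (of_int (int (n + 1))) x) (besselY (int (n + 1)) x))"
  proof (rule recurrence_ratio_bounded[of x "\<lambda>n. besselJ (of_int (int n)) x" B "\<lambda>n. besselY (int n) x" w])
    show "\<bar>besselY (int (n + 2)) x\<bar> \<ge> 2 * real (n + 1) / x * \<bar>besselY (int (n + 1)) x\<bar> - \<bar>besselY (int n) x\<bar>" for n
    proof -
      have "2 * real (n + 1) / x * \<bar>besselY (int (n + 1)) x\<bar> = \<bar>2 * (of_int (int n) + 1) / x * besselY (int n + 1) x\<bar>"
        using x by (simp add: abs_mult add_ac)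
      then show ?thesis using recY[of "int n"]
        abs_triangle_ineq2[of "2 * (of_int (int n) + 1) / x * besselY (int n + 1) x" "besselY (int n) x"]
        by (simp only: of_nat_add of_nat_numeral of_nat_1)
    qed
    show "w \<le> \<bar>besselJ (of_int (int (n + 1))) x * besselY (int n) x - besselJ (of_int (int n)) x * besselY (int (n + 1)) x\<bar>" for n
      using hankel1_cross_product[OF x, of "int n"] w by (simp add: H w_def algebra_simps)
    show "\<bar>besselJ (of_int (int n)) x\<bar> \<le> B" for n by (rule Jb)
  qed (use x w that in blast)+
  note Cp = Cp[folded H]
  obtain Cm where Cm: "\<And>n. norm (Complex (besselJ (of_int (- int n)) x) (besselY (- int n) x))
         \<le> Cm * norm (Complex (besselJ (of_int (- int (n + 1))) x) (besselY (- int (n + 1)) x))"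
  proof (rule recurrence_ratio_bounded[of x "\<lambda>n. besselJ (of_int (- int n)) x" B "\<lambda>n. besselY (- int n) x" w])
    show "\<bar>besselY (- int (n + 2)) x\<bar> \<ge> 2 * real (n + 1) / x * \<bar>besselY (- int (n + 1)) x\<bar> - \<bar>besselY (- int n) x\<bar>" for n
    proof -
      \<comment> \<open>Solved for the term at -n, the recurrence at negative orders is the one at
        positive orders up to signs, which the absolute values hide.\<close>
      have "- int (n + 2) + 2 = - int n" "- int (n + 2) + 1 = - int (n + 1)" by auto
      moreover have "(of_int (- int (n + 2)) + 1 :: real) = - real (n + 1)" by simp
      ultimately have 1: "besselY (- int n) x = - (2 * real (n + 1) / x * besselY (- int (n + 1)) x) - besselY (- int (n + 2)) x"
        using recY[of "- int (n + 2)"] by (simp only: mult_minus_right minus_divide_left [symmetric] mult_minus_left)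
      have 2: "2 * real (n + 1) / x * \<bar>besselY (- int (n + 1)) x\<bar> = \<bar>2 * real (n + 1) / x * besselY (- int (n + 1)) x\<bar>"
        using x by (simp add: abs_mult)
      have "\<bar>a\<bar> - \<bar>- a - c\<bar> \<le> \<bar>c\<bar>" for a c :: real by linarith
      then show ?thesis unfolding 1 2 .
    qed
    show "w \<le> \<bar>besselJ (of_int (- int (n + 1))) x * besselY (- int n) x - besselJ (of_int (- int n)) x * besselY (- int (n + 1)) x\<bar>" for n
    proof -
      have "- int (n + 1) + 1 = - int n" by simp
      from hankel1_cross_product[OF x, of "- int (n + 1)", unfolded this H complex.sel]
      show ?thesis unfolding w_def by linarith
    qed
    show "\<bar>besselJ (of_int (- int n)) x\<bar> \<le> B" for n by (rule Jb)
  qed (use x w that in blast)+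
  note Cm = Cm[folded H]
  \<comment> \<open>The summands account for the ratios at either sign of n, for the term n / x, and
    for the mode n = 0.\<close>
  define C where "C = max \<bar>Cp\<bar> \<bar>Cm\<bar> + 3 / x + norm (dtn_symbol 0 x)"
  have C0: "C \<ge> 0" using x by (auto simp: C_def)
  have "1 / x \<le> 3 / x" "3 / x \<ge> 0" using x by (auto simp: divide_right_mono)
  then have Cge: "1 / x \<le> C" "\<bar>Cp\<bar> \<le> C" "\<bar>Cm\<bar> \<le> C"
    using norm_ge_zero[of "dtn_symbol 0 x"] unfolding C_def by linarith+
  have "norm (dtn_symbol n x) \<le> C * (1 + \<bar>real_of_int n\<bar>)" for n
  proof -
    consider "n = 0" | m where "n = int m + 1" | m where "n = - int m - 1"
    proof (cases n)
      case (nonneg k)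
      then show ?thesis using that by (cases k) auto
    next
      case (neg k)
      then show ?thesis using that(3)[of k] by simp
    qed
    then show ?thesis
    proof cases
      case 1
      then show ?thesis using x by (simp add: C_def)
    next
      case (2 m)
      have hz: "hankel1 n x \<noteq> 0" using hankel1_nonzero x by blast
      have r: "norm (hankel1 (int m) x / hankel1 n x) \<le> \<bar>Cp\<bar>"
        using hz 2 order_trans[OF Cp[of m] mult_right_mono[OF abs_ge_self]]
        by (simp add: norm_divide divide_le_eq add.commute)
      \<comment> \<open>For n > 0 the quotient H_{n+1} / H_n itself grows; the recurrence trades it
        for H_{n-1} / H_n, which is bounded.\<close>
      have "hankel1 (n + 1) x = 2 * of_int n / of_real x * hankel1 n x - hankel1 (int m) x"
        using hankel1_recurrence[OF x, of "int m"] 2 by (simp add: add.assoc)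
      then have "dtn_symbol n x = - (of_int n / of_real x) + hankel1 (int m) x / hankel1 n x"
        unfolding dtn_symbol_eq[OF x] using hz by (simp add: field_simps)
      then have "norm (dtn_symbol n x) \<le> norm (- (of_int n / complex_of_real x)) + norm (hankel1 (int m) x / hankel1 n x)"
        by (simp only: norm_triangle_ineq)
      also have "norm (- (of_int n / complex_of_real x)) = \<bar>real_of_int n\<bar> / x" using x by (simp add: norm_divide)
      finally have "norm (dtn_symbol n x) \<le> \<bar>real_of_int n\<bar> * (1 / x) + \<bar>Cp\<bar>" using r by simp
      also have "\<dots> \<le> \<bar>real_of_int n\<bar> * C + C"
        using Cge by (intro add_mono mult_left_mono) auto
      finally show ?thesis by (simp add: algebra_simps)
    next
      case (3 m)
      have hz: "hankel1 n x \<noteq> 0" using hankel1_nonzero x by blast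
      have n1: "n + 1 = - int m" using 3 by simp
      have r: "norm (hankel1 (n + 1) x / hankel1 n x) \<le> \<bar>Cm\<bar>"
      proof -
        have n': "- int (m + 1) = n" using 3 by simp
        show ?thesis
          using hz order_trans[OF Cm[of m, unfolded n'] mult_right_mono[OF abs_ge_self]] unfolding n1
          by (simp add: norm_divide divide_le_eq)
      qed
      have "norm (dtn_symbol n x) \<le> norm (of_int n / complex_of_real x) + norm (hankel1 (n + 1) x / hankel1 n x)"
        unfolding dtn_symbol_eq[OF x] by (rule norm_triangle_ineq4)
      also have "norm (of_int n / complex_of_real x) = \<bar>real_of_int n\<bar> / x" using x by (simp add: norm_divide)
      finally have "norm (dtn_symbol n x) \<le> \<bar>real_of_int n\<bar> * (1 / x) + \<bar>Cm\<bar>" using r by simp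
      also have "\<dots> \<le> \<bar>real_of_int n\<bar> * C + C"
        using Cge by (intro add_mono mult_left_mono) auto
      finally show ?thesis by (simp add: algebra_simps)
    qed
  qed
  with C0 that show thesis by blast
qed

section \<open>Fourier series and the radiation condition\<close>

text \<open>Left without the factor 1 / (2 pi), to match the integral in \<open>dtn_term\<close>;
  the factor reappears in the Parseval and Bessel formulas.\<close>

definition fourier_coeff :: "(real \<Rightarrow> complex) \<Rightarrow> int \<Rightarrow> complex" where
  "fourier_coeff f n = integral {0..2*pi} (\<lambda>\<theta>. f \<theta> * cis (- (of_int n * \<theta>)))"

lemma integrable_continuous_UNIV:
  fixes f :: "real \<Rightarrow> 'a::banach"
  shows "continuous_on UNIV f \<Longrightarrow> f integrable_on {a..b}"
  by (rule integrable_continuous_real) (erule continuous_on_subset[OF _ subset_UNIV])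

lemma integral_of_real_continuous:
  fixes f :: "real \<Rightarrow> real"
  assumes "continuous_on UNIV f"
  shows "integral {a..b} (\<lambda>x. complex_of_real (f x)) = of_real (integral {a..b} f)"
proof -
  have "bounded_linear complex_of_real" by (rule bounded_linear_of_real)
  from integral_linear[OF integrable_continuous_UNIV[OF assms] this] show ?thesis by (simp add: o_def)
qed

lemma has_integral_cis:
  "((\<lambda>\<theta>. cis (of_int n * \<theta>)) has_integral (if n = 0 then of_real (2 * pi) else 0)) {0..2*pi}"
proof (cases "n = 0")
  case True
  then show ?thesis
    using has_integral_const_real[of "1::complex" 0 "2*pi"] by (simp add: scaleR_conv_of_real)
next
  case False
  define F where "F \<theta> = cis (of_int n * \<theta>) / (\<i> * of_int n)" for \<theta>
  have "(F has_vector_derivative cis (of_int n * \<theta>)) (at \<theta> within {0..2*pi})" for \<theta>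
  proof -
    have "((\<lambda>z. exp (\<i> * of_int n * z) / (\<i> * of_int n)) has_field_derivative exp (\<i> * of_int n * of_real \<theta>)) (at (of_real \<theta>))"
      using False by (auto intro!: derivative_eq_intros)
    from has_vector_derivative_real_field[OF this]
    have "((\<lambda>\<theta>. exp (\<i> * of_int n * of_real \<theta>) / (\<i> * of_int n)) has_vector_derivative exp (\<i> * of_int n * of_real \<theta>)) (at \<theta>)"
      by simp
    then show ?thesis unfolding F_def [abs_def] cis_conv_exp
      by (simp add: has_vector_derivative_at_within mult.assoc)
  qed
  then have "((\<lambda>\<theta>. cis (of_int n * \<theta>)) has_integral F (2*pi) - F 0) {0..2*pi}"
    by (intro fundamental_theorem_of_calculus) auto
  moreover have "cis (of_int n * (2 * pi)) = 1"
    using cis_multiple_2pi[of "of_int n"] by (simp add: mult_ac)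
  then have "F (2*pi) - F 0 = 0" by (simp add: F_def)
  ultimately show ?thesis using False by simp
qed

lemma fourier_coeff_add:
  assumes "continuous_on UNIV f" "continuous_on UNIV g"
  shows "fourier_coeff (\<lambda>\<theta>. f \<theta> + g \<theta>) n = fourier_coeff f n + fourier_coeff g n"
  unfolding fourier_coeff_def using assms
  by (simp add: distrib_right integral_add integrable_continuous_UNIV continuous_intros)

lemma fourier_coeff_diff:
  assumes "continuous_on UNIV f" "continuous_on UNIV g"
  shows "fourier_coeff (\<lambda>\<theta>. f \<theta> - g \<theta>) n = fourier_coeff f n - fourier_coeff g n"
  unfolding fourier_coeff_def using assms
  by (simp add: left_diff_distrib integral_diff integrable_continuous_UNIV continuous_intros)

lemma fourier_coeff_cmult: "fourier_coeff (\<lambda>\<theta>. c * f \<theta>) n = c * fourier_coeff f n"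
  unfolding fourier_coeff_def by (simp add: mult.assoc)

lemma fourier_coeff_cis: "fourier_coeff (\<lambda>\<theta>. f \<theta> * cis (of_int m * \<theta>)) n = fourier_coeff f (n - m)"
  unfolding fourier_coeff_def
  by (intro integral_cong) (simp add: mult.assoc cis_mult algebra_simps)

lemma integral_mult_cnj_trig:
  assumes f: "continuous_on UNIV f" and "finite F"
  shows "integral {0..2*pi} (\<lambda>\<theta>. f \<theta> * cnj (\<Sum>n\<in>F. c n * cis (of_int n * \<theta>)))
     = (\<Sum>n\<in>F. cnj (c n) * fourier_coeff f n)"
proof -
  have "integral {0..2*pi} (\<lambda>\<theta>. f \<theta> * cnj (\<Sum>n\<in>F. c n * cis (of_int n * \<theta>)))
     = integral {0..2*pi} (\<lambda>\<theta>. \<Sum>n\<in>F. cnj (c n) * (f \<theta> * cis (- (of_int n * \<theta>))))"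
    by (intro integral_cong) (simp add: cnj_sum sum_distrib_left cis_cnj mult_ac)
  also have "\<dots> = (\<Sum>n\<in>F. integral {0..2*pi} (\<lambda>\<theta>. cnj (c n) * (f \<theta> * cis (- (of_int n * \<theta>)))))"
    using f assms by (intro integral_sum integrable_continuous_UNIV continuous_intros)
  finally show ?thesis by (simp add: fourier_coeff_def)
qed

lemma fourier_coeff_trig:
  assumes "finite F" "n \<in> F"
  shows "fourier_coeff (\<lambda>\<theta>. \<Sum>m\<in>F. c m * cis (of_int m * \<theta>)) n = of_real (2 * pi) * c n"
proof -
  have "fourier_coeff (\<lambda>\<theta>. \<Sum>m\<in>F. c m * cis (of_int m * \<theta>)) n
     = integral {0..2*pi} (\<lambda>\<theta>. \<Sum>m\<in>F. c m * cis (of_int (m - n) * \<theta>))"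
    unfolding fourier_coeff_def
    by (intro integral_cong) (simp add: sum_distrib_right mult.assoc cis_mult left_diff_distrib)
  also have "\<dots> = (\<Sum>m\<in>F. c m * (if m - n = 0 then of_real (2 * pi) else 0))"
    by (intro integral_unique has_integral_sum has_integral_mult_right has_integral_cis assms)
  also have "\<dots> = (\<Sum>m\<in>F. if m = n then of_real (2 * pi) * c m else 0)"
    by (intro sum.cong) auto
  finally show ?thesis using assms by simp
qed

lemma integral_norm_square_trig:
  assumes "finite F"
  shows "integral {0..2*pi} (\<lambda>\<theta>. (norm (\<Sum>n\<in>F. c n * cis (of_int n * \<theta>)))\<^sup>2) = 2 * pi * (\<Sum>n\<in>F. (norm (c n))\<^sup>2)"
proof -
  let ?s = "\<lambda>\<theta>. \<Sum>n\<in>F. c n * cis (of_int n * \<theta>)"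
  have s: "continuous_on UNIV ?s" by (intro continuous_intros)
  have "complex_of_real (integral {0..2*pi} (\<lambda>\<theta>. (norm (?s \<theta>))\<^sup>2)) = integral {0..2*pi} (\<lambda>\<theta>. of_real ((norm (?s \<theta>))\<^sup>2))"
    by (rule integral_of_real_continuous [symmetric]) (intro continuous_intros)
  also have "\<dots> = integral {0..2*pi} (\<lambda>\<theta>. ?s \<theta> * cnj (?s \<theta>))"
    unfolding complex_norm_square ..
  also have "\<dots> = (\<Sum>n\<in>F. cnj (c n) * (of_real (2 * pi) * c n))"
    unfolding integral_mult_cnj_trig[OF s assms]
    by (intro sum.cong refl) (simp add: fourier_coeff_trig assms)
  also have "\<dots> = of_real (2 * pi * (\<Sum>n\<in>F. (norm (c n))\<^sup>2))"
    unfolding of_real_mult of_real_sum complex_norm_square sum_distrib_left by (simp add: mult_ac)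
  finally show ?thesis by (simp only: of_real_eq_iff)
qed

lemma bessel_inequality:
  assumes f: "continuous_on UNIV f" and F: "finite F"
  shows "(\<Sum>n\<in>F. (norm (fourier_coeff f n))\<^sup>2) \<le> 2 * pi * integral {0..2*pi} (\<lambda>\<theta>. (norm (f \<theta>))\<^sup>2)"
proof -
  define c where "c n = fourier_coeff f n / of_real (2 * pi)" for n
  let ?s = "\<lambda>\<theta>. \<Sum>n\<in>F. c n * cis (of_int n * \<theta>)"
  have s: "continuous_on UNIV ?s" by (intro continuous_intros)
  note int = integrable_continuous_UNIV continuous_intros f s
  have "integral {0..2*pi} (\<lambda>\<theta>. Re (f \<theta> * cnj (?s \<theta>))) = Re (integral {0..2*pi} (\<lambda>\<theta>. f \<theta> * cnj (?s \<theta>)))"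
    by (rule integral_linear[OF _ bounded_linear_Re, unfolded o_def]) (intro int)
  also have "\<dots> = Re (\<Sum>n\<in>F. of_real ((norm (fourier_coeff f n))\<^sup>2 / (2 * pi)))"
    unfolding integral_mult_cnj_trig[OF f F] of_real_divide complex_norm_square
    by (simp add: c_def mult.commute)
  also have "\<dots> = (\<Sum>n\<in>F. (norm (fourier_coeff f n))\<^sup>2) / (2 * pi)"
    by (simp add: sum_divide_distrib)
  finally have cross: "integral {0..2*pi} (\<lambda>\<theta>. Re (f \<theta> * cnj (?s \<theta>))) = (\<Sum>n\<in>F. (norm (fourier_coeff f n))\<^sup>2) / (2 * pi)" .
  have sq: "integral {0..2*pi} (\<lambda>\<theta>. (norm (?s \<theta>))\<^sup>2) = (\<Sum>n\<in>F. (norm (fourier_coeff f n))\<^sup>2) / (2 * pi)"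
    unfolding integral_norm_square_trig[OF F]
    by (simp add: c_def norm_divide power_divide sum_divide_distrib[symmetric] field_simps power2_eq_square)
  have "0 \<le> integral {0..2*pi} (\<lambda>\<theta>. (norm (f \<theta> - ?s \<theta>))\<^sup>2)"
    by (intro integral_nonneg int) auto
  also have "\<dots> = integral {0..2*pi} (\<lambda>\<theta>. (norm (f \<theta>))\<^sup>2 - 2 * Re (f \<theta> * cnj (?s \<theta>)) + (norm (?s \<theta>))\<^sup>2)"
  proof -
    have "(norm (a - b))\<^sup>2 = (norm a)\<^sup>2 - 2 * Re (a * cnj b) + (norm b)\<^sup>2" for a b :: complex
      unfolding cmod_power2 by (simp add: power2_eq_square algebra_simps)
    then show ?thesis by (simp only:)
  qed
  also have "\<dots> = integral {0..2*pi} (\<lambda>\<theta>. (norm (f \<theta>))\<^sup>2) - 2 * integral {0..2*pi} (\<lambda>\<theta>. Re (f \<theta> * cnj (?s \<theta>)))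
      + integral {0..2*pi} (\<lambda>\<theta>. (norm (?s \<theta>))\<^sup>2)"
  proof -
    have i: "(\<lambda>\<theta>. (norm (f \<theta>))\<^sup>2) integrable_on {0..2*pi}" "(\<lambda>\<theta>. 2 * Re (f \<theta> * cnj (?s \<theta>))) integrable_on {0..2*pi}"
      "(\<lambda>\<theta>. (norm (?s \<theta>))\<^sup>2) integrable_on {0..2*pi}"
      by (intro int)+
    show ?thesis
      unfolding integral_add[OF integrable_diff[OF i(1,2)] i(3)] integral_diff[OF i(1,2)] integral_mult_right ..
  qed
  also have "\<dots> = integral {0..2*pi} (\<lambda>\<theta>. (norm (f \<theta>))\<^sup>2) - (\<Sum>n\<in>F. (norm (fourier_coeff f n))\<^sup>2) / (2 * pi)"
    unfolding cross sq by (simp add: field_simps)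
  finally show ?thesis by (simp add: field_simps)
qed

lemma Im_integral:
  fixes f :: "real \<Rightarrow> complex"
  assumes "continuous_on UNIV f"
  shows "Im (integral {a..b} f) = integral {a..b} (\<lambda>\<theta>. Im (f \<theta>))"
  using integral_linear[OF integrable_continuous_UNIV[OF assms] bounded_linear_Im]
  by (simp add: o_def)

lemma symmetric_int_interval_mono: "M \<le> N \<Longrightarrow> {- int M..int M} \<subseteq> {- int N..int N}" by auto

text \<open>Fatou's lemma upgrades pointwise convergence to convergence in the mean once the
  coefficients are square summable.\<close>

lemma trig_series_L2_limit:
  fixes g :: "real \<Rightarrow> complex" and c :: "int \<Rightarrow> complex"
  defines "S \<equiv> \<lambda>N \<theta>. \<Sum>n\<in>{-int N..int N}. c n * cis (of_int n * \<theta>)"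
  assumes g: "continuous_on UNIV g"
    and lim: "\<And>\<theta>. (\<lambda>N. S N \<theta>) \<longlonglongrightarrow> g \<theta>"
    and bound: "\<And>N. (\<Sum>n\<in>{-int N..int N}. (norm (c n))\<^sup>2) \<le> K"
  shows "(\<lambda>N. integral {0..2*pi} (\<lambda>\<theta>. (norm (g \<theta> - S N \<theta>))\<^sup>2)) \<longlonglongrightarrow> 0"
proof -
  define B where "B N = (\<Sum>n\<in>{-int N..int N}. (norm (c n))\<^sup>2)" for N
  have S: "continuous_on UNIV (S N)" for N unfolding S_def by (intro continuous_intros)
  have "incseq B"
    unfolding B_def incseq_def by (intro allI impI sum_mono2 symmetric_int_interval_mono) auto
  moreover have "bdd_above (range B)" using bound unfolding B_def by (intro bdd_aboveI[of _ K]) auto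
  ultimately obtain b where b: "B \<longlonglongrightarrow> b" "\<And>N. B N \<le> b"
    by (metis LIMSEQ_incseq_SUP cSUP_upper UNIV_I)
  \<comment> \<open>Orthogonality turns the distance of two partial sums into a difference of values
    of B. Its bound through the limit b no longer depends on M, so it can survive M tending to
    infinity with N fixed.\<close>
  have SM: "integral {0..2*pi} (\<lambda>\<theta>. (norm (S M \<theta> - S N \<theta>))\<^sup>2) \<le> 2 * pi * (b - B N)" if "M \<ge> N" for M N
  proof -
    have sub: "{- int N..int N} \<subseteq> {- int M..int M}" using that by auto
    have "S M \<theta> - S N \<theta> = (\<Sum>n\<in>{-int M..int M} - {-int N..int N}. c n * cis (of_int n * \<theta>))" for \<theta>
      unfolding S_def by (rule sum_diff[symmetric]) (use sub in auto)
    then have "integral {0..2*pi} (\<lambda>\<theta>. (norm (S M \<theta> - S N \<theta>))\<^sup>2) =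
       2 * pi * (\<Sum>n\<in>{-int M..int M} - {-int N..int N}. (norm (c n))\<^sup>2)"
      by (simp add: integral_norm_square_trig)
    also have "\<dots> = 2 * pi * (B M - B N)"
      unfolding B_def by (subst sum_diff) (use sub in auto)
    also have "\<dots> \<le> 2 * pi * (b - B N)" using b(2)[of M] by simp
    finally show ?thesis .
  qed
  have nn: "(\<integral>\<^sup>+\<theta>. indicator {0..2*pi} \<theta> * ennreal ((norm (h \<theta>))\<^sup>2) \<partial>lborel)
      = ennreal (integral {0..2*pi} (\<lambda>\<theta>. (norm (h \<theta>))\<^sup>2))" if h: "continuous_on UNIV h" for h :: "real \<Rightarrow> complex"
  proof -
    have "((\<lambda>\<theta>. (norm (h \<theta>))\<^sup>2) has_integral integral {0..2*pi} (\<lambda>\<theta>. (norm (h \<theta>))\<^sup>2)) {0..2*pi}"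
      by (intro integrable_integral integrable_continuous_UNIV continuous_intros h)
    from nn_integral_has_integral_lebesgue[OF _ this] show ?thesis
      by (simp add: ennreal_mult' ennreal_indicator)
  qed
  have le: "integral {0..2*pi} (\<lambda>\<theta>. (norm (g \<theta> - S N \<theta>))\<^sup>2) \<le> 2 * pi * (b - B N)" for N
  proof -
    have ms: "(\<lambda>\<theta>. indicator {0..2*pi} \<theta> * ennreal ((norm (S M \<theta> - S N \<theta>))\<^sup>2)) \<in> borel_measurable lborel" for M
    proof -
      have "(\<lambda>\<theta>. (norm (S M \<theta> - S N \<theta>))\<^sup>2) \<in> borel_measurable borel"
        by (intro borel_measurable_continuous_onI continuous_intros S)
      then show ?thesis by measurable
    qed
    have lim': "(\<lambda>M. indicator {0..2*pi} \<theta> * ennreal ((norm (S M \<theta> - S N \<theta>))\<^sup>2)) \<longlonglongrightarrow>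
       indicator {0..2*pi} \<theta> * ennreal ((norm (g \<theta> - S N \<theta>))\<^sup>2)" for \<theta>
      by (cases "\<theta> \<in> {0..2*pi}") (auto intro!: tendsto_intros lim)
    have "ennreal (integral {0..2*pi} (\<lambda>\<theta>. (norm (g \<theta> - S N \<theta>))\<^sup>2))
       = (\<integral>\<^sup>+\<theta>. indicator {0..2*pi} \<theta> * ennreal ((norm (g \<theta> - S N \<theta>))\<^sup>2) \<partial>lborel)"
      by (rule nn[symmetric]) (intro continuous_intros g S)
    also have "\<dots> = (\<integral>\<^sup>+\<theta>. liminf (\<lambda>M. indicator {0..2*pi} \<theta> * ennreal ((norm (S M \<theta> - S N \<theta>))\<^sup>2)) \<partial>lborel)"
      by (intro nn_integral_cong lim_imp_Liminf[symmetric] lim') auto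
    also have "\<dots> \<le> liminf (\<lambda>M. \<integral>\<^sup>+\<theta>. indicator {0..2*pi} \<theta> * ennreal ((norm (S M \<theta> - S N \<theta>))\<^sup>2) \<partial>lborel)"
      by (rule nn_integral_liminf[OF ms])
    also have "\<dots> \<le> liminf (\<lambda>M::nat. ennreal (2 * pi * (b - B N)))"
    proof (rule Liminf_mono)
      show "\<forall>\<^sub>F M in sequentially. (\<integral>\<^sup>+\<theta>. indicator {0..2*pi} \<theta> * ennreal ((norm (S M \<theta> - S N \<theta>))\<^sup>2) \<partial>lborel)
          \<le> ennreal (2 * pi * (b - B N))"
        using eventually_ge_at_top[of N]
      proof eventually_elim
        case (elim M)
        show ?case
          by (subst nn) (intro continuous_intros S ennreal_leI SM elim)+
      qed
    qed
    also have "\<dots> = ennreal (2 * pi * (b - B N))" by (simp add: Liminf_const)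
    finally show ?thesis using b(2)[of N] by (simp add: ennreal_le_iff)
  qed
  have "(\<lambda>N. 2 * pi * (b - B N)) \<longlonglongrightarrow> 2 * pi * (b - b)" by (intro tendsto_intros b)
  then have "(\<lambda>N. 2 * pi * (b - B N)) \<longlonglongrightarrow> 0" by simp
  then have up: "(\<lambda>N. 2 * pi * (b - B N)) \<longlonglongrightarrow> 0" .
  have nonneg: "integral {0..2*pi} (\<lambda>\<theta>. (norm (g \<theta> - S N \<theta>))\<^sup>2) \<ge> 0" for N
    by (intro integral_nonneg integrable_continuous_UNIV continuous_intros g S) auto
  show ?thesis
    by (rule tendsto_sandwich[OF always_eventually[OF allI[OF nonneg]] always_eventually[OF allI[OF le]] tendsto_const up])
qed

text \<open>P, Q and g stand for p, its tangential and its normal derivative on the outer circle.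
  Bessel's inequality for Q makes n a_n square summable; with the linear bound on d the coefficients
  of the DtN series are square summable too, so its partial sums tend to g in the mean. The flux is
  then the limit of the sums of Im (d n) |a_n|^2 / (2 pi). Their terms are nonnegative, so a zero
  limit makes every a_n vanish.\<close>

lemma dtn_coeffs_vanish:
  fixes P Q g :: "real \<Rightarrow> complex" and d :: "int \<Rightarrow> complex"
  assumes P: "continuous_on UNIV P" and Q: "continuous_on UNIV Q" and g: "continuous_on UNIV g"
    and PQ: "\<And>n. fourier_coeff Q n = \<i> * of_int n * fourier_coeff P n"
    and d: "\<And>n. norm (d n) \<le> C * (1 + \<bar>real_of_int n\<bar>)" "\<And>n. Im (d n) > 0"
    and lim: "\<And>\<theta>. (\<lambda>N. \<Sum>n\<in>{-int N..int N}. d n * fourier_coeff P n / of_real (2 * pi) * cis (of_int n * \<theta>)) \<longlonglongrightarrow> g \<theta>"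
    and flux: "integral {0..2*pi} (\<lambda>\<theta>. Im (cnj (P \<theta>) * g \<theta>)) = 0"
  shows "fourier_coeff P n = 0"
proof -
  define a where "a = fourier_coeff P"
  define c where "c n = d n * a n / of_real (2 * pi)" for n
  define S where "S N \<theta> = (\<Sum>n\<in>{-int N..int N}. c n * cis (of_int n * \<theta>))" for N \<theta>
  have S: "continuous_on UNIV (S N)" for N unfolding S_def by (intro continuous_intros)
  define K where "K = 2 * C\<^sup>2 / (2 * pi)\<^sup>2 * (2 * pi * integral {0..2*pi} (\<lambda>\<theta>. (norm (P \<theta>))\<^sup>2)
     + 2 * pi * integral {0..2*pi} (\<lambda>\<theta>. (norm (Q \<theta>))\<^sup>2))"
  \<comment> \<open>Uses (1 + |n|)^2 \<le> 2 (1 + n^2), where n^2 |a_n|^2 is the squared modulus of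
    the coefficient of Q.\<close>
  have cn: "(norm (c n))\<^sup>2 \<le> 2 * C\<^sup>2 / (2 * pi)\<^sup>2 * ((norm (fourier_coeff P n))\<^sup>2 + (norm (fourier_coeff Q n))\<^sup>2)" for n
  proof -
    let ?n = "\<bar>real_of_int n\<bar>"
    have "(norm (d n))\<^sup>2 \<le> (C * (1 + ?n))\<^sup>2" by (intro power_mono d) auto
    also have "\<dots> \<le> C\<^sup>2 * (2 * (1 + ?n\<^sup>2))"
      unfolding power_mult_distrib
      using sum_squares_bound[of 1 ?n] by (intro mult_left_mono) (auto simp: power2_eq_square algebra_simps)
    finally have "(norm (d n))\<^sup>2 * (norm (a n))\<^sup>2 \<le> C\<^sup>2 * (2 * (1 + ?n\<^sup>2)) * (norm (a n))\<^sup>2"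
      by (intro mult_right_mono) auto
    also have "\<dots> = 2 * C\<^sup>2 * ((norm (fourier_coeff P n))\<^sup>2 + (norm (fourier_coeff Q n))\<^sup>2)"
      unfolding PQ a_def by (simp add: norm_mult power_mult_distrib algebra_simps)
    finally have "(norm (d n))\<^sup>2 * (norm (a n))\<^sup>2 / (2 * pi)\<^sup>2 \<le> 2 * C\<^sup>2 * ((norm (fourier_coeff P n))\<^sup>2 + (norm (fourier_coeff Q n))\<^sup>2) / (2 * pi)\<^sup>2"
      by (intro divide_right_mono) auto
    then show ?thesis by (simp add: c_def norm_divide norm_mult power_divide power_mult_distrib)
  qed
  have bound: "(\<Sum>n\<in>{-int N..int N}. (norm (c n))\<^sup>2) \<le> K" for N
  proof -
    have "(\<Sum>n\<in>{-int N..int N}. (norm (c n))\<^sup>2) \<le> (\<Sum>n\<in>{-int N..int N}. 2 * C\<^sup>2 / (2 * pi)\<^sup>2 * ((norm (fourier_coeff P n))\<^sup>2 + (norm (fourier_coeff Q n))\<^sup>2))"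
      by (intro sum_mono cn)
    also have "\<dots> = 2 * C\<^sup>2 / (2 * pi)\<^sup>2 * ((\<Sum>n\<in>{-int N..int N}. (norm (fourier_coeff P n))\<^sup>2) + (\<Sum>n\<in>{-int N..int N}. (norm (fourier_coeff Q n))\<^sup>2))"
      by (simp only: sum_distrib_left[symmetric] sum.distrib)
    also have "\<dots> \<le> K"
      unfolding K_def by (intro mult_left_mono add_mono bessel_inequality P Q) auto
    finally show ?thesis .
  qed
  have L2: "(\<lambda>N. integral {0..2*pi} (\<lambda>\<theta>. (norm (g \<theta> - S N \<theta>))\<^sup>2)) \<longlonglongrightarrow> 0"
    unfolding S_def by (rule trig_series_L2_limit[OF g _ bound]) (use lim in \<open>simp add: c_def a_def\<close>)
  define I where "I N = (\<Sum>n\<in>{-int N..int N}. Im (d n) * (norm (a n))\<^sup>2 / (2 * pi))" for N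
  have IS: "I N = - integral {0..2*pi} (\<lambda>\<theta>. Im (P \<theta> * cnj (S N \<theta>)))" for N
  proof -
    have "integral {0..2*pi} (\<lambda>\<theta>. Im (P \<theta> * cnj (S N \<theta>))) = Im (integral {0..2*pi} (\<lambda>\<theta>. P \<theta> * cnj (S N \<theta>)))"
      by (rule Im_integral[symmetric]) (intro continuous_intros P S)
    also have "\<dots> = Im (\<Sum>n\<in>{-int N..int N}. cnj (c n) * a n)"
      unfolding S_def a_def by (subst integral_mult_cnj_trig[OF P]) auto
    also have "\<dots> = (\<Sum>n\<in>{-int N..int N}. - (Im (d n) * (norm (a n))\<^sup>2 / (2 * pi)))"
    proof -
      have "cnj (c n) * a n = cnj (d n) * of_real ((norm (a n))\<^sup>2 / (2 * pi))" for n
        unfolding of_real_divide complex_norm_square by (simp add: c_def)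
      then have "Im (cnj (c n) * a n) = - (Im (d n) * (norm (a n))\<^sup>2 / (2 * pi))" for n
        by (simp del: of_real_divide)
      then show ?thesis by simp
    qed
    finally show ?thesis by (simp add: I_def sum_negf)
  qed
  define E where "E N = integral {0..2*pi} (\<lambda>\<theta>. (norm (g \<theta> - S N \<theta>))\<^sup>2)" for N
  define p2 where "p2 = integral {0..2*pi} (\<lambda>\<theta>. (norm (P \<theta>))\<^sup>2)"
  have p2: "p2 \<ge> 0" unfolding p2_def by (intro integral_nonneg integrable_continuous_UNIV continuous_intros P) auto
  note int = integrable_continuous_UNIV continuous_intros P g S
  \<comment> \<open>In place of Cauchy-Schwarz for integrals: x y \<le> e x^2 + y^2 / (4 e)
    pointwise, with e left free until the limit is taken.\<close>
  have IE: "I N \<le> e * p2 + E N / (4 * e)" if e: "e > 0" for N e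
  proof -
    have "I N = integral {0..2*pi} (\<lambda>\<theta>. Im (P \<theta> * cnj (g \<theta>))) - integral {0..2*pi} (\<lambda>\<theta>. Im (P \<theta> * cnj (S N \<theta>)))"
    proof -
      have "Im (P \<theta> * cnj (g \<theta>)) = - Im (cnj (P \<theta>) * g \<theta>)" for \<theta> by simp
      then show ?thesis using flux IS by (simp only: integral_neg)
    qed
    also have "\<dots> = integral {0..2*pi} (\<lambda>\<theta>. Im (P \<theta> * cnj (g \<theta>)) - Im (P \<theta> * cnj (S N \<theta>)))"
      by (rule integral_diff[symmetric]) (intro int)+
    also have "\<dots> \<le> integral {0..2*pi} (\<lambda>\<theta>. e * (norm (P \<theta>))\<^sup>2 + (norm (g \<theta> - S N \<theta>))\<^sup>2 / (4 * e))"
    proof (rule integral_le)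
      fix \<theta>
      let ?x = "norm (P \<theta>)" and ?y = "norm (g \<theta> - S N \<theta>)"
      have "Im (P \<theta> * cnj (g \<theta>)) - Im (P \<theta> * cnj (S N \<theta>)) = Im (P \<theta> * cnj (g \<theta> - S N \<theta>))"
        by (simp add: algebra_simps)
      also have "\<dots> \<le> norm (P \<theta> * cnj (g \<theta> - S N \<theta>))" using abs_Im_le_cmod abs_le_D1 by blast
      also have "\<dots> = ?x * ?y" by (metis complex_mod_cnj norm_mult)
      also have "\<dots> \<le> e * ?x\<^sup>2 + ?y\<^sup>2 / (4 * e)"
      proof -
        have "0 \<le> (2 * e * ?x - ?y)\<^sup>2" by simp
        also have "\<dots> = (e * ?x\<^sup>2 + ?y\<^sup>2 / (4 * e) - ?x * ?y) * (4 * e)"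
          using e by (simp add: field_simps power2_eq_square)
        finally show ?thesis using e by (simp add: zero_le_mult_iff)
      qed
      finally show "Im (P \<theta> * cnj (g \<theta>)) - Im (P \<theta> * cnj (S N \<theta>)) \<le> e * ?x\<^sup>2 + ?y\<^sup>2 / (4 * e)" .
    next
      show "(\<lambda>\<theta>. Im (P \<theta> * cnj (g \<theta>)) - Im (P \<theta> * cnj (S N \<theta>))) integrable_on {0..2 * pi}"
        by (intro int)
      show "(\<lambda>\<theta>. e * (norm (P \<theta>))\<^sup>2 + (norm (g \<theta> - S N \<theta>))\<^sup>2 / (4 * e)) integrable_on {0..2 * pi}"
        by (rule integrable_continuous_UNIV, intro continuous_intros P g S) (use e in simp)
    qed
    also have "\<dots> = e * p2 + E N / (4 * e)"
    proof -
      have i: "(\<lambda>\<theta>. e * (norm (P \<theta>))\<^sup>2) integrable_on {0..2*pi}" by (intro int)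
      have i': "(\<lambda>\<theta>. (norm (g \<theta> - S N \<theta>))\<^sup>2 / (4 * e)) integrable_on {0..2*pi}"
        by (rule integrable_continuous_UNIV, intro continuous_intros P g S) (use e in simp)
      show ?thesis unfolding integral_add[OF i i'] by (simp add: p2_def E_def)
    qed
    finally show ?thesis .
  qed
  have I0: "(\<lambda>N. I N) \<longlonglongrightarrow> 0"
  proof (rule LIMSEQ_I)
    fix r :: real assume r: "r > 0"
    \<comment> \<open>Splits r into halves: e p2 \<le> r / 2, with p2 + 1 guarding against p2 = 0,
      while E N is eventually small enough for the other half.\<close>
    define e where "e = r / (2 * (p2 + 1))"
    have e: "e > 0" using r p2 by (simp add: e_def)
    have "\<forall>\<^sub>F N in sequentially. E N < r / 2 * (4 * e)"
      using L2[folded E_def] e r by (intro order_tendstoD(2)[of E 0]) auto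
    then obtain N0 where N0: "\<And>N. N \<ge> N0 \<Longrightarrow> E N < r / 2 * (4 * e)" by (auto simp: eventually_sequentially)
    have "norm (I N - 0) < r" if "N \<ge> N0" for N
    proof -
      have "I N \<ge> 0" unfolding I_def using d(2) by (intro sum_nonneg) (simp add: less_imp_le)
      moreover have "E N / (4 * e) < r / 2" using N0[OF that] e by (simp add: field_simps)
      moreover have "e * p2 \<le> r / 2"
      proof -
        have "e * p2 \<le> e * (p2 + 1)" using e by simp
        also have "\<dots> = r / 2" using p2 unfolding e_def by (simp add: divide_simps)
        finally show ?thesis .
      qed
      ultimately show ?thesis using IE[OF e, of N] by simp
    qed
    then show "\<exists>no. \<forall>n\<ge>no. norm (I n - 0) < r" by blast
  qed
  have "Im (d n) * (norm (a n))\<^sup>2 / (2 * pi) \<le> I N" if "N \<ge> nat \<bar>n\<bar>" for N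
  proof -
    have "n \<in> {- int N..int N}" using that by auto
    then show ?thesis
      unfolding I_def using d(2) by (intro member_le_sum) (auto simp: less_imp_le)
  qed
  then have "Im (d n) * (norm (a n))\<^sup>2 / (2 * pi) \<le> 0"
    by (intro LIMSEQ_le_const[OF I0]) blast
  then have "(norm (a n))\<^sup>2 \<le> 0" using d(2)[of n] pi_gt_zero by (auto simp: mult_le_0_iff divide_le_0_iff)
  then show ?thesis by (simp add: a_def)
qed

text \<open>Stone-Weierstrass approximates cnj F uniformly on the circle by a polynomial q in the
  plane coordinates. The integral of F q vanishes, so the integral of |F|^2 is at most a multiple of
  the error. Taking F on the circle itself builds in the periodicity.\<close>

lemma fourier_uniqueness:
  fixes F :: "complex \<Rightarrow> complex"
  assumes F: "continuous_on (sphere 0 1) F"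
    and coeff: "\<And>n. fourier_coeff (\<lambda>\<theta>. F (cis \<theta>)) n = 0" and z: "z \<in> sphere 0 1"
  shows "F z = 0"
proof -
  have cont_poly: "continuous_on UNIV (\<lambda>\<theta>. h (cis \<theta>))" if "real_polynomial_function h" for h
    by (rule continuous_on_compose2[OF continuous_on_polymonial_function[of h UNIV]])
       (use that in \<open>auto simp: real_polynomial_function_eq intro: continuous_intros\<close>)
  \<comment> \<open>Stated for every \<phi> with vanishing coefficients, not just for F:
    multiplication by a polynomial stays within this class, which is what the case of a product of
    two polynomials consumes.\<close>
  have mult: "fourier_coeff (\<lambda>\<theta>. \<phi> \<theta> * of_real (h (cis \<theta>))) n = 0"
    if "real_polynomial_function h" "continuous_on UNIV \<phi>" "\<And>n. fourier_coeff \<phi> n = 0" for h \<phi> n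
    using that
  proof (induction h arbitrary: \<phi> n)
    case (linear h)
    interpret h: bounded_linear h by fact
    define A where "A = (of_real (h 1) - \<i> * of_real (h \<i>)) / 2"
    define B where "B = (of_real (h 1) + \<i> * of_real (h \<i>)) / 2"
    \<comment> \<open>On the circle a real-linear functional is a combination of cis \<theta> and
      cis (-\<theta>), so multiplying by it shifts the coefficients by 1 in either
      direction.\<close>
    have hc: "complex_of_real (h (cis \<theta>)) = A * cis (of_int 1 * \<theta>) + B * cis (of_int (-1) * \<theta>)" for \<theta>
    proof -
      have "cis \<theta> = cos \<theta> *\<^sub>R 1 + sin \<theta> *\<^sub>R \<i>" by (simp add: complex_eq_iff)
      then have "h (cis \<theta>) = cos \<theta> * h 1 + sin \<theta> * h \<i>" by (simp only: h.add h.scaleR real_scaleR_def)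
      then show ?thesis by (simp add: A_def B_def complex_eq_iff field_simps)
    qed
    have "fourier_coeff (\<lambda>\<theta>. \<phi> \<theta> * of_real (h (cis \<theta>))) n
       = fourier_coeff (\<lambda>\<theta>. A * (\<phi> \<theta> * cis (of_int 1 * \<theta>)) + B * (\<phi> \<theta> * cis (of_int (-1) * \<theta>))) n"
      unfolding hc by (simp add: algebra_simps)
    also have "\<dots> = A * fourier_coeff \<phi> (n - 1) + B * fourier_coeff \<phi> (n - (-1))"
      by (subst fourier_coeff_add)
         (intro continuous_intros linear, intro continuous_intros linear,
          simp only: fourier_coeff_cmult fourier_coeff_cis)
    finally show ?case using linear by simp
  next
    case (const c)
    have "fourier_coeff (\<lambda>\<theta>. of_real c * \<phi> \<theta>) n = 0" unfolding fourier_coeff_cmult const by simp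
    then show ?case by (simp add: mult.commute)
  next
    case (add h1 h2)
    have c: "continuous_on UNIV (\<lambda>\<theta>. \<phi> \<theta> * of_real (h (cis \<theta>)))" if "real_polynomial_function h" for h
      by (intro continuous_intros add cont_poly that)
    have "fourier_coeff (\<lambda>\<theta>. \<phi> \<theta> * of_real (h1 (cis \<theta>)) + \<phi> \<theta> * of_real (h2 (cis \<theta>))) n = 0"
      using add by (subst fourier_coeff_add) (auto intro: c)
    then show ?case by (simp add: distrib_left)
  next
    case (mult h1 h2)
    have c: "continuous_on UNIV (\<lambda>\<theta>. \<phi> \<theta> * of_real (h (cis \<theta>)))" if "real_polynomial_function h" for h
      by (intro continuous_intros mult cont_poly that)
    have "fourier_coeff (\<lambda>\<theta>. (\<phi> \<theta> * of_real (h1 (cis \<theta>))) * of_real (h2 (cis \<theta>))) n = 0"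
      using mult by (intro mult(4) c) auto
    then show ?case by (simp add: mult.assoc)
  qed
  define \<phi> where "\<phi> \<theta> = F (cis \<theta>)" for \<theta>
  have \<phi>: "continuous_on UNIV \<phi>"
    unfolding \<phi>_def by (rule continuous_on_compose2[OF F]) (auto intro: continuous_intros)
  note int = integrable_continuous_UNIV continuous_intros \<phi>
  obtain M where M: "\<And>z. z \<in> sphere 0 1 \<Longrightarrow> norm (F z) \<le> M"
    using compact_imp_bounded[OF compact_continuous_image[OF F compact_sphere]] unfolding bounded_iff by blast
  have M0: "M \<ge> 0" using order_trans[OF norm_ge_zero M[of 1]] by simp
  define J where "J = integral {0..2*pi} (\<lambda>\<theta>. (norm (\<phi> \<theta>))\<^sup>2)"
  have Jle: "J \<le> e * (2 * pi * M)" if e: "e > 0" for e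
  proof -
    have "continuous_on (sphere 0 1) (\<lambda>z. cnj (F z))" by (intro continuous_intros F)
    from Stone_Weierstrass_polynomial_function[OF _ this e]
    obtain q where q: "polynomial_function q" "\<And>z. z \<in> sphere 0 1 \<Longrightarrow> norm (cnj (F z) - q z) < e" by auto
    have q': "real_polynomial_function (\<lambda>z. Re (q z))" "real_polynomial_function (\<lambda>z. Im (q z))"
      using q(1) bounded_linear_Re bounded_linear_Im unfolding polynomial_function_def o_def by blast+
    have qc: "continuous_on UNIV (\<lambda>\<theta>. q (cis \<theta>))"
      by (rule continuous_on_compose2[OF continuous_on_polymonial_function[OF q(1), of UNIV]])
         (auto intro: continuous_intros)
    have "integral {0..2*pi} (\<lambda>\<theta>. \<phi> \<theta> * q (cis \<theta>)) = integral {0..2*pi} (\<lambda>\<theta>. \<phi> \<theta> * of_real (Re (q (cis \<theta>))) + \<i> * (\<phi> \<theta> * of_real (Im (q (cis \<theta>)))))"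
    proof (rule integral_cong)
      fix \<theta>
      have "q (cis \<theta>) = of_real (Re (q (cis \<theta>))) + \<i> * of_real (Im (q (cis \<theta>)))" by (rule complex_eq)
      then show "\<phi> \<theta> * q (cis \<theta>) = \<phi> \<theta> * of_real (Re (q (cis \<theta>))) + \<i> * (\<phi> \<theta> * of_real (Im (q (cis \<theta>))))"
        by (metis distrib_left mult.left_commute)
    qed
    also have "\<dots> = integral {0..2*pi} (\<lambda>\<theta>. \<phi> \<theta> * of_real (Re (q (cis \<theta>)))) + \<i> * integral {0..2*pi} (\<lambda>\<theta>. \<phi> \<theta> * of_real (Im (q (cis \<theta>))))"
    proof -
      have i: "(\<lambda>\<theta>. \<phi> \<theta> * of_real (Re (q (cis \<theta>)))) integrable_on {0..2*pi}"
        "(\<lambda>\<theta>. \<i> * (\<phi> \<theta> * of_real (Im (q (cis \<theta>))))) integrable_on {0..2*pi}"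
        by (intro int qc)+
      show ?thesis unfolding integral_add[OF i] by simp
    qed
    also have "\<dots> = 0"
      using mult[OF q'(1) \<phi>, of 0] mult[OF q'(2) \<phi>, of 0] coeff
      by (simp add: \<phi>_def fourier_coeff_def)
    finally have 0: "integral {0..2*pi} (\<lambda>\<theta>. \<phi> \<theta> * q (cis \<theta>)) = 0" .
    have "complex_of_real J = integral {0..2*pi} (\<lambda>\<theta>. of_real ((norm (\<phi> \<theta>))\<^sup>2))"
      unfolding J_def by (rule integral_of_real_continuous [symmetric]) (intro continuous_intros \<phi>)
    also have "\<dots> = integral {0..2*pi} (\<lambda>\<theta>. \<phi> \<theta> * cnj (\<phi> \<theta>)) - integral {0..2*pi} (\<lambda>\<theta>. \<phi> \<theta> * q (cis \<theta>))"
      unfolding complex_norm_square 0 by simp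
    also have "\<dots> = integral {0..2*pi} (\<lambda>\<theta>. \<phi> \<theta> * cnj (\<phi> \<theta>) - \<phi> \<theta> * q (cis \<theta>))"
      by (rule integral_diff[symmetric]) (intro int qc)+
    finally have "norm (complex_of_real J) = norm (integral {0..2*pi} (\<lambda>\<theta>. \<phi> \<theta> * cnj (\<phi> \<theta>) - \<phi> \<theta> * q (cis \<theta>)))" by simp
    also have "\<dots> \<le> M * e * (2 * pi - 0)"
    proof (rule integral_bound)
      show "norm (\<phi> \<theta> * cnj (\<phi> \<theta>) - \<phi> \<theta> * q (cis \<theta>)) \<le> M * e" for \<theta>
      proof -
        have "norm (\<phi> \<theta> * cnj (\<phi> \<theta>) - \<phi> \<theta> * q (cis \<theta>)) = norm (\<phi> \<theta>) * norm (cnj (\<phi> \<theta>) - q (cis \<theta>))"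
          by (metis norm_mult right_diff_distrib)
        also have "\<dots> \<le> M * e"
          using M[of "cis \<theta>"] q(2)[of "cis \<theta>"] M0 unfolding \<phi>_def by (intro mult_mono) auto
        finally show ?thesis .
      qed
      show "continuous_on {0..2*pi} (\<lambda>\<theta>. \<phi> \<theta> * cnj (\<phi> \<theta>) - \<phi> \<theta> * q (cis \<theta>))"
        by (rule continuous_on_subset[OF _ subset_UNIV]) (intro continuous_intros \<phi> qc)
    qed simp
    finally show ?thesis by (simp add: mult_ac)
  qed
  have "J \<le> 0"
  proof (rule field_le_epsilon)
    fix e :: real assume e: "e > 0"
    have "J \<le> e / (2 * pi * M + 1) * (2 * pi * M)" using M0 e by (intro Jle) (simp add: add_nonneg_pos)
    also have "\<dots> = e * ((2 * pi * M) / (2 * pi * M + 1))" by simp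
    also have "\<dots> \<le> e * 1"
    proof (rule mult_left_mono)
      have "2 * pi * M \<ge> 0" using M0 by simp
      then have "2 * pi * M + 1 > 0" by linarith
      then show "(2 * pi * M) / (2 * pi * M + 1) \<le> 1" by (subst divide_le_eq_1_pos) auto
    qed (use e in simp)
    finally show "J \<le> 0 + e" by simp
  qed
  moreover have "J \<ge> 0" unfolding J_def by (intro integral_nonneg int) auto
  ultimately have "J = 0" by simp
  moreover have "((\<lambda>\<theta>. (norm (\<phi> \<theta>))\<^sup>2) has_integral J) {0..2*pi}"
    unfolding J_def by (intro integrable_integral int)
  ultimately have hi: "((\<lambda>\<theta>. (norm (\<phi> \<theta>))\<^sup>2) has_integral 0) (cbox 0 (2*pi))" by simp
  have cn: "continuous_on (cbox 0 (2*pi)) (\<lambda>\<theta>. (norm (\<phi> \<theta>))\<^sup>2)"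
    by (rule continuous_on_subset[OF _ subset_UNIV]) (intro continuous_intros \<phi>)
  have zero: "\<phi> \<theta> = 0" if "\<theta> \<in> {0..2*pi}" for \<theta>
    using has_integral_0_cbox_imp_0[OF cn _ hi, of \<theta>] that by (simp add: not_le)
  have "z = cis (Arg2pi z)" using z Arg2pi_eq[of z] by (simp add: cis_conv_exp mult.commute)
  with zero[of "Arg2pi z"] Arg2pi[of z] show ?thesis by (simp add: \<phi>_def)
qed

section \<open>Polar modes and unique continuation\<close>

lemma frechet_axis_sum:
  fixes D :: "real^2 \<Rightarrow> complex"
  assumes "linear D"
  shows "D h = D (axis 1 1) * of_real (h$1) + D (axis 2 1) * of_real (h$2)"
proof -
  have "h = (h$1) *\<^sub>R axis 1 1 + (h$2) *\<^sub>R axis 2 1"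
    by (simp add: vec_eq_iff forall_2 axis_def)
  then have "D h = D ((h$1) *\<^sub>R axis 1 1 + (h$2) *\<^sub>R axis 2 1)" by simp
  also have "\<dots> = (h$1) *\<^sub>R D (axis 1 1) + (h$2) *\<^sub>R D (axis 2 1)"
    using assms by (simp add: linear_add linear_scale)
  finally show ?thesis by (simp add: scaleR_conv_of_real mult.commute)
qed

lemma has_derivative_pd_iff:
  "f differentiable at x \<longleftrightarrow> (f has_derivative (\<lambda>h. pd 1 f x * of_real (h$1) + pd 2 f x * of_real (h$2))) (at x)"
proof
  assume "f differentiable at x"
  then have *: "(f has_derivative frechet_derivative f (at x)) (at x)" by (simp add: frechet_derivative_works)
  then have "linear (frechet_derivative f (at x))" by (rule has_derivative_linear)
  then have "frechet_derivative f (at x) = (\<lambda>h. pd 1 f x * of_real (h$1) + pd 2 f x * of_real (h$2))"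
    unfolding pd_def by (intro ext frechet_axis_sum)
  with * show "(f has_derivative (\<lambda>h. pd 1 f x * of_real (h$1) + pd 2 f x * of_real (h$2))) (at x)" by simp
qed (auto simp: differentiable_def)

lemma pd_unique:
  assumes "(f has_derivative (\<lambda>h. a * of_real (h$1) + b * of_real (h$2))) (at x)"
  shows "pd 1 f x = a" "pd 2 f x = b"
  using frechet_derivative_at[OF assms, symmetric] by (simp_all add: pd_def axis_def)

lemma C1_on_has_derivative:
  assumes "open S" "C1_on S f" "x \<in> S"
  shows "(f has_derivative (\<lambda>h. pd 1 f x * of_real (h$1) + pd 2 f x * of_real (h$2))) (at x)"
proof -
  have "f differentiable at x"
    using assms unfolding C1_on_def by (simp add: differentiable_on_eq_differentiable_at)
  then show ?thesis unfolding has_derivative_pd_iff .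
qed

lemma C1_on_continuous: "C1_on S f \<Longrightarrow> continuous_on S f"
  unfolding C1_on_def by (simp add: differentiable_imp_continuous_on)

lemma C1_on_chain:
  fixes v :: "real^2"
  assumes "open S" "C1_on S f" "c s \<in> S" "(c has_vector_derivative v) (at s within T)"
  shows "((\<lambda>s. f (c s)) has_vector_derivative (pd 1 f (c s) * of_real (v$1) + pd 2 f (c s) * of_real (v$2))) (at s within T)"
proof -
  have "(c has_derivative (\<lambda>h. h *\<^sub>R v)) (at s within T)" using assms(4) by (simp add: has_vector_derivative_def)
  from has_derivative_compose[OF this C1_on_has_derivative[OF assms(1-3)]]
  show ?thesis unfolding has_vector_derivative_def
    by (rule has_derivative_eq_rhs) (simp add: fun_eq_iff scaleR_conv_of_real[of _ "_::complex"] algebra_simps)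
qed

lemma polar_pt_nth [simp]: "polar_pt r \<theta> $ 1 = r * cos \<theta>" "polar_pt r \<theta> $ 2 = r * sin \<theta>"
  by (auto simp: polar_pt_def)

lemma has_vector_derivative_vec2:
  fixes c :: "real \<Rightarrow> real^2" and v :: "real^2"
  assumes "((\<lambda>t. c t $ 1) has_real_derivative v$1) (at t within T)" "((\<lambda>t. c t $ 2) has_real_derivative v$2) (at t within T)"
  shows "(c has_vector_derivative v) (at t within T)"
proof -
  have "((\<lambda>t. c t $ i) has_vector_derivative v $ i) (at t within T)" for i
    using assms exhaust_2[of i] by (auto simp: has_real_derivative_iff_has_vector_derivative)
  then have "((\<lambda>t. c t $ i) has_derivative (\<lambda>h. (h *\<^sub>R v) $ i)) (at t within T)" for i
    by (simp add: has_vector_derivative_def)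
  then show ?thesis
    unfolding has_vector_derivative_def has_derivative_componentwise_within[of c]
    by (auto simp: Basis_vec_def inner_axis)
qed

lemma polar_pt_derivatives:
  "((\<lambda>s. y + polar_pt (exp s) \<theta>) has_vector_derivative polar_pt (exp s) \<theta>) (at s within T)"
  "((\<lambda>\<theta>. y + polar_pt r \<theta>) has_vector_derivative vector [- r * sin \<theta>, r * cos \<theta>]) (at \<theta> within T)"
  by (rule has_vector_derivative_vec2; auto intro!: derivative_eq_intros)+

lemma continuous_on_vec2:
  fixes f :: "'a::t2_space \<Rightarrow> real^2"
  assumes "continuous_on S (\<lambda>x. f x $ 1)" "continuous_on S (\<lambda>x. f x $ 2)"
  shows "continuous_on S f"
proof -
  have "continuous_on S (\<lambda>x. f x $ i)" for i using assms exhaust_2[of i] by auto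
  then show ?thesis
    unfolding continuous_on_componentwise[of S f] by (auto simp: Basis_vec_def inner_axis)
qed

lemma continuous_on_polar_pt [continuous_intros]:
  fixes r \<theta> :: "'a::t2_space \<Rightarrow> real"
  shows "continuous_on S r \<Longrightarrow> continuous_on S \<theta> \<Longrightarrow> continuous_on S (\<lambda>x. polar_pt (r x) (\<theta> x))"
  by (rule continuous_on_vec2) (auto intro!: continuous_intros)

lemma polar_pt_2pi: "polar_pt r (2 * pi) = polar_pt r 0"
  by (simp add: vec_eq_iff forall_2)

lemma norm_vec2: "norm (x :: real^2) = sqrt ((x$1)\<^sup>2 + (x$2)\<^sup>2)"
  by (simp add: norm_vec_def L2_set_def sum_2)

lemma norm_polar_pt [simp]: "norm (polar_pt r \<theta>) = \<bar>r\<bar>"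
proof -
  have "(r * cos \<theta>)\<^sup>2 + (r * sin \<theta>)\<^sup>2 = r\<^sup>2 * ((cos \<theta>)\<^sup>2 + (sin \<theta>)\<^sup>2)"
    by (simp add: power_mult_distrib distrib_left del: sin_cos_squared_add sin_cos_squared_add2)
  then show ?thesis by (simp only: norm_vec2 polar_pt_nth sin_cos_squared_add2 mult_1_right real_sqrt_abs)
qed

text \<open>With r = exp s this is the derivative in s, that is r times the radial derivative; the
  next one is the derivative in \<theta>.\<close>

definition radial_pd :: "(real^2 \<Rightarrow> complex) \<Rightarrow> real^2 \<Rightarrow> real \<Rightarrow> real \<Rightarrow> complex" where
  "radial_pd f y s \<theta> = pd 1 f (y + polar_pt (exp s) \<theta>) * of_real (exp s * cos \<theta>)
                + pd 2 f (y + polar_pt (exp s) \<theta>) * of_real (exp s * sin \<theta>)"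

definition angular_pd :: "(real^2 \<Rightarrow> complex) \<Rightarrow> real^2 \<Rightarrow> real \<Rightarrow> real \<Rightarrow> complex" where
  "angular_pd f y s \<theta> = pd 2 f (y + polar_pt (exp s) \<theta>) * of_real (exp s * cos \<theta>)
                - pd 1 f (y + polar_pt (exp s) \<theta>) * of_real (exp s * sin \<theta>)"

lemma fourier_coeff_deriv:
  assumes d: "\<And>\<theta>. (f has_vector_derivative f' \<theta>) (at \<theta>)" and per: "f (2 * pi) = f 0"
    and c: "continuous_on UNIV f'"
  shows "fourier_coeff f' n = \<i> * of_int n * fourier_coeff f n"
proof -
  have fc: "continuous_on UNIV f"
    using d by (meson continuous_at_imp_continuous_on has_vector_derivative_continuous)
  have e: "((\<lambda>\<theta>. cis (- (of_int n * \<theta>))) has_vector_derivative - \<i> * of_int n * cis (- (of_int n * \<theta>))) (at \<theta>)" for \<theta>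
  proof -
    have "((\<lambda>z. exp (- \<i> * of_int n * z)) has_field_derivative - \<i> * of_int n * exp (- \<i> * of_int n * of_real \<theta>)) (at (of_real \<theta>))"
      by (auto intro!: derivative_eq_intros)
    from has_vector_derivative_real_field[OF this] show ?thesis
      by (simp add: cis_conv_exp mult.assoc)
  qed
  define h where "h \<theta> = f \<theta> * cis (- (of_int n * \<theta>))" for \<theta>
  have "(h has_vector_derivative (f \<theta> * (- \<i> * of_int n * cis (- (of_int n * \<theta>))) + f' \<theta> * cis (- (of_int n * \<theta>)))) (at \<theta> within {0..2*pi})" for \<theta>
    unfolding h_def [abs_def] by (rule has_vector_derivative_at_within[OF has_vector_derivative_mult[OF d e]])
  then have "((\<lambda>\<theta>. f \<theta> * (- \<i> * of_int n * cis (- (of_int n * \<theta>))) + f' \<theta> * cis (- (of_int n * \<theta>))) has_integral h (2 * pi) - h 0) {0..2*pi}"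
    by (intro fundamental_theorem_of_calculus) auto
  moreover have "cis (- (of_int n * (2 * pi))) = 1"
    using cis_multiple_2pi[of "of_int (- n)"] by (simp add: mult_ac)
  then have "h (2 * pi) - h 0 = 0" by (simp add: h_def per)
  ultimately have "0 = integral {0..2*pi} (\<lambda>\<theta>. (- \<i> * of_int n) * (f \<theta> * cis (- (of_int n * \<theta>))) + f' \<theta> * cis (- (of_int n * \<theta>)))"
    by (simp add: integral_unique algebra_simps)
  also have "\<dots> = (- \<i> * of_int n) * fourier_coeff f n + fourier_coeff f' n"
    unfolding fourier_coeff_def integral_mult_right[symmetric]
    by (rule integral_add) (intro integrable_continuous_UNIV continuous_intros fc c)+
  finally show ?thesis by (simp add: algebra_simps)
qed

lemma fourier_coeff_leibniz:
  fixes f f' :: "real \<Rightarrow> real \<Rightarrow> complex"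
  assumes d: "\<And>s \<theta>. s \<in> {\<alpha><..<\<beta>} \<Longrightarrow> ((\<lambda>s. f s \<theta>) has_vector_derivative f' s \<theta>) (at s)"
    and c: "\<And>s. s \<in> {\<alpha><..<\<beta>} \<Longrightarrow> continuous_on UNIV (f s)"
    and c': "continuous_on ({\<alpha><..<\<beta>} \<times> UNIV) (\<lambda>(s, \<theta>). f' s \<theta>)"
    and s: "s \<in> {\<alpha><..<\<beta>}"
  shows "((\<lambda>s. fourier_coeff (f s) n) has_vector_derivative fourier_coeff (f' s) n) (at s)"
proof -
  have "((\<lambda>s. integral (cbox 0 (2*pi)) (\<lambda>\<theta>. f s \<theta> * cis (- (of_int n * \<theta>)))) has_vector_derivative
      integral (cbox 0 (2*pi)) (\<lambda>\<theta>. f' s \<theta> * cis (- (of_int n * \<theta>)))) (at s within {\<alpha><..<\<beta>})"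
  proof (rule leibniz_rule_vector_derivative[where fx = "\<lambda>s \<theta>. f' s \<theta> * cis (- (of_int n * \<theta>))"])
    show "((\<lambda>s. f s \<theta> * cis (- (of_int n * \<theta>))) has_vector_derivative f' s \<theta> * cis (- (of_int n * \<theta>))) (at s within {\<alpha><..<\<beta>})"
      if "s \<in> {\<alpha><..<\<beta>}" for s \<theta>
      using has_vector_derivative_mult_left[OF has_vector_derivative_at_within[OF d[OF that]]] by blast
    show "(\<lambda>\<theta>. f s \<theta> * cis (- (of_int n * \<theta>))) integrable_on cbox 0 (2 * pi)" if "s \<in> {\<alpha><..<\<beta>}" for s
      using c[OF that] by (auto intro!: integrable_continuous_UNIV continuous_intros)
    have "continuous_on ({\<alpha><..<\<beta>} \<times> cbox 0 (2 * pi)) (\<lambda>x. f' (fst x) (snd x))"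
      using continuous_on_subset[OF c', of "{\<alpha><..<\<beta>} \<times> cbox 0 (2*pi)"] by (auto simp: split_beta)
    then show "continuous_on ({\<alpha><..<\<beta>} \<times> cbox 0 (2 * pi)) (\<lambda>(s, \<theta>). f' s \<theta> * cis (- (of_int n * \<theta>)))"
      unfolding split_beta by (intro continuous_intros)
  qed (use s in auto)
  then show ?thesis
    unfolding fourier_coeff_def using s at_within_open[OF s open_greaterThanLessThan] by simp
qed

lemma continuous_on_fourier_coeff_param:
  assumes "continuous_on (U \<times> UNIV) (\<lambda>(s, \<theta>). f s \<theta>)"
  shows "continuous_on U (\<lambda>s. fourier_coeff (f s) n)"
proof -
  have "continuous_on (U \<times> cbox 0 (2 * pi)) (\<lambda>x. f (fst x) (snd x))"
    using continuous_on_subset[OF assms, of "U \<times> cbox 0 (2*pi)"] by (auto simp: split_beta)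
  then have "continuous_on (U \<times> cbox 0 (2 * pi)) (\<lambda>(s, \<theta>). f s \<theta> * cis (- (of_int n * \<theta>)))"
    unfolding split_beta by (intro continuous_intros)
  from integral_continuous_on_param[OF this] show ?thesis by (simp add: fourier_coeff_def)
qed

text \<open>Gronwall for E = |a|^2 + |b|^2: |E'| \<le> (1 + M) E, so an exponential weight makes E
  monotone. The equations hold in the open interval and the functions are merely continuous at its
  ends, as happens on the outer circle. Data may sit at either end: one use runs outwards from a
  ball of zeros, the other inwards from the outer circle.\<close>

lemma second_order_ode_unique:
  fixes a b :: "real \<Rightarrow> complex" and q :: "real \<Rightarrow> real"
  assumes cont: "continuous_on {\<alpha>..\<beta>} a" "continuous_on {\<alpha>..\<beta>} b"
    and d: "\<And>s. \<alpha> < s \<Longrightarrow> s < \<beta> \<Longrightarrow> (a has_vector_derivative b s) (at s)"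
      "\<And>s. \<alpha> < s \<Longrightarrow> s < \<beta> \<Longrightarrow> (b has_vector_derivative of_real (q s) * a s) (at s)"
    and M: "\<And>s. \<alpha> < s \<Longrightarrow> s < \<beta> \<Longrightarrow> \<bar>q s\<bar> \<le> M"
    and init: "(a \<alpha> = 0 \<and> b \<alpha> = 0) \<or> (a \<beta> = 0 \<and> b \<beta> = 0)"
    and s: "s \<in> {\<alpha>..\<beta>}"
  shows "a s = 0 \<and> b s = 0"
proof (cases "\<alpha> < \<beta>")
  case False
  then have "s = \<alpha>" "s = \<beta>" using s by auto
  then show ?thesis using init by blast
next
  case True
  have M0: "M \<ge> 0" using M[of "(\<alpha> + \<beta>) / 2"] True by (simp add: field_simps)
  define E where "E s = (Re (a s))\<^sup>2 + (Im (a s))\<^sup>2 + ((Re (b s))\<^sup>2 + (Im (b s))\<^sup>2)" for s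
  define E' where "E' s = 2 * (1 + q s) * (Re (a s) * Re (b s) + Im (a s) * Im (b s))" for s
  have Ec: "continuous_on {\<alpha>..\<beta>} E" unfolding E_def by (intro continuous_intros cont)
  have E0: "E s \<ge> 0" for s by (simp add: E_def)
  have Ed: "(E has_real_derivative E' s) (at s)" if "\<alpha> < s" "s < \<beta>" for s
  proof -
    have 1: "((\<lambda>s. Re (a s)) has_real_derivative Re (b s)) (at s)" "((\<lambda>s. Im (a s)) has_real_derivative Im (b s)) (at s)"
      using d(1)[OF that] by (auto simp: has_vector_derivative_complex_iff)
    have 2: "((\<lambda>s. Re (b s)) has_real_derivative q s * Re (a s)) (at s)" "((\<lambda>s. Im (b s)) has_real_derivative q s * Im (a s)) (at s)"
      using d(2)[OF that] by (auto simp: has_vector_derivative_complex_iff)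
    have "(E has_real_derivative (2 * Re (a s) * Re (b s) + 2 * Im (a s) * Im (b s)
        + (2 * Re (b s) * (q s * Re (a s)) + 2 * Im (b s) * (q s * Im (a s))))) (at s)"
      unfolding E_def [abs_def] power2_eq_square
      by (intro DERIV_add; rule DERIV_cong, rule DERIV_mult, rule 1 2, rule 1 2, simp)
    then show ?thesis by (rule DERIV_cong) (simp add: E'_def algebra_simps)
  qed
  have E'le: "\<bar>E' s\<bar> \<le> (1 + M) * E s" if "\<alpha> < s" "s < \<beta>" for s
  proof -
    have "\<bar>1 + q s\<bar> \<le> 1 + M" using M[OF that] by linarith
    moreover have "\<bar>2 * (Re (a s) * Re (b s) + Im (a s) * Im (b s))\<bar> \<le> E s"
    proof -
      have "\<bar>2 * x * y\<bar> \<le> x\<^sup>2 + y\<^sup>2" for x y :: real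
        using sum_squares_bound[of x y] sum_squares_bound[of "-x" y] by (auto simp: abs_le_iff)
      from this[of "Re (a s)" "Re (b s)"] this[of "Im (a s)" "Im (b s)"]
      show ?thesis unfolding E_def by (simp add: abs_le_iff)
    qed
    ultimately have "\<bar>1 + q s\<bar> * \<bar>2 * (Re (a s) * Re (b s) + Im (a s) * Im (b s))\<bar> \<le> (1 + M) * E s"
      using M0 by (intro mult_mono) auto
    moreover have "E' s = (1 + q s) * (2 * (Re (a s) * Re (b s) + Im (a s) * Im (b s)))" by (simp add: E'_def algebra_simps)
    ultimately show ?thesis by (simp only: abs_mult)
  qed
  have "E s \<le> 0"
    using init
  proof
    assume "a \<alpha> = 0 \<and> b \<alpha> = 0"
    then have z: "E \<alpha> = 0" by (simp add: E_def)
    have "exp (- (1 + M) * \<alpha>) * (- E \<alpha>) \<le> exp (- (1 + M) * s) * (- E s)"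
    proof (rule DERIV_nonneg_imp_increasing_open[where f = "\<lambda>s. exp (- (1 + M) * s) * (- E s)"])
      fix x assume x: "\<alpha> < x" "x < s"
      have "((\<lambda>s. exp (- (1 + M) * s) * (- E s)) has_real_derivative exp (- (1 + M) * x) * ((1 + M) * E x - E' x)) (at x)"
        using Ed[of x] x s by (auto intro!: derivative_eq_intros simp: algebra_simps)
      moreover have "exp (- (1 + M) * x) * ((1 + M) * E x - E' x) \<ge> 0"
        using E'le[of x] x s by (intro mult_nonneg_nonneg) auto
      ultimately show "\<exists>y. ((\<lambda>s. exp (- (1 + M) * s) * (- E s)) has_real_derivative y) (at x) \<and> 0 \<le> y" by blast
    qed (use s in \<open>auto intro!: continuous_intros continuous_on_subset[OF Ec]\<close>)
    with z show ?thesis by (simp add: mult_le_0_iff)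
  next
    assume "a \<beta> = 0 \<and> b \<beta> = 0"
    then have z: "E \<beta> = 0" by (simp add: E_def)
    have "exp ((1 + M) * s) * E s \<le> exp ((1 + M) * \<beta>) * E \<beta>"
    proof (rule DERIV_nonneg_imp_increasing_open[where f = "\<lambda>s. exp ((1 + M) * s) * E s"])
      fix x assume x: "s < x" "x < \<beta>"
      have "((\<lambda>s. exp ((1 + M) * s) * E s) has_real_derivative exp ((1 + M) * x) * ((1 + M) * E x + E' x)) (at x)"
        using Ed[of x] x s by (auto intro!: derivative_eq_intros simp: algebra_simps)
      moreover have "exp ((1 + M) * x) * ((1 + M) * E x + E' x) \<ge> 0"
        using E'le[of x] x s by (intro mult_nonneg_nonneg) auto
      ultimately show "\<exists>y. ((\<lambda>s. exp ((1 + M) * s) * E s) has_real_derivative y) (at x) \<and> 0 \<le> y" by blast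
    qed (use s in \<open>auto intro!: continuous_intros continuous_on_subset[OF Ec]\<close>)
    with z show ?thesis by (simp add: mult_le_0_iff)
  qed
  then have "E s = 0" using E0[of s] by simp
  then show ?thesis unfolding E_def
    by (simp add: add_nonneg_eq_0_iff sum_power2_eq_zero_iff complex_eq_iff)
qed

text \<open>In the logarithmic radius \<open>s = ln r\<close> the Helmholtz equation becomes
  \<open>p\<^sub>s\<^sub>s + p\<^sub>\<theta>\<^sub>\<theta> + k\<^sup>2 exp (2 s) p = 0\<close>, free of first-order terms.\<close>

locale helmholtz_annulus =
  fixes S :: "(real^2) set" and p :: "real^2 \<Rightarrow> complex" and y :: "real^2" and k \<alpha> \<beta> :: real
  assumes S: "open S" and p: "C2_on S p"
    and helmholtz: "\<And>x. x \<in> S \<Longrightarrow> laplacian p x + of_real (k^2) * p x = 0"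
    and in_S: "\<And>s \<theta>. \<alpha> < s \<Longrightarrow> s < \<beta> \<Longrightarrow> y + polar_pt (exp s) \<theta> \<in> S"
begin

definition mode where "mode n s = fourier_coeff (\<lambda>\<theta>. p (y + polar_pt (exp s) \<theta>)) n"
definition dmode where "dmode n s = fourier_coeff (radial_pd p y s) n"

lemma C1: "C1_on S p" "C1_on S (pd i p)"
  using p by (auto simp: C2_on_def)

lemma contS: "continuous_on S p" "continuous_on S (pd i p)" "continuous_on S (pd j (pd i p))"
  using C1 C1_on_continuous C1_on_def by blast+

lemma cont_comp:
  assumes "continuous_on S f"
  shows "continuous_on ({\<alpha><..<\<beta>} \<times> UNIV) (\<lambda>x. f (y + polar_pt (exp (fst x)) (snd x)))"
  by (rule continuous_on_compose2[OF assms]) (auto intro!: continuous_intros in_S)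

lemma cont_comp_angle:
  assumes "continuous_on S f" "s \<in> {\<alpha><..<\<beta>}"
  shows "continuous_on UNIV (\<lambda>\<theta>. f (y + polar_pt (exp s) \<theta>))"
  using assms(2) by (intro continuous_on_compose2[OF assms(1)]) (auto intro!: continuous_intros in_S)

lemma radial_deriv:
  assumes "C1_on S f" "s \<in> {\<alpha><..<\<beta>}"
  shows "((\<lambda>s. f (y + polar_pt (exp s) \<theta>)) has_vector_derivative radial_pd f y s \<theta>) (at s)"
  using C1_on_chain[OF S assms(1) _ polar_pt_derivatives(1), of y s \<theta> UNIV] in_S assms
  by (simp add: radial_pd_def)

lemma angular_deriv:
  assumes "C1_on S f" "s \<in> {\<alpha><..<\<beta>}"
  shows "((\<lambda>\<theta>. f (y + polar_pt (exp s) \<theta>)) has_vector_derivative angular_pd f y s \<theta>) (at \<theta>)"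
  using C1_on_chain[OF S assms(1) _ polar_pt_derivatives(2), of y "exp s" \<theta> UNIV] in_S assms
  by (simp add: angular_pd_def)

text \<open>The second derivative in s, followed by the second derivative in \<theta>. The
  first-order term, from differentiating exp s here and the rotating frame there, occurs with
  opposite signs and drops out of the sum.\<close>

definition radial2 where "radial2 s \<theta> =
  (radial_pd (pd 1 p) y s \<theta> * of_real (exp s * cos \<theta>) + radial_pd (pd 2 p) y s \<theta> * of_real (exp s * sin \<theta>)) + radial_pd p y s \<theta>"

definition angular2 where "angular2 s \<theta> =
  (angular_pd (pd 2 p) y s \<theta> * of_real (exp s * cos \<theta>) - angular_pd (pd 1 p) y s \<theta> * of_real (exp s * sin \<theta>)) - radial_pd p y s \<theta>"

lemma radial2_deriv:
  assumes "s \<in> {\<alpha><..<\<beta>}"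
  shows "((\<lambda>s. radial_pd p y s \<theta>) has_vector_derivative radial2 s \<theta>) (at s)"
proof -
  have e: "((\<lambda>s. complex_of_real (exp s * c)) has_vector_derivative of_real (exp s * c)) (at s)" for c
    by (rule has_vector_derivative_of_real) (auto intro!: derivative_eq_intros simp: has_real_derivative_iff_has_vector_derivative [symmetric])
  show ?thesis
    unfolding radial_pd_def [of p, abs_def]
    by (rule has_vector_derivative_eq_rhs[OF has_vector_derivative_add[OF
          has_vector_derivative_mult[OF radial_deriv[OF C1(2)[of 1] assms] e]
          has_vector_derivative_mult[OF radial_deriv[OF C1(2)[of 2] assms] e]]])
       (simp add: radial2_def radial_pd_def algebra_simps)
qed

lemma angular2_deriv:
  assumes "s \<in> {\<alpha><..<\<beta>}"
  shows "((\<lambda>\<theta>. angular_pd p y s \<theta>) has_vector_derivative angular2 s \<theta>) (at \<theta>)"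
proof -
  have e: "((\<lambda>\<theta>. complex_of_real (exp s * cos \<theta>)) has_vector_derivative of_real (- (exp s * sin \<theta>))) (at \<theta>)"
    "((\<lambda>\<theta>. complex_of_real (exp s * sin \<theta>)) has_vector_derivative of_real (exp s * cos \<theta>)) (at \<theta>)"
    by (rule has_vector_derivative_of_real, auto intro!: derivative_eq_intros simp: has_real_derivative_iff_has_vector_derivative [symmetric])+
  show ?thesis
    unfolding angular_pd_def [of p, abs_def]
    by (rule has_vector_derivative_eq_rhs[OF has_vector_derivative_diff[OF
          has_vector_derivative_mult[OF angular_deriv[OF C1(2)[of 2] assms] e(1)]
          has_vector_derivative_mult[OF angular_deriv[OF C1(2)[of 1] assms] e(2)]]])
       (simp add: angular2_def angular_pd_def radial_pd_def algebra_simps)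
qed

lemma polar_laplacian:
  assumes "s \<in> {\<alpha><..<\<beta>}"
  shows "radial2 s \<theta> + angular2 s \<theta> = - of_real (k\<^sup>2 * exp (2 * s)) * p (y + polar_pt (exp s) \<theta>)"
proof -
  let ?x = "y + polar_pt (exp s) \<theta>"
  have "complex_of_real ((cos \<theta>)\<^sup>2 + (sin \<theta>)\<^sup>2) = 1" by simp
  then have cs: "(complex_of_real (cos \<theta>))\<^sup>2 + (complex_of_real (sin \<theta>))\<^sup>2 = 1" by (simp only: of_real_add of_real_power)
  have h: "pd 1 (pd 1 p) ?x + pd 2 (pd 2 p) ?x = - of_real (k\<^sup>2) * p ?x"
    using helmholtz[OF in_S[of s \<theta>]] assms by (simp add: laplacian_def sum_2 eq_neg_iff_add_eq_0)
  have "radial2 s \<theta> + angular2 s \<theta> = (of_real (exp s))\<^sup>2 * ((of_real (cos \<theta>))\<^sup>2 + (of_real (sin \<theta>))\<^sup>2) * (pd 1 (pd 1 p) ?x + pd 2 (pd 2 p) ?x)"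
    unfolding radial2_def angular2_def by (simp add: radial_pd_def angular_pd_def algebra_simps power2_eq_square)
  also have "\<dots> = (of_real (exp s))\<^sup>2 * (- of_real (k\<^sup>2) * p ?x)" unfolding cs h by simp
  also have "(complex_of_real (exp s))\<^sup>2 = of_real (exp (2 * s))" by (simp add: exp_double)
  finally show ?thesis by simp
qed

lemma cont2:
  "continuous_on ({\<alpha><..<\<beta>} \<times> UNIV) (\<lambda>(s, \<theta>). radial_pd p y s \<theta>)"
  "continuous_on ({\<alpha><..<\<beta>} \<times> UNIV) (\<lambda>(s, \<theta>). radial2 s \<theta>)"
  unfolding split_beta radial2_def radial_pd_def
  by (intro continuous_intros cont_comp contS)+

text \<open>Fourier analysis turns two derivatives in \<theta> into the factor - n^2, and so the
  Helmholtz equation into one ordinary differential equation per mode.\<close>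

lemma mode_deriv:
  assumes s: "s \<in> {\<alpha><..<\<beta>}"
  shows "(mode n has_vector_derivative dmode n s) (at s)"
    "(dmode n has_vector_derivative of_real ((of_int n)\<^sup>2 - k\<^sup>2 * exp (2 * s)) * mode n s) (at s)"
proof -
  show "(mode n has_vector_derivative dmode n s) (at s)"
    unfolding mode_def [abs_def] dmode_def
    by (rule fourier_coeff_leibniz[OF radial_deriv cont_comp_angle cont2(1) s]) (auto intro: C1 contS)
  have "continuous_on UNIV (radial_pd p y s)" if "s \<in> {\<alpha><..<\<beta>}" for s
    unfolding radial_pd_def [abs_def] using that by (intro continuous_intros cont_comp_angle contS)
  then have 1: "(dmode n has_vector_derivative fourier_coeff (radial2 s) n) (at s)"
    unfolding dmode_def [abs_def]
    by (intro fourier_coeff_leibniz[OF radial2_deriv _ cont2(2) s]) auto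
  let ?P = "\<lambda>\<theta>. p (y + polar_pt (exp s) \<theta>)"
  have ca: "continuous_on UNIV (angular_pd p y s)" "continuous_on UNIV (angular2 s)"
    unfolding angular_pd_def [abs_def] angular2_def [abs_def] radial_pd_def [abs_def]
    by (intro continuous_intros cont_comp_angle contS s)+
  have "fourier_coeff (angular2 s) n = \<i> * of_int n * (\<i> * of_int n * fourier_coeff ?P n)"
    using fourier_coeff_deriv[OF angular2_deriv[OF s] _ ca(2), of n]
      fourier_coeff_deriv[OF angular_deriv[OF C1(1) s] _ ca(1), of n]
    by (simp add: polar_pt_2pi angular_pd_def [of p y s 0] angular_pd_def [of p y s "2 * pi"])
  then have ang: "fourier_coeff (angular2 s) n = - (of_int n)\<^sup>2 * mode n s"
    by (simp add: mode_def power2_eq_square algebra_simps)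
  have "radial2 s = (\<lambda>\<theta>. (- of_real (k\<^sup>2 * exp (2 * s))) * ?P \<theta> - angular2 s \<theta>)"
    using polar_laplacian[OF s] by (auto simp: fun_eq_iff eq_diff_eq)
  then have "fourier_coeff (radial2 s) n = fourier_coeff (\<lambda>\<theta>. (- of_real (k\<^sup>2 * exp (2 * s))) * ?P \<theta>) n - fourier_coeff (angular2 s) n"
    using s by (simp only:) (intro fourier_coeff_diff continuous_intros cont_comp_angle contS ca)
  also have "\<dots> = of_real ((of_int n)\<^sup>2 - k\<^sup>2 * exp (2 * s)) * mode n s"
    unfolding fourier_coeff_cmult ang by (simp add: mode_def algebra_simps)
  finally show "(dmode n has_vector_derivative of_real ((of_int n)\<^sup>2 - k\<^sup>2 * exp (2 * s)) * mode n s) (at s)"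
    using 1 by simp
qed

lemma vanish_of_modes:
  assumes s: "s \<in> {\<alpha><..<\<beta>}" and m: "\<And>n. mode n s = 0"
  shows "p (y + polar_pt (exp s) \<theta>) = 0"
proof -
  define F where "F z = p (y + vector [exp s * Re z, exp s * Im z])" for z
  have eq: "F (cis \<theta>) = p (y + polar_pt (exp s) \<theta>)" for \<theta> by (simp add: F_def polar_pt_def)
  have "F (cis \<theta>) = 0"
  proof (rule fourier_uniqueness[of F])
    show "fourier_coeff (\<lambda>\<theta>. F (cis \<theta>)) n = 0" for n using m[of n] by (simp add: eq mode_def)
    show "continuous_on (sphere 0 1) F"
      unfolding F_def
    proof (rule continuous_on_compose2[OF contS(1)])
      show "continuous_on (sphere 0 1) (\<lambda>z. y + vector [exp s * Re z, exp s * Im z])"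
        by (rule continuous_on_vec2) (auto intro!: continuous_intros)
      show "(\<lambda>z. y + vector [exp s * Re z, exp s * Im z]) ` sphere 0 1 \<subseteq> S"
      proof
        fix x assume "x \<in> (\<lambda>z. y + vector [exp s * Re z, exp s * Im z]) ` sphere 0 1"
        then obtain z where z: "norm z = 1" "x = y + vector [exp s * Re z, exp s * Im z]" by auto
        then have "z = cis (Arg2pi z)" using Arg2pi_eq[of z] by (simp add: cis_conv_exp mult.commute)
        then have "x = y + polar_pt (exp s) (Arg2pi z)" using z by (metis cis.sel polar_pt_def)
        then show "x \<in> S" using in_S s by auto
      qed
    qed
  qed simp
  then show ?thesis by (simp add: eq)
qed

end

lemma polar_pt_exhaust:
  assumes "x \<noteq> (0::real^2)"
  obtains \<theta> where "x = polar_pt (norm x) \<theta>"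
proof -
  define z where "z = Complex (x$1) (x$2)"
  have n: "norm z = norm x" by (simp add: z_def norm_vec2 cmod_def)
  have "z = of_real (norm z) * cis (Arg z)" using rcis_cmod_Arg[of z] by (simp add: rcis_def)
  then have "Re z = norm x * cos (Arg z)" "Im z = norm x * sin (Arg z)"
    by (metis n Re_complex_of_real Im_complex_of_real cis.sel mult_zero_left diff_zero add_0_right times_complex.sel add.right_neutral)+
  then have "x = polar_pt (norm x) (Arg z)" by (simp add: z_def vec_eq_iff forall_2)
  then show thesis by (rule that)
qed

text \<open>Takes the place of analyticity: around y all modes solve linear ordinary differential
  equations with zero data at radius r / 2, so they stay zero up to radius r'.\<close>

lemma helmholtz_vanish_larger_ball:
  assumes S: "open S" and p: "C2_on S p"
    and helmholtz: "\<And>x. x \<in> S \<Longrightarrow> laplacian p x + of_real (k^2) * p x = 0"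
    and zero: "\<And>x. x \<in> ball y r \<Longrightarrow> p x = 0" and r: "r > 0" and sub: "ball y r' \<subseteq> S"
    and x: "x \<in> ball y r'"
  shows "p x = 0"
proof (cases "x \<in> ball y r")
  case True
  then show ?thesis using zero by simp
next
  case False
  define \<sigma> where "\<sigma> = ln (dist y x)"
  have d: "dist y x \<ge> r" "dist y x < r'" using False x by auto
  have \<sigma>: "exp \<sigma> = dist y x" using d r unfolding \<sigma>_def by (intro exp_ln) linarith
  \<comment> \<open>The annulus starts at r / 4 so that the initial radius r / 2 lies strictly
    inside it.\<close>
  interpret helmholtz_annulus S p y k "ln (r / 4)" "ln r'"
  proof
    fix s \<theta> assume "s < ln r'"
    then have "exp s < r'" using d r by (metis exp_less_mono exp_ln order_less_le_trans order_less_trans)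
    then show "y + polar_pt (exp s) \<theta> \<in> S" using sub by (auto simp: dist_norm)
  qed (use S p helmholtz in auto)
  define \<alpha> where "\<alpha> = ln (r / 2)"
  have al: "ln (r/4) < \<alpha>" "\<alpha> < \<sigma>" "\<sigma> < ln r'" unfolding \<alpha>_def \<sigma>_def
    by (intro ln_strict_mono, use r d in linarith, use r d in linarith)+
  have "pd i p z = 0" if "z \<in> ball y r" for i z
  proof -
    have "(p has_derivative (\<lambda>h. 0)) (at z)"
      by (rule has_derivative_transform_within_open[OF has_derivative_const open_ball that]) (simp add: zero)
    from frechet_derivative_at[OF this] show ?thesis by (simp add: pd_def) (metis)
  qed
  moreover have "y + polar_pt (exp \<alpha>) \<theta> \<in> ball y r" for \<theta> using r by (simp add: dist_norm \<alpha>_def)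
  ultimately have init: "mode n \<alpha> = 0" "dmode n \<alpha> = 0" for n
    by (auto simp: mode_def dmode_def fourier_coeff_def radial_pd_def zero)
  have "mode n \<sigma> = 0 \<and> dmode n \<sigma> = 0" for n
  proof (rule second_order_ode_unique[where \<alpha> = \<alpha> and \<beta> = \<sigma> and a = "mode n" and b = "dmode n"
        and q = "\<lambda>s. (of_int n)\<^sup>2 - k\<^sup>2 * exp (2 * s)" and M = "(of_int n)\<^sup>2 + k\<^sup>2 * exp (2 * \<sigma>)"])
    have md: "(mode n has_vector_derivative dmode n s) (at s)"
      "(dmode n has_vector_derivative of_real ((of_int n)\<^sup>2 - k\<^sup>2 * exp (2 * s)) * mode n s) (at s)" if "s \<in> {\<alpha>..\<sigma>}" for s
      using that al by (intro mode_deriv; auto)+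
    then show "continuous_on {\<alpha>..\<sigma>} (mode n)" "continuous_on {\<alpha>..\<sigma>} (dmode n)"
      by (meson continuous_at_imp_continuous_on has_vector_derivative_continuous)+
    show "(mode n has_vector_derivative dmode n s) (at s)"
      "(dmode n has_vector_derivative of_real ((of_int n)\<^sup>2 - k\<^sup>2 * exp (2 * s)) * mode n s) (at s)" if "\<alpha> < s" "s < \<sigma>" for s
      using that by (intro md; simp)+
    show "\<bar>(real_of_int n)\<^sup>2 - k\<^sup>2 * exp (2 * s)\<bar> \<le> (real_of_int n)\<^sup>2 + k\<^sup>2 * exp (2 * \<sigma>)" if "\<alpha> < s" "s < \<sigma>" for s
    proof -
      have "k\<^sup>2 * exp (2 * s) \<le> k\<^sup>2 * exp (2 * \<sigma>)" using that by (intro mult_left_mono) auto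
      moreover have "k\<^sup>2 * exp (2 * s) \<ge> 0" "(real_of_int n)\<^sup>2 \<ge> 0" by auto
      ultimately show ?thesis unfolding abs_le_iff by linarith
    qed
  qed (use init al in auto)
  then have *: "p (y + polar_pt (exp \<sigma>) \<theta>) = 0" for \<theta>
    using al by (intro vanish_of_modes) auto
  have "x - y \<noteq> 0" using d r by auto
  then obtain \<theta> where "x - y = polar_pt (norm (x - y)) \<theta>" by (rule polar_pt_exhaust)
  then have "x = y + polar_pt (exp \<sigma>) \<theta>" unfolding \<sigma> dist_norm by (metis diff_add_cancel add.commute norm_minus_commute)
  then show ?thesis using * by simp
qed

text \<open>The interior Z of the zero set is relatively closed: a limit point x has points z of Z
  at distance below d, and the zeros near z spread to the ball of radius d around z, which contains
  x.\<close>

lemma helmholtz_unique_continuation: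
  assumes S: "open S" "connected S" and p: "C2_on S p"
    and helmholtz: "\<And>x. x \<in> S \<Longrightarrow> laplacian p x + of_real (k^2) * p x = 0"
    and zero: "\<And>x. x \<in> ball a r \<Longrightarrow> p x = 0" and r: "r > 0" and a: "a \<in> S"
    and x: "x \<in> S"
  shows "p x = 0"
proof -
  define Z where "Z = interior {x \<in> S. p x = 0}"
  have Z: "open Z" "Z \<subseteq> {x \<in> S. p x = 0}" unfolding Z_def by (rule open_interior, rule interior_subset)
  have "openin (top_of_set S) Z" using Z by (metis (no_types, lifting) inf.orderE inf_commute openin_open mem_Collect_eq subset_eq)
  moreover have "closedin (top_of_set S) Z"
  proof -
    have "closure Z \<inter> S \<subseteq> Z"
    proof
      fix x assume x: "x \<in> closure Z \<inter> S"
      \<comment> \<open>Radius 2 d, so that the ball of radius d around any z within d of x still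
        lies in S.\<close>
      then obtain d where d: "d > 0" "ball x (2 * d) \<subseteq> S"
        using S(1) by (metis Int_iff open_contains_ball field_sum_of_halves half_gt_zero mult_2)
      obtain z where z: "z \<in> Z" "dist z x < d" using x d by (metis IntD1 closure_approachable)
      obtain e where e: "e > 0" "ball z e \<subseteq> Z" using Z(1) z(1) open_contains_ball by blast
      have sub: "ball z d \<subseteq> S"
      proof
        fix w assume "w \<in> ball z d"
        then have "dist x w < 2 * d" using z(2) dist_triangle[of x w z] by (simp add: dist_commute)
        then show "w \<in> S" using d by auto
      qed
      have "p w = 0" if "w \<in> ball z d" for w
        using helmholtz_vanish_larger_ball[OF S(1) p helmholtz _ e(1) sub that] e(2) Z(2) by blast
      then have "ball z d \<subseteq> {x \<in> S. p x = 0}" using sub by blast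
      then have "ball z d \<subseteq> Z" unfolding Z_def by (intro interior_maximal) auto
      then show "x \<in> Z" using z(2) by auto
    qed
    then have "Z = S \<inter> closure Z" using Z closure_subset by blast
    then show ?thesis by (metis closed_closure closedin_closed_Int)
  qed
  moreover have "a \<in> Z"
  proof -
    obtain e where e: "e > 0" "ball a e \<subseteq> S" using S(1) a open_contains_ball by blast
    have "ball a (min e r) \<subseteq> {x \<in> S. p x = 0}" using e zero by auto
    then have "ball a (min e r) \<subseteq> Z" unfolding Z_def by (intro interior_maximal) auto
    then show ?thesis using e r by auto
  qed
  ultimately have "Z = S" using S(2) by (metis connected_clopen empty_iff)
  then show ?thesis using Z x by auto
qed

section \<open>Closed differential forms in the plane\<close>

text \<open>The 1-form A dx + B dy of class C^1. Closedness is encoded by one and the same A2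
  serving as the y-derivative of A and the x-derivative of B.\<close>

definition closed_form :: "complex set \<Rightarrow> (complex \<Rightarrow> real) \<Rightarrow> (complex \<Rightarrow> real) \<Rightarrow> bool" where
  "closed_form U A B \<longleftrightarrow> (\<exists>A1 A2 B2. continuous_on U A1 \<and> continuous_on U A2 \<and> continuous_on U B2 \<and>
     (\<forall>z\<in>U. (A has_derivative (\<lambda>h. A1 z * Re h + A2 z * Im h)) (at z) \<and>
            (B has_derivative (\<lambda>h. A2 z * Re h + B2 z * Im h)) (at z)))"

definition form_primitive :: "complex set \<Rightarrow> (complex \<Rightarrow> real) \<Rightarrow> (complex \<Rightarrow> real) \<Rightarrow> (complex \<Rightarrow> real) \<Rightarrow> bool" where
  "form_primitive U A B \<phi> \<longleftrightarrow> (\<forall>z\<in>U. (\<phi> has_derivative (\<lambda>h. A z * Re h + B z * Im h)) (at z))"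

lemma closed_form_continuous:
  assumes "closed_form U A B"
  shows "continuous_on U A" "continuous_on U B"
  using assms unfolding closed_form_def
  by (meson continuous_at_imp_continuous_on has_derivative_continuous)+

text \<open>The primitive is the integral of the form along the segment from 0 to z.\<close>

lemma poincare_ball:
  assumes "closed_form (ball 0 1) A B"
  shows "\<exists>\<phi>. form_primitive (ball 0 1) A B \<phi>"
proof -
  let ?U = "ball (0::complex) 1"
  obtain A1 A2 B2 where cont: "continuous_on ?U A1" "continuous_on ?U A2" "continuous_on ?U B2"
    and dA: "\<And>z. z \<in> ?U \<Longrightarrow> (A has_derivative (\<lambda>h. A1 z * Re h + A2 z * Im h)) (at z)"
    and dB: "\<And>z. z \<in> ?U \<Longrightarrow> (B has_derivative (\<lambda>h. A2 z * Re h + B2 z * Im h)) (at z)"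
    using assms unfolding closed_form_def by blast
  note contAB = closed_form_continuous[OF assms]
  have tz: "t *\<^sub>R z \<in> ?U" if "z \<in> ?U" "t \<in> {0..1}" for z t
  proof -
    have "\<bar>t\<bar> * norm z \<le> 1 * norm z" using that by (intro mult_right_mono) auto
    then show ?thesis using that by (simp add: dist_norm)
  qed
  \<comment> \<open>\<alpha> z t is at once the x-derivative of the integrand and the t-derivative
    of t A(t z); the two agree because the form is closed. Integrating over t therefore gives A z,
    and \<beta> gives B z likewise.\<close>
  define \<alpha> where "\<alpha> z t = t * (A1 (t *\<^sub>R z) * Re z + A2 (t *\<^sub>R z) * Im z) + A (t *\<^sub>R z)" for z t
  define \<beta> where "\<beta> z t = t * (A2 (t *\<^sub>R z) * Re z + B2 (t *\<^sub>R z) * Im z) + B (t *\<^sub>R z)" for z t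
  define bR where "bR = Blinfun Re"
  define bI where "bI = Blinfun Im"
  have bRI: "blinfun_apply bR = Re" "blinfun_apply bI = Im"
    unfolding bR_def bI_def by (simp_all add: bounded_linear_Blinfun_apply bounded_linear_Re bounded_linear_Im)
  define f where "f z t = A (t *\<^sub>R z) * Re z + B (t *\<^sub>R z) * Im z" for z t
  define fx where "fx z t = \<alpha> z t *\<^sub>R bR + \<beta> z t *\<^sub>R bI" for z t
  have contc: "continuous_on (?U \<times> cbox 0 1) (\<lambda>x. g (snd x *\<^sub>R fst x))" if "continuous_on ?U g" for g :: "complex \<Rightarrow> real"
    by (rule continuous_on_compose2[OF that]) (auto intro!: continuous_intros simp del: mem_ball intro: tz)
  have cab: "continuous_on (?U \<times> cbox 0 1) (\<lambda>x. \<alpha> (fst x) (snd x))" "continuous_on (?U \<times> cbox 0 1) (\<lambda>x. \<beta> (fst x) (snd x))"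
    unfolding \<alpha>_def \<beta>_def by (intro continuous_intros contc cont contAB)+
  have leib: "((\<lambda>z. integral (cbox 0 1) (f z)) has_derivative blinfun_apply (integral (cbox 0 1) (fx z))) (at z within ?U)"
    if z: "z \<in> ?U" for z
  proof (rule leibniz_rule)
    show "((\<lambda>z. f z t) has_derivative blinfun_apply (fx z t)) (at z within ?U)" if "z \<in> ?U" "t \<in> cbox 0 1" for z t
    proof -
      have sc: "((\<lambda>z. t *\<^sub>R z) has_derivative (\<lambda>h. t *\<^sub>R h)) (at z)" by (auto intro!: derivative_eq_intros)
      have tz': "t *\<^sub>R z \<in> ?U" using tz that by simp
      have a: "((\<lambda>z. A (t *\<^sub>R z)) has_derivative (\<lambda>h. A1 (t *\<^sub>R z) * Re (t *\<^sub>R h) + A2 (t *\<^sub>R z) * Im (t *\<^sub>R h))) (at z)"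
        by (rule has_derivative_compose[OF sc dA[OF tz']])
      have b: "((\<lambda>z. B (t *\<^sub>R z)) has_derivative (\<lambda>h. A2 (t *\<^sub>R z) * Re (t *\<^sub>R h) + B2 (t *\<^sub>R z) * Im (t *\<^sub>R h))) (at z)"
        by (rule has_derivative_compose[OF sc dB[OF tz']])
      have "((\<lambda>z. f z t) has_derivative blinfun_apply (fx z t)) (at z)"
        unfolding f_def
        by (rule has_derivative_eq_rhs[OF has_derivative_add[OF has_derivative_mult[OF a] has_derivative_mult[OF b]]])
           (rule bounded_linear.has_derivative[OF bounded_linear_Re has_derivative_ident]
             bounded_linear.has_derivative[OF bounded_linear_Im has_derivative_ident] |
            simp add: fun_eq_iff fx_def \<alpha>_def \<beta>_def blinfun.add_left blinfun.scaleR_left bRI algebra_simps)+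
      then show ?thesis by (rule has_derivative_at_withinI)
    qed
    have lin: "continuous_on (cbox 0 1) (\<lambda>t. g (t *\<^sub>R z))" if "z \<in> ?U" "continuous_on ?U g" for z and g :: "complex \<Rightarrow> real"
      by (rule continuous_on_compose2[OF that(2)]) (use tz[OF that(1)] in \<open>auto intro!: continuous_intros simp del: mem_ball\<close>)
    show "f z integrable_on cbox 0 1" if "z \<in> ?U" for z
      unfolding f_def [abs_def] by (intro integrable_continuous continuous_intros contAB lin that)
    show "continuous_on (?U \<times> cbox 0 1) (\<lambda>(z, t). fx z t)"
      unfolding fx_def split_beta by (intro continuous_intros cab)
  qed (use z in auto)
  have "form_primitive ?U A B (\<lambda>z. integral (cbox 0 1) (f z))"
    unfolding form_primitive_def
  proof
    fix z assume z: "z \<in> ?U"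
    have line: "((\<lambda>t. t *\<^sub>R z) has_vector_derivative z) (at t within {0..1})" for t
      by (auto intro!: derivative_eq_intros)
    have a: "(\<alpha> z has_integral A z) {0..1}"
    proof -
      have "((\<lambda>t. t * A (t *\<^sub>R z)) has_vector_derivative \<alpha> z t) (at t within {0..1})" if "t \<in> {0..1}" for t
      proof -
        have "((\<lambda>t. A (t *\<^sub>R z)) has_vector_derivative (A1 (t *\<^sub>R z) * Re z + A2 (t *\<^sub>R z) * Im z)) (at t within {0..1})"
          using has_derivative_compose[OF line[unfolded has_vector_derivative_def] dA[OF tz[OF z that]]]
          unfolding has_vector_derivative_def by (rule has_derivative_eq_rhs) (simp add: fun_eq_iff algebra_simps)
        from has_vector_derivative_mult[OF has_vector_derivative_id[unfolded id_def] this] show ?thesis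
          by (simp add: \<alpha>_def)
      qed
      from fundamental_theorem_of_calculus[OF _ this] show ?thesis by simp
    qed
    have b: "(\<beta> z has_integral B z) {0..1}"
    proof -
      have "((\<lambda>t. t * B (t *\<^sub>R z)) has_vector_derivative \<beta> z t) (at t within {0..1})" if "t \<in> {0..1}" for t
      proof -
        have "((\<lambda>t. B (t *\<^sub>R z)) has_vector_derivative (A2 (t *\<^sub>R z) * Re z + B2 (t *\<^sub>R z) * Im z)) (at t within {0..1})"
          using has_derivative_compose[OF line[unfolded has_vector_derivative_def] dB[OF tz[OF z that]]]
          unfolding has_vector_derivative_def by (rule has_derivative_eq_rhs) (simp add: fun_eq_iff algebra_simps)
        from has_vector_derivative_mult[OF has_vector_derivative_id[unfolded id_def] this] show ?thesis
          by (simp add: \<beta>_def)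
      qed
      from fundamental_theorem_of_calculus[OF _ this] show ?thesis by simp
    qed
    have "(fx z has_integral A z *\<^sub>R bR + B z *\<^sub>R bI) (cbox 0 1)"
      unfolding fx_def [abs_def] using a b
      by (intro has_integral_add has_integral_scaleR_left) auto
    then have "blinfun_apply (integral (cbox 0 1) (fx z)) = (\<lambda>h. A z * Re h + B z * Im h)"
      by (simp add: integral_unique fun_eq_iff blinfun.add_left blinfun.scaleR_left bRI)
    then show "((\<lambda>z. integral (cbox 0 1) (f z)) has_derivative (\<lambda>h. A z * Re h + B z * Im h)) (at z)"
      using leib[OF z] at_within_open[OF z open_ball] by simp
  qed
  then show ?thesis by blast
qed

text \<open>The pullback under g: A and B at g z applied to Re and Im of g' h, regrouped by Re h and
  Im h. The Cauchy-Riemann equations for g and g' keep the mixed coefficient Q common to both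
  components.\<close>

lemma closed_form_pullback:
  assumes cf: "closed_form V A B" and hol: "g holomorphic_on U" and U: "open U" and sub: "g ` U \<subseteq> V"
  shows "closed_form U (\<lambda>z. A (g z) * Re (deriv g z) + B (g z) * Im (deriv g z))
                       (\<lambda>z. B (g z) * Re (deriv g z) - A (g z) * Im (deriv g z))"
proof -
  obtain A1 A2 B2 where cont: "continuous_on V A1" "continuous_on V A2" "continuous_on V B2"
    and dA: "\<And>z. z \<in> V \<Longrightarrow> (A has_derivative (\<lambda>h. A1 z * Re h + A2 z * Im h)) (at z)"
    and dB: "\<And>z. z \<in> V \<Longrightarrow> (B has_derivative (\<lambda>h. A2 z * Re h + B2 z * Im h)) (at z)"
    using cf unfolding closed_form_def by blast
  note contAB = closed_form_continuous[OF cf]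
  define a b a1 b1 where ab: "a z = Re (deriv g z)" "b z = Im (deriv g z)"
    "a1 z = Re (deriv (deriv g) z)" "b1 z = Im (deriv (deriv g) z)" for z
  have hol': "deriv g holomorphic_on U" "deriv (deriv g) holomorphic_on U"
    using hol U by (auto intro!: holomorphic_deriv)
  have contab: "continuous_on U a" "continuous_on U b" "continuous_on U a1" "continuous_on U b1"
    unfolding ab [abs_def] using hol' by (auto intro!: continuous_intros holomorphic_on_imp_continuous_on)
  have comp: "continuous_on U (\<lambda>z. F (g z))" if "continuous_on V F" for F :: "complex \<Rightarrow> real"
    by (rule continuous_on_compose2[OF that holomorphic_on_imp_continuous_on[OF hol] sub])
  have dg: "(g has_derivative (\<lambda>h. deriv g z * h)) (at z)" "(deriv g has_derivative (\<lambda>h. deriv (deriv g) z * h)) (at z)" if "z \<in> U" for z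
    using holomorphic_derivI[OF hol U that] holomorphic_derivI[OF hol'(1) U that] by (auto simp: has_field_derivative_def)
  have da: "(a has_derivative (\<lambda>h. a1 z * Re h - b1 z * Im h)) (at z)"
    "(b has_derivative (\<lambda>h. b1 z * Re h + a1 z * Im h)) (at z)" if "z \<in> U" for z
    unfolding ab [abs_def]
    by (rule has_derivative_eq_rhs[OF bounded_linear.has_derivative[OF bounded_linear_Re dg(2)[OF that]]], simp add: fun_eq_iff,
        rule has_derivative_eq_rhs[OF bounded_linear.has_derivative[OF bounded_linear_Im dg(2)[OF that]]], simp add: fun_eq_iff)
  have dAg: "((\<lambda>z. A (g z)) has_derivative (\<lambda>h. (A1 (g z) * a z + A2 (g z) * b z) * Re h + (A2 (g z) * a z - A1 (g z) * b z) * Im h)) (at z)"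
    if "z \<in> U" for z
    using sub that
    by (intro has_derivative_eq_rhs[OF has_derivative_compose[OF dg(1)[OF that] dA]]) (auto simp: fun_eq_iff ab algebra_simps)
  have dBg: "((\<lambda>z. B (g z)) has_derivative (\<lambda>h. (A2 (g z) * a z + B2 (g z) * b z) * Re h + (B2 (g z) * a z - A2 (g z) * b z) * Im h)) (at z)"
    if "z \<in> U" for z
    using sub that
    by (intro has_derivative_eq_rhs[OF has_derivative_compose[OF dg(1)[OF that] dB]]) (auto simp: fun_eq_iff ab algebra_simps)
  define P where "P z = (A1 (g z) * a z + A2 (g z) * b z) * a z + A (g z) * a1 z + (A2 (g z) * a z + B2 (g z) * b z) * b z + B (g z) * b1 z" for z
  define Q where "Q z = (A2 (g z) * a z - A1 (g z) * b z) * a z - A (g z) * b1 z + (B2 (g z) * a z - A2 (g z) * b z) * b z + B (g z) * a1 z" for z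
  define T where "T z = (B2 (g z) * a z - A2 (g z) * b z) * a z - B (g z) * b1 z - (A2 (g z) * a z - A1 (g z) * b z) * b z - A (g z) * a1 z" for z
  have "continuous_on U P" "continuous_on U Q" "continuous_on U T"
    unfolding P_def Q_def T_def by (intro continuous_intros comp cont contAB contab)+
  moreover have "((\<lambda>z. A (g z) * a z + B (g z) * b z) has_derivative (\<lambda>h. P z * Re h + Q z * Im h)) (at z)"
    "((\<lambda>z. B (g z) * a z - A (g z) * b z) has_derivative (\<lambda>h. Q z * Re h + T z * Im h)) (at z)" if "z \<in> U" for z
    by (rule has_derivative_eq_rhs[OF has_derivative_add[OF has_derivative_mult[OF dAg[OF that] da(1)[OF that]] has_derivative_mult[OF dBg[OF that] da(2)[OF that]]]],
        simp add: fun_eq_iff P_def Q_def algebra_simps,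
        rule has_derivative_eq_rhs[OF has_derivative_diff[OF has_derivative_mult[OF dBg[OF that] da(1)[OF that]] has_derivative_mult[OF dAg[OF that] da(2)[OF that]]]],
        simp add: fun_eq_iff Q_def T_def algebra_simps)
  ultimately show ?thesis unfolding closed_form_def ab[symmetric] by blast
qed

text \<open>A primitive on the disc is enough: it is found after pulling back along the Riemann map
  g and is carried back by its inverse f, where the chain rule for g (f z) = z removes the factor g'
  again.\<close>

lemma closed_form_simply_connected_exact:
  assumes cf: "closed_form S A B" and S: "open S" "simply_connected S" "S \<noteq> UNIV"
  shows "\<exists>\<phi>. form_primitive S A B \<phi>"
proof (cases "S = {}")
  case True
  then show ?thesis by (simp add: form_primitive_def)
next
  case False
  then obtain f g where f: "f holomorphic_on S" and g: "g holomorphic_on ball 0 1"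
    and fg: "\<And>z. z \<in> S \<Longrightarrow> f z \<in> ball 0 1 \<and> g (f z) = z"
    and gf: "\<And>z. z \<in> ball 0 1 \<Longrightarrow> g z \<in> S \<and> f (g z) = z"
    using S simply_connected_eq_biholomorphic_to_disc[OF S(1)] by blast
  have "closed_form (ball 0 1) (\<lambda>z. A (g z) * Re (deriv g z) + B (g z) * Im (deriv g z))
                       (\<lambda>z. B (g z) * Re (deriv g z) - A (g z) * Im (deriv g z))"
    by (rule closed_form_pullback[OF cf g open_ball]) (use gf in auto)
  then obtain \<phi> where \<phi>: "\<And>z. z \<in> ball 0 1 \<Longrightarrow> (\<phi> has_derivative (\<lambda>h. (A (g z) * Re (deriv g z) + B (g z) * Im (deriv g z)) * Re h
      + (B (g z) * Re (deriv g z) - A (g z) * Im (deriv g z)) * Im h)) (at z)"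
    using poincare_ball unfolding form_primitive_def by blast
  have "form_primitive S A B (\<lambda>z. \<phi> (f z))"
    unfolding form_primitive_def
  proof
    fix z assume z: "z \<in> S"
    have df: "(f has_field_derivative deriv f z) (at z)" by (rule holomorphic_derivI[OF f S(1) z])
    have fz: "f z \<in> ball 0 1" "g (f z) = z" using fg z by auto
    have dg: "(g has_field_derivative deriv g (f z)) (at (f z))" by (rule holomorphic_derivI[OF g open_ball fz(1)])
    have "((\<lambda>z. g (f z)) has_field_derivative deriv g (f z) * deriv f z) (at z)"
      by (rule DERIV_chain2[OF dg df])
    moreover have "((\<lambda>z. g (f z)) has_field_derivative 1) (at z)"
      by (rule has_field_derivative_transform_within_open[OF DERIV_ident S(1) z]) (simp add: fg)
    ultimately have one: "deriv g (f z) * deriv f z = 1" by (rule DERIV_unique)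
    have "((\<lambda>z. \<phi> (f z)) has_derivative (\<lambda>h. (A (g (f z)) * Re (deriv g (f z)) + B (g (f z)) * Im (deriv g (f z))) * Re (deriv f z * h)
      + (B (g (f z)) * Re (deriv g (f z)) - A (g (f z)) * Im (deriv g (f z))) * Im (deriv f z * h))) (at z)"
      by (rule has_derivative_compose[OF df[unfolded has_field_derivative_def] \<phi>[OF fz(1)]])
    moreover have "(A (g (f z)) * Re (deriv g (f z)) + B (g (f z)) * Im (deriv g (f z))) * Re (deriv f z * h)
      + (B (g (f z)) * Re (deriv g (f z)) - A (g (f z)) * Im (deriv g (f z))) * Im (deriv f z * h) = A z * Re h + B z * Im h" for h
    proof -
      have "deriv g (f z) * (deriv f z * h) = h" using one by (simp add: mult.assoc [symmetric])
      then have "Re (deriv g (f z) * (deriv f z * h)) = Re h" "Im (deriv g (f z) * (deriv f z * h)) = Im h" by (simp_all only:)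
      then have "A z * Re h + B z * Im h = A z * Re (deriv g (f z) * (deriv f z * h)) + B z * Im (deriv g (f z) * (deriv f z * h))" by simp
      then show ?thesis unfolding fz(2) times_complex.sel[of "deriv g (f z)"] by (simp only: algebra_simps)
    qed
    ultimately show "((\<lambda>z. \<phi> (f z)) has_derivative (\<lambda>h. A z * Re h + B z * Im h)) (at z)" by simp
  qed
  then show ?thesis by blast
qed

lemma primitive_line_integral:
  fixes c :: "real \<Rightarrow> complex"
  assumes prim: "form_primitive U A B \<phi>" and ab: "a \<le> b"
    and c: "\<And>t. t \<in> {a..b} \<Longrightarrow> (c has_vector_derivative c' t) (at t within {a..b})" "\<And>t. t \<in> {a..b} \<Longrightarrow> c t \<in> U"
  shows "((\<lambda>t. A (c t) * Re (c' t) + B (c t) * Im (c' t)) has_integral \<phi> (c b) - \<phi> (c a)) {a..b}"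
proof (rule fundamental_theorem_of_calculus[OF ab])
  fix t assume t: "t \<in> {a..b}"
  have "(\<phi> has_derivative (\<lambda>h. A (c t) * Re h + B (c t) * Im h)) (at (c t))"
    using prim c(2)[OF t] by (simp add: form_primitive_def)
  from has_derivative_compose[OF c(1)[OF t, unfolded has_vector_derivative_def] this]
  show "((\<lambda>t. \<phi> (c t)) has_vector_derivative A (c t) * Re (c' t) + B (c t) * Im (c' t)) (at t within {a..b})"
    unfolding has_vector_derivative_def by (rule has_derivative_eq_rhs) (simp add: fun_eq_iff algebra_simps)
qed

lemma exp_lift_path:
  fixes g :: "real \<Rightarrow> complex"
  assumes g: "path g" "z0 \<notin> path_image g" and w: "z0 + exp w = pathstart g"
  obtains h where "path h" "pathstart h = w" "\<And>t. t \<in> {0..1} \<Longrightarrow> z0 + exp (h t) = g t"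
proof -
  have "path (\<lambda>t. g t - z0)" using g by (auto simp: path_def intro!: continuous_intros)
  moreover have "path_image (\<lambda>t. g t - z0) \<subseteq> - {0}" using g by (auto simp: path_image_def)
  moreover have "pathstart (\<lambda>t. g t - z0) = exp w" using w by (auto simp: pathstart_def algebra_simps)
  ultimately obtain h where "path h" "pathstart h = w" "\<And>t. t \<in> {0..1} \<Longrightarrow> exp (h t) = g t - z0"
    using covering_space_lift_path_strong[OF covering_space_exp_punctured_plane, of w] by blast
  then show thesis by (intro that[of h]) auto
qed

text \<open>Lifting curves through the logarithm turns a closed form on a ring-shaped domain into an
  exact one whose primitive is quasi-periodic; the line integral over a loop is then the product
  of a fixed period and the winding number.\<close>

lemma closed_form_period:
  assumes cf: "closed_form V A B" and V: "open V" "z0 \<notin> V"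
    and sc: "simply_connected {w. z0 + exp w \<in> V}" and ne: "{w. z0 + exp w \<in> V} \<noteq> UNIV"
  obtains C where "\<And>c c'. \<lbrakk>\<And>t. t \<in> {0..1} \<Longrightarrow> (c has_vector_derivative c' t) (at t within {0..1});
       continuous_on {0..1} c'; \<And>t. t \<in> {0..1} \<Longrightarrow> c t \<in> V; c 1 = c 0\<rbrakk> \<Longrightarrow>
      of_real (integral {0..1} (\<lambda>t. A (c t) * Re (c' t) + B (c t) * Im (c' t)))
        = of_real C * integral {0..1} (\<lambda>t. c' t / (c t - z0)) / (2 * of_real pi * \<i>)"
proof -
  define U where "U = {w. z0 + exp w \<in> V}"
  have "continuous_on UNIV (\<lambda>w. z0 + exp w)" by (intro continuous_intros)
  from open_vimage[OF V(1) this] have openU: "open U" by (simp add: U_def vimage_def)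
  show thesis
  proof (cases "U = {}")
    \<comment> \<open>Every point of V has a logarithm relative to z0, so an empty U leaves no curve
      to consider.\<close>
    case True
    show thesis
    proof (rule that[of 0])
      fix c c' :: "real \<Rightarrow> complex" assume cV: "\<And>t. t \<in> {0..1} \<Longrightarrow> c t \<in> V"
      have "c 0 \<in> V" by (rule cV) simp
      moreover from this have "c 0 \<noteq> z0" using V by auto
      then have "exp (Ln (c 0 - z0)) = c 0 - z0" by simp
      ultimately have "Ln (c 0 - z0) \<in> U" by (simp add: U_def)
      with True show "of_real (integral {0..1} (\<lambda>t. A (c t) * Re (c' t) + B (c t) * Im (c' t)))
        = of_real 0 * integral {0..1} (\<lambda>t. c' t / (c t - z0)) / (2 * of_real pi * \<i>)" by simp
    qed
  next
    case False
    define A' where "A' w = A (z0 + exp w) * Re (exp w) + B (z0 + exp w) * Im (exp w)" for w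
    define B' where "B' w = B (z0 + exp w) * Re (exp w) - A (z0 + exp w) * Im (exp w)" for w
    have dexp: "deriv (\<lambda>w. z0 + exp w) = exp"
      by (rule ext, rule DERIV_imp_deriv) (auto intro!: derivative_eq_intros)
    have hol: "(\<lambda>w. z0 + exp w) holomorphic_on U" by (intro holomorphic_intros)
    have "(\<lambda>w. z0 + exp w) ` U \<subseteq> V" by (auto simp: U_def)
    from closed_form_pullback[OF cf hol openU this] have "closed_form U A' B'"
      unfolding A'_def [abs_def] B'_def [abs_def] dexp .
    then obtain \<phi> where \<phi>: "form_primitive U A' B' \<phi>"
      using closed_form_simply_connected_exact[OF _ openU sc[folded U_def] ne[folded U_def]] by blast
    define T where "T = 2 * of_real pi * \<i>"
    have Tnz: "T \<noteq> 0" by (simp add: T_def)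
    have T: "exp (w + T) = exp w" for w by (simp add: T_def exp_add)
    have UT: "w + T \<in> U \<longleftrightarrow> w \<in> U" for w by (simp add: U_def T)
    have D: "((\<lambda>w. \<phi> (w + T) - \<phi> w) has_derivative (\<lambda>h. 0)) (at w)" if "w \<in> U" for w
    proof -
      have "((\<lambda>w. w + T) has_derivative (\<lambda>h. h)) (at w)" by (auto intro!: derivative_eq_intros)
      moreover have "(\<phi> has_derivative (\<lambda>h. A' w * Re h + B' w * Im h)) (at (w + T))"
        using \<phi> that UT[of w] unfolding form_primitive_def by (auto simp: A'_def B'_def T dest: bspec[of _ _ "w + T"])
      ultimately have "((\<lambda>w. \<phi> (w + T)) has_derivative (\<lambda>h. A' w * Re h + B' w * Im h)) (at w)"
        by (rule has_derivative_compose)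
      moreover have "(\<phi> has_derivative (\<lambda>h. A' w * Re h + B' w * Im h)) (at w)"
        using \<phi> that unfolding form_primitive_def by auto
      ultimately have "((\<lambda>w. \<phi> (w + T) - \<phi> w) has_derivative (\<lambda>h. (A' w * Re h + B' w * Im h) - (A' w * Re h + B' w * Im h))) (at w)"
        by (rule has_derivative_diff)
      then show ?thesis by simp
    qed
    obtain w0 where w0: "w0 \<in> U" using False by blast
    define C where "C = \<phi> (w0 + T) - \<phi> w0"
    have conU: "connected U" using sc simply_connected_imp_connected unfolding U_def by blast
    \<comment> \<open>The pulled-back form is invariant under the translation by T, so the increment
      of its primitive over T has derivative 0; U being connected, it is a constant.\<close>
    have step: "\<phi> (w + T) - \<phi> w = C" if "w \<in> U" for w
      unfolding C_def by (rule has_derivative_zero_unique_connected[OF openU conU D that w0])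
    have nat: "w + of_nat n * T \<in> U \<and> \<phi> (w + of_nat n * T) - \<phi> w = of_nat n * C" if "w \<in> U" for w n
    proof (induction n)
      case (Suc n)
      have "w + of_nat (Suc n) * T = (w + of_nat n * T) + T" by (simp add: algebra_simps)
      then show ?case using Suc step[of "w + of_nat n * T"] UT[of "w + of_nat n * T"] by (simp add: algebra_simps)
    qed (use that in simp)
    have int: "\<phi> v - \<phi> w = of_int n * C" if "w \<in> U" "v \<in> U" "v = w + of_int n * T" for v w n
    proof (cases n)
      case (nonneg m)
      then show ?thesis using nat[OF that(1), of m] that(3) by simp
    next
      case (neg m)
      then have n: "(of_int n :: complex) = - of_nat (Suc m)" "(of_int n :: real) = - of_nat (Suc m)" by auto
      have "w = v + of_nat (Suc m) * T" unfolding that(3) n by (simp del: of_nat_Suc)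
      then show ?thesis using nat[OF that(2), of "Suc m"] unfolding n by (simp del: of_nat_Suc)
    qed
    show thesis
    proof (rule that[of C])
      fix c c' :: "real \<Rightarrow> complex" assume c: "\<And>t. t \<in> {0..1} \<Longrightarrow> (c has_vector_derivative c' t) (at t within {0..1})"
        and cc: "continuous_on {0..1} c'" and cV: "\<And>t. t \<in> {0..1} \<Longrightarrow> c t \<in> V" and c01: "c 1 = c 0"
      have c0: "continuous_on {0..1} c"
        using c by (meson continuous_on_eq_continuous_within has_vector_derivative_continuous)
      have nz: "c t - z0 \<noteq> 0" if "t \<in> {0..1}" for t using cV[OF that] V by auto
      define k where "k t = c' t / (c t - z0)" for t
      have k: "continuous_on {0..1} k" unfolding k_def using nz by (intro continuous_intros cc c0) auto
      \<comment> \<open>A logarithm of c - z0 along the curve. Building it by integrating c' / (c -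
        z0) makes its total increment the integral in the claim; it is a logarithm because (c - z0)
        exp (-q) is constant and starts at 1.\<close>
      define q where "q t = Ln (c 0 - z0) + integral {0..t} k" for t
      have dq: "(q has_vector_derivative k t) (at t within {0..1})" if "t \<in> {0..1}" for t
        using has_vector_derivative_add[OF has_vector_derivative_const integral_has_vector_derivative[OF k that]]
        unfolding q_def by simp
      have ex: "((\<lambda>t. (c t - z0) * exp (- q t)) has_vector_derivative 0) (at t within {0..1})" if "t \<in> {0..1}" for t
      proof -
        have e: "((\<lambda>t. exp (- q t)) has_vector_derivative (- k t) * exp (- q t)) (at t within {0..1})"
          using field_vector_diff_chain_within[OF has_vector_derivative_minus[OF dq[OF that]], of exp "exp (- q t)"]
          by (auto simp: o_def intro: has_field_derivative_at_within DERIV_exp)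
        have "((\<lambda>t. (c t - z0) * exp (- q t)) has_vector_derivative ((c t - z0) * ((- k t) * exp (- q t)) + c' t * exp (- q t))) (at t within {0..1})"
          using has_vector_derivative_mult[OF has_vector_derivative_diff[OF c[OF that] has_vector_derivative_const] e] by simp
        moreover have "(c t - z0) * ((- k t) * exp (- q t)) + c' t * exp (- q t) = 0"
          using nz[OF that] by (simp add: k_def)
        ultimately show ?thesis by simp
      qed
      obtain d where d: "\<And>t. t \<in> {0..1} \<Longrightarrow> (c t - z0) * exp (- q t) = d"
        using has_vector_derivative_zero_constant[OF _ ex] by auto
      have "d = 1" using d[of 0] nz[of 0] by (simp add: q_def exp_minus)
      then have eq: "exp (q t) = c t - z0" if "t \<in> {0..1}" for t
        using d[OF that] by (simp add: exp_minus field_simps)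
      have qU: "q t \<in> U" if "t \<in> {0..1}" for t using cV[OF that] eq[OF that] by (simp add: U_def)
      have hi: "((\<lambda>t. A' (q t) * Re (k t) + B' (q t) * Im (k t)) has_integral \<phi> (q 1) - \<phi> (q 0)) {0..1}"
        by (rule primitive_line_integral[OF \<phi>]) (use dq qU in auto)
      have pull: "A' (q t) * Re (k t) + B' (q t) * Im (k t) = A (c t) * Re (c' t) + B (c t) * Im (c' t)" if "t \<in> {0..1}" for t
      proof -
        have "c' t = (c t - z0) * k t" using nz[OF that] by (simp add: k_def)
        then have ri: "Re (c' t) = Re (c t - z0) * Re (k t) - Im (c t - z0) * Im (k t)"
          "Im (c' t) = Re (c t - z0) * Im (k t) + Im (c t - z0) * Re (k t)" by (simp_all only: times_complex.sel)
        show ?thesis unfolding A'_def B'_def eq[OF that] ri by (simp add: algebra_simps)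
      qed
      have I: "integral {0..1} (\<lambda>t. A (c t) * Re (c' t) + B (c t) * Im (c' t)) = \<phi> (q 1) - \<phi> (q 0)"
        by (rule integral_unique[OF has_integral_eq[OF pull hi]])
      have "exp (q 1) = exp (q 0)" using eq[of 0] eq[of 1] c01 by simp
      then obtain n :: int where "q 1 = q 0 + (of_int (2 * n) * pi) * \<i>" by (auto simp: exp_eq)
      then have n: "q 1 = q 0 + of_int n * T" by (simp add: T_def)
      then have "\<phi> (q 1) - \<phi> (q 0) = of_int n * C" by (intro int qU) auto
      moreover have "integral {0..1} (\<lambda>t. c' t / (c t - z0)) = of_int n * T"
        using n unfolding k_def [abs_def, symmetric] by (simp add: q_def)
      ultimately show "of_real (integral {0..1} (\<lambda>t. A (c t) * Re (c' t) + B (c t) * Im (c' t)))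
        = of_real C * integral {0..1} (\<lambda>t. c' t / (c t - z0)) / (2 * of_real pi * \<i>)"
        unfolding I T_def[symmetric] using Tnz by simp
    qed
  qed
qed

section \<open>Flux through a Jordan curve\<close>

lemma limit_at_0_sequence:
  assumes "continuous_on {0..<\<epsilon>} f" "(\<epsilon>::real) > 0"
  obtains X :: "nat \<Rightarrow> real" where "\<And>n. 0 < X n" "\<And>n. X n < \<epsilon>" "(\<lambda>n. f (X n)) \<longlonglongrightarrow> f 0"
proof -
  \<comment> \<open>Shifted by two so that X 0, too, is strictly below \<epsilon>.\<close>
  define X where "X n = \<epsilon> * inverse (real (Suc (Suc n)))" for n
  have X: "X \<longlonglongrightarrow> 0"
    unfolding X_def using tendsto_mult_right_zero[OF LIMSEQ_Suc[OF LIMSEQ_inverse_real_of_nat], of \<epsilon>] by simp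
  have XS: "0 < X n" "X n < \<epsilon>" for n
  proof -
    have "0 < inverse (real (Suc (Suc n)))" "inverse (real (Suc (Suc n))) < 1"
      by (auto simp: inverse_less_1_iff)
    then show "0 < X n" "X n < \<epsilon>"
      unfolding X_def using assms(2) mult_strict_left_mono[of "inverse (real (Suc (Suc n)))" 1 \<epsilon>]
      by (auto simp del: of_nat_Suc)
  qed
  have "(\<lambda>n. f (X n)) \<longlonglongrightarrow> f 0"
    by (rule continuous_on_tendsto_compose[OF assms(1) X])
       (use assms(2) XS in \<open>auto intro!: always_eventually simp: less_imp_le\<close>)
  with XS that show thesis by blast
qed

text \<open>How identities reach a boundary: they hold on the nearby curves 0 < s < \<epsilon>, and
  the expression is continuous at s = 0.\<close>

lemma limit_at_0_const:
  fixes f :: "real \<Rightarrow> 'a::t2_space"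
  assumes "continuous_on {0..<\<epsilon>} f" "\<epsilon> > 0" "\<And>s. 0 < s \<Longrightarrow> s < \<epsilon> \<Longrightarrow> f s = a"
  shows "f 0 = a"
proof -
  obtain X where X: "\<And>n. 0 < X n" "\<And>n. X n < \<epsilon>" "(\<lambda>n. f (X n)) \<longlonglongrightarrow> f 0"
    by (rule limit_at_0_sequence[OF assms(1,2)]) blast
  then have "(\<lambda>n::nat. a) \<longlonglongrightarrow> f 0" using assms(3)[OF X(1,2)] by simp
  then show ?thesis by (simp add: LIMSEQ_const_iff)
qed

lemma limit_at_0_closure:
  fixes f :: "real \<Rightarrow> 'a::metric_space"
  assumes "continuous_on {0..<\<epsilon>} f" "\<epsilon> > 0" "\<And>s. 0 < s \<Longrightarrow> s < \<epsilon> \<Longrightarrow> f s \<in> V"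
  shows "f 0 \<in> closure V"
proof -
  obtain X where X: "\<And>n. 0 < X n" "\<And>n. X n < \<epsilon>" "(\<lambda>n. f (X n)) \<longlonglongrightarrow> f 0"
    by (rule limit_at_0_sequence[OF assms(1,2)]) blast
  show ?thesis
    unfolding closure_sequential by (intro exI[of _ "\<lambda>n. f (X n)"] conjI allI assms(3) X)
qed

section \<open>Offset curves of a Jordan curve\<close>

locale jordan_C2_curve =
  fixes c c1 c2 :: "real \<Rightarrow> complex"
  assumes deriv: "\<And>t. (c has_vector_derivative c1 t) (at t)"
    and deriv2: "\<And>t. (c1 has_vector_derivative c2 t) (at t)"
    and cont2: "continuous_on UNIV c2"
    and nz: "\<And>t. c1 t \<noteq> 0"
    and periodic: "\<And>t. c (t + 1) = c t"
    and inj: "inj_on c {0..<1}"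
begin

lemma cont: "continuous_on S c" "continuous_on S c1"
  using deriv deriv2 by (meson continuous_at_imp_continuous_on has_vector_derivative_continuous)+

lemma cont2': "continuous_on S c2"
  using cont2 continuous_on_subset by blast

lemma periodic1: "c1 (t + 1) = c1 t"
proof -
  have "((\<lambda>t. c (t + 1)) has_vector_derivative c1 (t + 1)) (at t)"
  proof -
    have "((\<lambda>t::real. t + 1) has_vector_derivative 1) (at t)"
      by (auto intro!: derivative_eq_intros simp flip: has_real_derivative_iff_has_vector_derivative)
    from vector_diff_chain_at[OF this deriv[of "t + 1"]] show ?thesis by (simp add: o_def)
  qed
  then have "(c has_vector_derivative c1 (t + 1)) (at t)" by (simp add: periodic)
  then show ?thesis using deriv[of t] vector_derivative_unique_at by blast
qed

lemma periodic_int: "c (t + of_int n) = c t"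
proof -
  have nat: "c (t + of_nat m) = c t" for t m
  proof (induction m)
    case (Suc m)
    then show ?case using periodic[of "t + of_nat m"] by (simp add: add_ac)
  qed simp
  show ?thesis
  proof (cases n)
    case (nonneg m)
    then show ?thesis using nat by simp
  next
    case (neg m)
    then show ?thesis using nat[of "t + of_int n" "Suc m"] by simp
  qed
qed

lemma c_eq_iff: "c t = c t' \<longleftrightarrow> (\<exists>n::int. t' = t + of_int n)"
proof
  assume eq: "c t = c t'"
  have fr: "c (frac x) = c x" for x
    using periodic_int[of "frac x" "\<lfloor>x\<rfloor>"] by (simp add: frac_def)
  have "c (frac t) = c (frac t')" using eq fr by simp
  then have "frac t = frac t'" using inj by (auto simp: inj_on_def frac_ge_0 frac_lt_1)
  then have "t' = t + of_int (\<lfloor>t'\<rfloor> - \<lfloor>t\<rfloor>)" by (simp add: frac_def)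
  then show "\<exists>n::int. t' = t + of_int n" by blast
qed (use periodic_int in auto)

abbreviation \<Gamma> where "\<Gamma> \<equiv> c ` {0..1}"

lemma c_in_\<Gamma>: "c t \<in> \<Gamma>"
proof -
  have "c t = c (frac t)" using periodic_int[of "frac t" "\<lfloor>t\<rfloor>"] by (simp add: frac_def)
  then show ?thesis by (metis atLeastAtMost_iff frac_ge_0 frac_lt_1 image_eqI less_imp_le)
qed

lemma simple_path_c: "simple_path c" "pathfinish c = pathstart c" "path_image c = \<Gamma>"
proof -
  show "pathfinish c = pathstart c" using periodic[of 0] by (simp add: pathfinish_def pathstart_def)
  show "path_image c = \<Gamma>" by (simp add: path_image_def)
  show "simple_path c"
    unfolding simple_path_def path_def loop_free_def
  proof (intro conjI cont ballI impI)
    fix x y assume xy: "x \<in> {0..1::real}" "y \<in> {0..1}" "c x = c y"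
    then obtain n :: int where n: "y = x + of_int n" using c_eq_iff by blast
    then have "\<bar>real_of_int n\<bar> \<le> 1" using xy by auto
    then have "n = -1 \<or> n = 0 \<or> n = 1" by linarith
    then show "x = y \<or> x = 0 \<and> y = 1 \<or> x = 1 \<and> y = 0" using xy n by auto
  qed
qed

lemma jordan:
  "open (inside \<Gamma>)" "connected (inside \<Gamma>)" "bounded (inside \<Gamma>)" "open (outside \<Gamma>)" "connected (outside \<Gamma>)"
  "inside \<Gamma> \<inter> outside \<Gamma> = {}" "inside \<Gamma> \<union> outside \<Gamma> = - \<Gamma>"
  "frontier (inside \<Gamma>) = \<Gamma>" "frontier (outside \<Gamma>) = \<Gamma>" "inside \<Gamma> \<noteq> {}"
  using Jordan_inside_outside[OF simple_path_c(1,2)] unfolding simple_path_c(3) by blast+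

lemma sides:
  "x \<in> inside \<Gamma> \<Longrightarrow> x \<notin> outside \<Gamma>" "x \<in> inside \<Gamma> \<Longrightarrow> x \<notin> \<Gamma>" "x \<in> outside \<Gamma> \<Longrightarrow> x \<notin> \<Gamma>"
  "x \<notin> \<Gamma> \<Longrightarrow> x \<in> inside \<Gamma> \<or> x \<in> outside \<Gamma>"
  using jordan(6,7) by blast+

text \<open>- i c1 is the tangent turned by a right angle, left unnormalised; which side it points
  to depends on the orientation of c. As c is C^2, each offset curve is C^1 with velocity
  \<open>offset1\<close>.\<close>

definition offset where "offset s t = c t - \<i> * of_real s * c1 t"
definition offset1 where "offset1 s t = c1 t - \<i> * of_real s * c2 t"

lemma offset_deriv: "(offset s has_vector_derivative offset1 s t) (at t within T)"
  unfolding offset_def [abs_def] offset1_def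
  by (intro has_vector_derivative_diff has_vector_derivative_mult_right
        has_vector_derivative_at_within[OF deriv] has_vector_derivative_at_within[OF deriv2])

lemma cont_offset:
  "continuous_on S (\<lambda>x. offset (fst x) (snd x))" "continuous_on S (\<lambda>x. offset1 (fst x) (snd x))"
  unfolding offset_def offset1_def
  by (intro continuous_intros continuous_on_compose2[OF cont(1)[of UNIV]] continuous_on_compose2[OF cont(2)[of UNIV]]
       continuous_on_compose2[OF cont2]; simp)+

lemma cont_offset_t: "continuous_on S (offset1 s)"
  unfolding offset1_def [abs_def] by (intro continuous_intros cont cont2')

lemma offset_1: "offset s 1 = offset s 0"
  using periodic[of 0] periodic1[of 0] by (simp add: offset_def)

lemma offset_0: "offset 0 t = c t" "offset1 0 t = c1 t" by (simp_all add: offset_def offset1_def)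

lemma c1_bounds:
  obtains m M where "m > 0" "\<And>t. t \<in> {0..1} \<Longrightarrow> m \<le> norm (c1 t)" "\<And>t. t \<in> {0..1} \<Longrightarrow> norm (c1 t) \<le> M"
proof -
  have cn: "continuous_on {0..1} (\<lambda>t. norm (c1 t))" by (intro continuous_intros cont)
  obtain t0 where t0: "t0 \<in> {0..1}" "\<And>t. t \<in> {0..1} \<Longrightarrow> norm (c1 t0) \<le> norm (c1 t)"
    using continuous_attains_inf[OF compact_Icc _ cn] by auto
  obtain t1 where t1: "t1 \<in> {0..1}" "\<And>t. t \<in> {0..1} \<Longrightarrow> norm (c1 t) \<le> norm (c1 t1)"
    using continuous_attains_sup[OF compact_Icc _ cn] by auto
  show thesis using that[of "norm (c1 t0)" "norm (c1 t1)"] t0 t1 nz by auto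
qed

text \<open>A uniform tubular neighbourhood. A hit c t' = offset s t with t and t' apart is excluded
  by the positive distance d0 between such points of the curve. With t and t' close it is excluded
  by the projection onto the tangent at t, which increases strictly along the curve but agrees at t
  and t', as the offset is normal.\<close>

lemma offset_avoids:
  obtains \<epsilon> where "\<epsilon> > 0" "\<And>s t. 0 < \<bar>s\<bar> \<Longrightarrow> \<bar>s\<bar> < \<epsilon> \<Longrightarrow> t \<in> {0..1} \<Longrightarrow> offset s t \<notin> \<Gamma>"
proof -
  obtain m M where m: "m > 0" "\<And>t. t \<in> {0..1} \<Longrightarrow> m \<le> norm (c1 t)" and M: "\<And>t. t \<in> {0..1} \<Longrightarrow> norm (c1 t) \<le> M"
    by (rule c1_bounds) blast
  have M0: "M > 0" using m(2)[of 0] M[of 0] m(1) by simp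
  have "uniformly_continuous_on {-1..2} c1"
    by (intro compact_uniformly_continuous cont compact_Icc)
  then obtain \<delta> where \<delta>: "\<delta> > 0" "\<And>t t'. t \<in> {-1..2} \<Longrightarrow> t' \<in> {-1..2} \<Longrightarrow> dist t' t < \<delta> \<Longrightarrow> dist (c1 t') (c1 t) < m"
    using uniformly_continuous_onE[OF _ m(1)] by metis
  \<comment> \<open>Modulo the period t' can be chosen within 1/2 of t, hence in [-1, 2]. The bound
    1/2 also excludes the coincidence of c t with c (t + 1), so c is injective on the pairs in
    K.\<close>
  define K where "K = {x. fst x \<in> {0..1::real} \<and> snd x \<in> {-1..2::real} \<and> \<bar>fst x - snd x\<bar> \<ge> \<delta> \<and> \<bar>fst x - snd x\<bar> \<le> 1/2}"
  have K: "compact K"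
  proof -
    have "K = ({0..1} \<times> {-1..2}) \<inter> {x. \<delta> \<le> \<bar>fst x - snd x\<bar>} \<inter> {x. \<bar>fst x - snd x\<bar> \<le> 1/2}"
      unfolding K_def by auto
    moreover have "closed {x::real \<times> real. \<delta> \<le> \<bar>fst x - snd x\<bar>}" "closed {x::real \<times> real. \<bar>fst x - snd x\<bar> \<le> 1/2}"
      by (intro closed_Collect_le continuous_intros)+
    ultimately show ?thesis by (simp add: compact_Int_closed compact_Times)
  qed
  have pos: "norm (c (fst x) - c (snd x)) > 0" if "x \<in> K" for x
  proof -
    have "c (fst x) \<noteq> c (snd x)"
    proof
      assume "c (fst x) = c (snd x)"
      then obtain n :: int where n: "snd x = fst x + of_int n" using c_eq_iff by blast
      then have "\<bar>real_of_int n\<bar> \<le> 1/2" using that by (auto simp: K_def)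
      then have "n = 0" by linarith
      then show False using n that \<delta>(1) by (auto simp: K_def)
    qed
    then show ?thesis by simp
  qed
  obtain d0 where d0: "d0 > 0" "\<And>x. x \<in> K \<Longrightarrow> d0 \<le> norm (c (fst x) - c (snd x))"
  proof (cases "K = {}")
    case True
    then show ?thesis using that[of 1] by simp
  next
    case False
    have "continuous_on K (\<lambda>x. norm (c (fst x) - c (snd x)))"
      by (intro continuous_intros continuous_on_compose2[OF cont(1)[of UNIV]]) auto
    from continuous_attains_inf[OF K False this] obtain x0 where "x0 \<in> K"
      "\<And>x. x \<in> K \<Longrightarrow> norm (c (fst x0) - c (snd x0)) \<le> norm (c (fst x) - c (snd x))" by blast
    then show ?thesis using pos that by blast
  qed
  have "offset s t \<notin> \<Gamma>" if s: "0 < \<bar>s\<bar>" "\<bar>s\<bar> < d0 / M" and t: "t \<in> {0..1}" for s t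
  proof
    assume "offset s t \<in> \<Gamma>"
    then obtain u where u: "offset s t = c u" by blast
    define t' where "t' = u - of_int (round (u - t))"
    have t': "\<bar>t - t'\<bar> \<le> 1/2"
      using of_int_round_abs_le[of "u - t"] by (simp add: t'_def abs_le_iff algebra_simps)
    have "c t' = c u" using periodic_int[of u "- round (u - t)"] by (simp add: t'_def)
    then have eq: "c t' - c t = - \<i> * of_real s * c1 t" using u by (simp add: offset_def algebra_simps)
    have t'r: "t' \<in> {-1..2}" using t t' unfolding atLeastAtMost_iff by linarith
    have "norm (c t - c t') = \<bar>s\<bar> * norm (c1 t)"
      unfolding norm_minus_commute[of "c t"] eq by (simp add: norm_mult)
    also have "\<dots> \<le> \<bar>s\<bar> * M" using M[OF t] by (intro mult_left_mono) auto
    also have "\<dots> < d0" using s(2) M0 by (simp add: field_simps)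
    finally have "(t, t') \<notin> K" using d0(2)[of "(t, t')"] by auto
    then have close: "\<bar>t - t'\<bar> < \<delta>" using t t' t'r by (auto simp: K_def)
    define h where "h \<tau> = Re (cnj (c1 t) * c \<tau>)" for \<tau>
    have dh: "(h has_real_derivative Re (cnj (c1 t) * c1 \<tau>)) (at \<tau>)" for \<tau>
    proof -
      have "((\<lambda>\<tau>. cnj (c1 t) * c \<tau>) has_vector_derivative cnj (c1 t) * c1 \<tau>) (at \<tau>)"
        by (rule has_vector_derivative_mult_right[OF deriv])
      then show ?thesis unfolding h_def [abs_def] by (simp only: has_vector_derivative_complex_iff)
    qed
    have pos: "Re (cnj (c1 t) * c1 \<tau>) > 0" if "\<bar>\<tau> - t\<bar> < \<delta>" "\<tau> \<in> {-1..2}" for \<tau>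
    proof -
      have "norm (c1 \<tau> - c1 t) < m" using \<delta>(2)[of t \<tau>] that t by (auto simp: dist_norm)
      also have "m \<le> norm (c1 t)" using m t by simp
      finally have l: "norm (c1 \<tau> - c1 t) < norm (c1 t)" .
      have "Re (cnj (c1 t) * c1 \<tau>) = (norm (c1 t))\<^sup>2 + Re (cnj (c1 t) * (c1 \<tau> - c1 t))"
        unfolding cmod_power2 by (simp add: power2_eq_square algebra_simps)
      moreover have "\<bar>Re (cnj (c1 t) * (c1 \<tau> - c1 t))\<bar> \<le> norm (c1 t) * norm (c1 \<tau> - c1 t)"
        using abs_Re_le_cmod[of "cnj (c1 t) * (c1 \<tau> - c1 t)"] by (simp add: norm_mult)
      moreover have "norm (c1 t) * norm (c1 \<tau> - c1 t) < (norm (c1 t))\<^sup>2"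
        using l nz[of t] by (simp add: power2_eq_square)
      ultimately show ?thesis by linarith
    qed
    have "h t' - h t = Re (cnj (c1 t) * (c t' - c t))" by (simp add: h_def algebra_simps)
    also have "\<dots> = 0" unfolding eq by simp
    finally have heq: "h t' = h t" by simp
    have "t' = t"
    proof (rule ccontr)
      assume "t' \<noteq> t"
      then consider "t < t'" | "t' < t" by linarith
      then show False
      proof cases
        case 1
        have "h t < h t'"
        proof (rule DERIV_pos_imp_increasing[OF 1])
          fix x assume "t \<le> x" "x \<le> t'"
          then show "\<exists>y. (h has_real_derivative y) (at x) \<and> 0 < y"
            using dh[of x] pos[of x] close t t'r by (intro exI[of _ "Re (cnj (c1 t) * c1 x)"]) auto
        qed
        with heq show False by simp
      next
        case 2
        have "h t' < h t"
        proof (rule DERIV_pos_imp_increasing[OF 2])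
          fix x assume "t' \<le> x" "x \<le> t"
          then show "\<exists>y. (h has_real_derivative y) (at x) \<and> 0 < y"
            using dh[of x] pos[of x] close t t'r by (intro exI[of _ "Re (cnj (c1 t) * c1 x)"]) auto
        qed
        with heq show False by simp
      qed
    qed
    with eq s nz[of t] show False by simp
  qed
  moreover have "d0 / M > 0" using d0 M0 by simp
  ultimately show thesis using that by blast
qed

text \<open>The foot of the perpendicular from a point to the curve shows that the offset curves fill
  a neighbourhood of the curve.\<close>

lemma near_curve_is_offset:
  assumes m: "m > 0" "\<And>t. t \<in> {0..1} \<Longrightarrow> m \<le> norm (c1 t)"
    and y: "y \<notin> \<Gamma>" "dist y (c t0) < \<epsilon> * m"
  obtains s t where "t \<in> {0..1}" "0 < \<bar>s\<bar>" "\<bar>s\<bar> < \<epsilon>" "y = offset s t"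
proof -
  have "continuous_on {0..1} (\<lambda>t. dist y (c t))" by (intro continuous_intros cont)
  from continuous_attains_inf[OF compact_Icc _ this]
  obtain t where t: "t \<in> {0..1}" "\<And>u. u \<in> {0..1} \<Longrightarrow> dist y (c t) \<le> dist y (c u)" by auto
  have min: "dist y (c t) \<le> dist y (c u)" for u
    using c_in_\<Gamma>[of u] t(2) by auto
  define h where "h \<tau> = (Re (y - c \<tau>))\<^sup>2 + (Im (y - c \<tau>))\<^sup>2" for \<tau>
  have hd: "h \<tau> = (dist y (c \<tau>))\<^sup>2" for \<tau> by (simp add: h_def dist_norm cmod_power2)
  have 1: "((\<lambda>\<tau>. Re (c \<tau>)) has_real_derivative Re (c1 t)) (at t)" "((\<lambda>\<tau>. Im (c \<tau>)) has_real_derivative Im (c1 t)) (at t)"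
    using deriv[of t] by (auto simp: has_vector_derivative_complex_iff)
  have "(h has_real_derivative (- 2 * Re (y - c t) * Re (c1 t) - 2 * Im (y - c t) * Im (c1 t))) (at t)"
    unfolding h_def [abs_def] minus_complex.sel power2_eq_square
    by (rule DERIV_cong[OF DERIV_add[OF DERIV_mult[OF DERIV_diff[OF DERIV_const 1(1)] DERIV_diff[OF DERIV_const 1(1)]]
            DERIV_mult[OF DERIV_diff[OF DERIV_const 1(2)] DERIV_diff[OF DERIV_const 1(2)]]]]) (simp add: algebra_simps)
  then have "- 2 * Re (y - c t) * Re (c1 t) - 2 * Im (y - c t) * Im (c1 t) = 0"
    by (rule DERIV_local_min[where d = 1]) (use min in \<open>auto simp: hd intro!: power_mono\<close>)
  then have perp: "Re (y - c t) * Re (c1 t) + Im (y - c t) * Im (c1 t) = 0" by algebra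
  \<comment> \<open>Orthogonality says that (y - c t) / c1 t is purely imaginary, which is exactly
    the form of an offset point.\<close>
  define w where "w = (y - c t) / c1 t"
  have "Re w = 0" using perp unfolding w_def by (simp add: Re_divide)
  then have w: "w = \<i> * of_real (Im w)" by (simp add: complex_eq_iff)
  have "y - c t = w * c1 t" using nz[of t] by (simp add: w_def)
  then have yo: "y = offset (- Im w) t" using w unfolding offset_def by (simp add: algebra_simps)
  have "\<bar>- Im w\<bar> = norm w" using w by (metis abs_minus_cancel norm_ii norm_mult norm_of_real mult_1)
  also have "\<dots> = dist y (c t) / norm (c1 t)" by (simp add: w_def norm_divide dist_norm)
  also have "\<dots> < \<epsilon>"
  proof -
    have "dist y (c t) < \<epsilon> * m" using min[of t0] y(2) by simp
    moreover have "\<epsilon> > 0" using m(1) y(2) zero_le_dist[of y "c t0"] by (metis less_le_trans not_less zero_less_mult_pos2 order_le_less_trans)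
    then have "\<epsilon> * m \<le> \<epsilon> * norm (c1 t)" using m t by (intro mult_left_mono) auto
    ultimately show ?thesis using nz[of t] by (simp add: field_simps)
  qed
  finally have "\<bar>- Im w\<bar> < \<epsilon>" .
  moreover have "0 < \<bar>- Im w\<bar>"
  proof (rule ccontr)
    assume "\<not> 0 < \<bar>- Im w\<bar>"
    then have "y = c t" using yo by (simp add: offset_def)
    then show False using y(1) t(1) by blast
  qed
  ultimately show thesis using that t(1) yo by blast
qed

text \<open>Each of the two strips is connected and avoids the curve, so it lies on one side.
  Together they fill a neighbourhood of c 0 off the curve, which contains points of both sides, so
  the strips lie on different sides; \<sigma> records the unknown orientation.\<close>

lemma offset_sides:
  obtains \<epsilon> \<sigma> where "\<epsilon> > 0" "\<sigma> = 1 \<or> \<sigma> = -1"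
    "\<And>s t. 0 < s \<Longrightarrow> s < \<epsilon> \<Longrightarrow> t \<in> {0..1} \<Longrightarrow> offset (\<sigma> * s) t \<in> inside \<Gamma>"
    "\<And>s t. 0 < s \<Longrightarrow> s < \<epsilon> \<Longrightarrow> t \<in> {0..1} \<Longrightarrow> offset (- \<sigma> * s) t \<in> outside \<Gamma>"
proof -
  obtain \<epsilon> where \<epsilon>: "\<epsilon> > 0" "\<And>s t. 0 < \<bar>s\<bar> \<Longrightarrow> \<bar>s\<bar> < \<epsilon> \<Longrightarrow> t \<in> {0..1} \<Longrightarrow> offset s t \<notin> \<Gamma>"
    by (rule offset_avoids) blast
  obtain m where m: "m > 0" "\<And>t. t \<in> {0..1} \<Longrightarrow> m \<le> norm (c1 t)"
    by (rule c1_bounds) blast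
  define T where "T \<sigma> = (\<lambda>x. offset (\<sigma> * fst x) (snd x)) ` ({0<..<\<epsilon>} \<times> {0..1})" for \<sigma>
  have side: "T \<sigma> \<subseteq> inside \<Gamma> \<or> T \<sigma> \<subseteq> outside \<Gamma>" if "\<sigma> = 1 \<or> \<sigma> = -1" for \<sigma>
  proof -
    have "connected (T \<sigma>)"
      unfolding T_def
    proof (rule connected_continuous_image)
      have "continuous_on ({0<..<\<epsilon>} \<times> {0..1}) (\<lambda>x. (\<sigma> * fst x, snd x))" by (intro continuous_intros)
      from continuous_on_compose2[OF cont_offset(1)[of UNIV] this]
      show "continuous_on ({0<..<\<epsilon>} \<times> {0..1}) (\<lambda>x. offset (\<sigma> * fst x) (snd x))" by simp
    qed (intro connected_Times connected_Ioo connected_Icc)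
    moreover have "T \<sigma> \<subseteq> inside \<Gamma> \<union> outside \<Gamma>"
    proof -
      have no: "offset (\<sigma> * s) t \<notin> \<Gamma>" if "s \<in> {0<..<\<epsilon>}" "t \<in> {0..1}" for s t
        using \<epsilon>(2)[of "\<sigma> * s" t] that \<open>\<sigma> = 1 \<or> \<sigma> = -1\<close> by auto
      show ?thesis unfolding jordan(7)
      proof
        fix y assume "y \<in> T \<sigma>"
        then obtain s t where "y = offset (\<sigma> * s) t" "s \<in> {0<..<\<epsilon>}" "t \<in> {0..1}" by (auto simp: T_def)
        then show "y \<in> - \<Gamma>" using no by simp
      qed
    qed
    ultimately show ?thesis
      using connectedD[of "T \<sigma>" "inside \<Gamma>" "outside \<Gamma>"] jordan(1,4,6) by blast
  qed
  have near: "y \<in> T 1 \<union> T (-1)" if y: "y \<notin> \<Gamma>" "dist y (c 0) < \<epsilon> * m" for y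
  proof -
    obtain s t where st: "t \<in> {0..1}" "0 < \<bar>s\<bar>" "\<bar>s\<bar> < \<epsilon>" "y = offset s t"
      using near_curve_is_offset[OF m y] by blast
    show ?thesis
    proof (cases "s > 0")
      case True
      then have "y \<in> T 1" unfolding T_def using st by (intro image_eqI[of _ _ "(s, t)"]) auto
      then show ?thesis by simp
    next
      case False
      then have "y \<in> T (-1)" unfolding T_def using st by (intro image_eqI[of _ _ "(-s, t)"]) auto
      then show ?thesis by simp
    qed
  qed
  have em: "\<epsilon> * m > 0" using \<epsilon> m by simp
  have "c 0 \<in> closure (inside \<Gamma>)" "c 0 \<in> closure (outside \<Gamma>)"
    using jordan(8,9) c_in_\<Gamma>[of 0] frontier_def[of "inside \<Gamma>"] frontier_def[of "outside \<Gamma>"] by blast+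
  then obtain y1 y2 where y1: "y1 \<in> inside \<Gamma>" "dist y1 (c 0) < \<epsilon> * m" and y2: "y2 \<in> outside \<Gamma>" "dist y2 (c 0) < \<epsilon> * m"
    using em unfolding closure_approachable by meson
  have y1': "y1 \<in> T 1 \<union> T (-1)" and y2': "y2 \<in> T 1 \<union> T (-1)"
    using near[OF sides(2)[OF y1(1)] y1(2)] near[OF sides(3)[OF y2(1)] y2(2)] by blast+
  have "\<exists>\<sigma>. (\<sigma> = 1 \<or> \<sigma> = -1) \<and> T \<sigma> \<subseteq> inside \<Gamma> \<and> T (- \<sigma>) \<subseteq> outside \<Gamma>"
  proof (cases "T 1 \<subseteq> inside \<Gamma>")
    case True
    then have "\<not> T (-1) \<subseteq> inside \<Gamma>" using y2(1) y2' jordan(6) True by blast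
    then show ?thesis using side[of "-1"] True by (intro exI[of _ 1]) auto
  next
    case False
    then have "T 1 \<subseteq> outside \<Gamma>" using side[of 1] by simp
    moreover from this have "\<not> T (-1) \<subseteq> outside \<Gamma>" using y1(1) y1' jordan(6) by blast
    ultimately show ?thesis using side[of "-1"] by (intro exI[of _ "-1"]) auto
  qed
  then obtain \<sigma> where \<sigma>: "\<sigma> = 1 \<or> \<sigma> = -1" "T \<sigma> \<subseteq> inside \<Gamma>" "T (- \<sigma>) \<subseteq> outside \<Gamma>" by blast
  show thesis
  proof (rule that[OF \<epsilon>(1) \<sigma>(1)])
    fix s t assume "0 < s" "s < \<epsilon>" "t \<in> {0..1::real}"
    then have x: "(s, t) \<in> {0<..<\<epsilon>} \<times> {0..1}" by auto
    show "offset (\<sigma> * s) t \<in> inside \<Gamma>" using \<sigma>(2) imageI[OF x, of "\<lambda>x. offset (\<sigma> * fst x) (snd x)"] unfolding T_def by auto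
    show "offset (- \<sigma> * s) t \<in> outside \<Gamma>" using \<sigma>(3) imageI[OF x, of "\<lambda>x. offset (- \<sigma> * fst x) (snd x)"] unfolding T_def by auto
  qed
qed

definition line_integral where
  "line_integral A B s = integral {0..1} (\<lambda>t. A (offset s t) * Re (offset1 s t) + B (offset s t) * Im (offset1 s t))"

lemma line_integral_continuous:
  assumes A: "continuous_on K A" "continuous_on K B"
    and inK: "\<And>s t. s \<in> {0..<\<epsilon>} \<Longrightarrow> t \<in> {0..1} \<Longrightarrow> offset (\<sigma> * s) t \<in> K"
  shows "continuous_on {0..<\<epsilon>} (\<lambda>s. line_integral A B (\<sigma> * s))"
proof -
  have sc: "continuous_on ({0..<\<epsilon>} \<times> cbox 0 1) (\<lambda>x. (\<sigma> * fst x, snd x))" by (intro continuous_intros)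
  have o: "continuous_on ({0..<\<epsilon>} \<times> cbox 0 1) (\<lambda>x. offset (\<sigma> * fst x) (snd x))"
    using continuous_on_compose2[OF cont_offset(1)[of UNIV] sc] by simp
  have o1: "continuous_on ({0..<\<epsilon>} \<times> cbox 0 1) (\<lambda>x. offset1 (\<sigma> * fst x) (snd x))"
    using continuous_on_compose2[OF cont_offset(2)[of UNIV] sc] by simp
  have "continuous_on ({0..<\<epsilon>} \<times> cbox 0 1) (\<lambda>(s, t). A (offset (\<sigma> * s) t) * Re (offset1 (\<sigma> * s) t) + B (offset (\<sigma> * s) t) * Im (offset1 (\<sigma> * s) t))"
    unfolding split_beta
    by (intro continuous_intros o1 continuous_on_compose2[OF A(1) o] continuous_on_compose2[OF A(2) o]) (auto intro!: inK)
  from integral_continuous_on_param[OF this] show ?thesis by (simp add: line_integral_def)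
qed

text \<open>The form is exact in the open domain, so it integrates to 0 over every inner offset
  loop. Continuity of A and B on the closure carries the zero to the curve itself, without a
  primitive there.\<close>

lemma interior_flux_zero:
  assumes cf: "closed_form (inside \<Gamma>) A B"
    and cont: "continuous_on (closure (inside \<Gamma>)) A" "continuous_on (closure (inside \<Gamma>)) B"
    and sc: "simply_connected (inside \<Gamma>)"
  shows "integral {0..1} (\<lambda>t. A (c t) * Re (c1 t) + B (c t) * Im (c1 t)) = 0"
proof -
  have ne: "inside \<Gamma> \<noteq> UNIV" using jordan(3) not_bounded_UNIV by metis
  obtain \<phi> where \<phi>: "form_primitive (inside \<Gamma>) A B \<phi>"
    using closed_form_simply_connected_exact[OF cf jordan(1) sc ne] by blast
  obtain \<epsilon> \<sigma> where \<epsilon>: "\<epsilon> > 0" and ins: "\<And>s t. 0 < s \<Longrightarrow> s < \<epsilon> \<Longrightarrow> t \<in> {0..1} \<Longrightarrow> offset (\<sigma> * s) t \<in> inside \<Gamma>"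
    by (rule offset_sides) blast
  have "line_integral A B (\<sigma> * s) = 0" if "0 < s" "s < \<epsilon>" for s
    unfolding line_integral_def
    using primitive_line_integral[OF \<phi>, of 0 1 "offset (\<sigma> * s)" "offset1 (\<sigma> * s)"] offset_deriv ins[OF that] offset_1
    by (simp add: integral_unique)
  moreover have "continuous_on {0..<\<epsilon>} (\<lambda>s. line_integral A B (\<sigma> * s))"
  proof (rule line_integral_continuous[OF cont])
    fix s t assume "s \<in> {0..<\<epsilon>}" "t \<in> {0..1::real}"
    then show "offset (\<sigma> * s) t \<in> closure (inside \<Gamma>)"
    proof (cases "s = 0")
      case True
      then show ?thesis using c_in_\<Gamma>[of t] jordan(8) frontier_def[of "inside \<Gamma>"] by (auto simp: offset_0)
    next
      case False
      then show ?thesis using ins[of s t] \<open>s \<in> {0..<\<epsilon>}\<close> \<open>t \<in> {0..1}\<close> closure_subset by fastforce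
    qed
  qed
  ultimately have "line_integral A B (\<sigma> * 0) = 0" using limit_at_0_const \<epsilon> by blast
  then show ?thesis by (simp add: line_integral_def offset_0)
qed

end

section \<open>The region between curve and circle, and its logarithmic cover\<close>

locale jordan_in_disc = jordan_C2_curve +
  fixes R :: real
  assumes in_disc: "closure (inside (c ` {0..1})) \<subseteq> ball 0 R"
begin

definition V where "V = ball 0 R - closure (inside \<Gamma>)"

lemma closure_inside: "closure (inside \<Gamma>) = inside \<Gamma> \<union> \<Gamma>"
  by (metis closure_Un_frontier jordan(8))

lemma V_eq: "V = ball 0 R \<inter> outside \<Gamma>"
  unfolding V_def closure_inside using jordan(6,7) by blast

lemma open_V: "open V" unfolding V_eq by (intro open_Int open_ball jordan)

lemma curve_in_closure_V: "c t \<in> closure V"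
proof -
  have "c t \<in> ball 0 R" using in_disc c_in_\<Gamma>[of t] unfolding closure_inside by blast
  moreover have "c t \<in> closure (outside \<Gamma>)" using c_in_\<Gamma>[of t] jordan(9) frontier_def[of "outside \<Gamma>"] by blast
  ultimately show ?thesis unfolding V_eq using open_Int_closure_subset[OF open_ball] by blast
qed

lemma inner_radius:
  obtains r1 where "0 < r1" "r1 < R" "closure (inside \<Gamma>) \<subseteq> ball 0 r1"
proof -
  have 1: "compact (closure (inside \<Gamma>))" using jordan(3) by (simp add: compact_closure)
  have 2: "closure (inside \<Gamma>) \<noteq> {}" using jordan(10) by simp
  obtain x where x: "x \<in> closure (inside \<Gamma>)" "\<And>y. y \<in> closure (inside \<Gamma>) \<Longrightarrow> norm y \<le> norm x"
    using continuous_attains_sup[OF 1 2 continuous_on_norm_id] by blast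
  have xR: "norm x < R" using x(1) in_disc by auto
  show thesis
  proof (rule that[of "(norm x + R) / 2"])
    have "norm x + R > 0" using xR norm_ge_zero[of x] by linarith
    then show "0 < (norm x + R) / 2" by simp
    show "(norm x + R) / 2 < R" using xR by simp
    show "closure (inside \<Gamma>) \<subseteq> ball 0 ((norm x + R) / 2)"
    proof
      fix y assume "y \<in> closure (inside \<Gamma>)"
      then have "norm y \<le> norm x" by (rule x(2))
      then show "y \<in> ball 0 ((norm x + R) / 2)" using xR by simp
    qed
  qed
qed

lemma outside_if_norm_ge:
  assumes "closure (inside \<Gamma>) \<subseteq> ball 0 r" "r \<le> norm z"
  shows "z \<in> outside \<Gamma>"
proof -
  have "z \<notin> closure (inside \<Gamma>)" using assms by auto
  then show ?thesis using sides(4) unfolding closure_inside by blast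
qed

text \<open>The connected outside of the curve is cut down to a closed ball of radius r > r1 by the
  radial retraction, which moves no point onto the curve or inside it. The open disc is not a
  retract of the plane, hence the exhaustion by the sets D r, which share the point r1.\<close>

lemma connected_V: "connected V"
proof -
  obtain r1 where r1: "0 < r1" "r1 < R" "closure (inside \<Gamma>) \<subseteq> ball 0 r1" by (rule inner_radius)
  define D where "D r = outside \<Gamma> \<inter> cball 0 r" for r
  have conn: "connected (D r)" if r: "r > r1" for r
  proof -
    have rp: "r > 0" using r r1 by simp
    define \<rho> where "\<rho> x = (r / max r (norm x)) *\<^sub>R x" for x :: complex
    have mx: "max r (norm x) > 0" for x :: complex using rp by (simp add: less_max_iff_disj)
    have "continuous_on (outside \<Gamma>) \<rho>"
      unfolding \<rho>_def by (intro continuous_intros ballI less_imp_neq[OF mx, symmetric])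
    moreover have "\<rho> ` outside \<Gamma> = D r"
    proof
      show "\<rho> ` outside \<Gamma> \<subseteq> D r"
      proof
        fix y assume "y \<in> \<rho> ` outside \<Gamma>"
        then obtain x where x: "x \<in> outside \<Gamma>" "y = \<rho> x" by blast
        show "y \<in> D r"
        proof (cases "norm x \<le> r")
          case True
          then have "y = x" using x rp by (simp add: \<rho>_def max_absorb1)
          then show ?thesis using x True by (simp add: D_def)
        next
          case False
          then have "x \<noteq> 0" using rp by auto
          then have "norm y = r" using x rp False by (simp add: \<rho>_def max_absorb2)
          then show ?thesis using outside_if_norm_ge[OF r1(3), of y] r by (simp add: D_def)
        qed
      qed
      show "D r \<subseteq> \<rho> ` outside \<Gamma>"
      proof
        fix x assume "x \<in> D r"
        then have "x \<in> outside \<Gamma>" "\<rho> x = x" using rp by (auto simp: D_def \<rho>_def max_absorb1)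
        then show "x \<in> \<rho> ` outside \<Gamma>" by (metis imageI)
      qed
    qed
    ultimately show ?thesis using connected_continuous_image jordan(5) by metis
  qed
  have "V = \<Union> (D ` {r1<..<R})"
  proof
    show "V \<subseteq> \<Union> (D ` {r1<..<R})"
    proof
      fix x assume x: "x \<in> V"
      define r where "r = max ((norm x + R) / 2) ((r1 + R) / 2)"
      have "r \<in> {r1<..<R}" "norm x \<le> r" using x r1 by (auto simp: r_def V_eq less_max_iff_disj le_max_iff_disj)
      moreover have "x \<in> outside \<Gamma>" using x by (simp add: V_eq)
      ultimately show "x \<in> \<Union> (D ` {r1<..<R})" by (auto simp: D_def)
    qed
    show "\<Union> (D ` {r1<..<R}) \<subseteq> V" by (auto simp: D_def V_eq)
  qed
  moreover have "connected (\<Union> (D ` {r1<..<R}))"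
  proof (rule connected_Union)
    have "of_real r1 \<in> D r" if "r \<in> {r1<..<R}" for r
      using outside_if_norm_ge[OF r1(3), of "of_real r1"] that r1 by (auto simp: D_def)
    then show "\<Inter> (D ` {r1<..<R}) \<noteq> {}" by blast
  qed (use conn in auto)
  ultimately show ?thesis by simp
qed

lemma circle_in_V:
  assumes "closure (inside \<Gamma>) \<subseteq> ball 0 r1" "r1 \<le> norm z" "norm z < R"
  shows "z \<in> V"
  using outside_if_norm_ge[OF assms(1,2)] assms(3) by (simp add: V_eq)

text \<open>V in the coordinate log (z - z0), invariant under translation by 2 pi i.\<close>

definition lifted where "lifted z0 = {w. z0 + exp w \<in> V}"

lemma lifted_translate: "w + 2 * of_real pi * \<i> * of_int n \<in> lifted z0 \<longleftrightarrow> w \<in> lifted z0"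
proof -
  have "exp (2 * of_real pi * \<i> * of_int n) = (1::complex)"
    using exp_integer_2pi[of "of_int n"] by (simp add: mult_ac)
  then show ?thesis by (simp add: lifted_def exp_add)
qed

lemma open_lifted: "open (lifted z0)"
proof -
  have "continuous_on UNIV (\<lambda>w. z0 + exp w)" by (intro continuous_intros)
  from open_vimage[OF open_V this] show ?thesis by (simp add: lifted_def vimage_def)
qed

text \<open>Paths in V lift, so each point can be joined to some translate q 0 + 2 pi i n.
  Neighbouring translates are joined because the circle of radius r1 lies in V and winds once around
  z0, so its logarithm climbs by 2 pi i.\<close>

lemma connected_lifted:
  assumes z0: "z0 \<in> inside \<Gamma>"
  shows "connected (lifted z0)"
proof -
  obtain r1 where r1: "0 < r1" "r1 < R" "closure (inside \<Gamma>) \<subseteq> ball 0 r1" by (rule inner_radius)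
  have z0V: "z0 \<notin> V" using sides(1)[OF z0] by (simp add: V_eq)
  have z0r: "norm z0 < r1" using subsetD[OF r1(3) subsetD[OF closure_subset z0]] by simp
  let ?g = "circlepath 0 r1"
  have gV: "path_image ?g \<subseteq> V" using circle_in_V[OF r1(3)] r1 by auto
  have "z0 \<notin> path_image ?g" using gV z0V by blast
  then obtain q where q: "path q" "pathfinish q - pathstart q = 2 * of_real pi * \<i> * winding_number ?g z0"
    "\<And>t. t \<in> {0..1} \<Longrightarrow> ?g t = z0 + exp (q t)"
    using winding_number_as_continuous_log[of ?g z0] by auto
  have "winding_number ?g z0 = 1" by (rule winding_number_circlepath) (use z0r in simp)
  then have q1: "q 1 = q 0 + 2 * of_real pi * \<i>" using q(2) by (simp add: pathfinish_def pathstart_def algebra_simps)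
  have qU: "q t \<in> lifted z0" if "t \<in> {0..1}" for t
    using gV q(3)[OF that] that unfolding lifted_def path_image_def by (metis (mono_tags, lifting) image_subset_iff mem_Collect_eq)
  have "path_component (lifted z0) (q 0 + 2 * of_real pi * \<i> * of_int n) (q 0 + 2 * of_real pi * \<i> * of_int (n + 1))" for n
  proof -
    have "path (\<lambda>t. q t + 2 * of_real pi * \<i> * of_int n)" using q(1) by (auto simp: path_def intro!: continuous_intros)
    moreover have "path_image (\<lambda>t. q t + 2 * of_real pi * \<i> * of_int n) \<subseteq> lifted z0"
      using qU by (auto simp: path_image_def lifted_translate)
    ultimately show ?thesis unfolding path_component_def
      by (intro exI[of _ "\<lambda>t. q t + 2 * of_real pi * \<i> * of_int n"]) (simp add: pathstart_def pathfinish_def q1 algebra_simps)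
  qed
  note step = this
  have base: "path_component (lifted z0) (q 0) (q 0 + 2 * of_real pi * \<i> * of_int n)" for n
  proof (induction n rule: int_induct[where k = 0])
    case base
    then show ?case using qU[of 0] by (simp add: path_component_refl)
  next
    case (step1 i)
    then show ?case using path_component_trans step by blast
  next
    case (step2 i)
    then show ?case using path_component_trans path_component_sym step[of "i - 1"] by (metis diff_add_cancel)
  qed
  have "path_component (lifted z0) w (q 0)" if w: "w \<in> lifted z0" for w
  proof -
    have "path_connected V" using connected_V open_V connected_open_path_connected by blast
    moreover have "z0 + exp w \<in> V" using w by (simp add: lifted_def)
    moreover have "z0 + exp (q 0) \<in> V" using qU[of 0] by (simp add: lifted_def)
    ultimately obtain g where g: "path g" "path_image g \<subseteq> V" "pathstart g = z0 + exp w" "pathfinish g = z0 + exp (q 0)"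
      unfolding path_connected_def by blast
    obtain h where h: "path h" "pathstart h = w" "\<And>t. t \<in> {0..1} \<Longrightarrow> z0 + exp (h t) = g t"
      using exp_lift_path[OF g(1), of z0 w] g z0V by (metis subsetD)
    have hU: "path_image h \<subseteq> lifted z0"
    proof -
      have "h t \<in> lifted z0" if "t \<in> {0..1}" for t
        using h(3)[OF that] g(2) that unfolding lifted_def path_image_def by (metis (mono_tags, lifting) image_subset_iff mem_Collect_eq)
      then show ?thesis by (auto simp: path_image_def)
    qed
    have "exp (h 1) = exp (q 0)" using h(3)[of 1] g(4) by (simp add: pathfinish_def)
    then obtain n :: int where "h 1 = q 0 + (of_int (2 * n) * pi) * \<i>" by (auto simp: exp_eq)
    then have "pathfinish h = q 0 + 2 * of_real pi * \<i> * of_int n" by (simp add: pathfinish_def)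
    then have "path_component (lifted z0) w (q 0 + 2 * of_real pi * \<i> * of_int n)"
      unfolding path_component_def using h hU by blast
    then show ?thesis using path_component_trans path_component_sym base by blast
  qed
  then have "path_connected (lifted z0)"
    unfolding path_connected_component using path_component_trans path_component_sym by blast
  then show ?thesis by (rule path_connected_imp_connected)
qed

text \<open>Prepares the proof that every complementary component of the cover is unbounded: from a
  point off V one can move, avoiding V and z0, far out or close to z0, and either makes |ln |z -
  z0|| large. A start on the curve itself is first pushed inwards along the normal.\<close>

lemma escape_path:
  assumes z0: "z0 \<in> inside \<Gamma>" and z: "z \<notin> V" "z \<noteq> z0" and N: "N > 0"
  obtains g where "path g" "pathstart g = z" "path_image g \<subseteq> - V - {z0}" "N \<le> \<bar>ln (norm (pathfinish g - z0))\<bar>"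
proof -
  have in_nV: "inside \<Gamma> \<subseteq> - V" "\<Gamma> \<subseteq> - V" using sides unfolding V_eq by blast+
  have inside_case: "\<exists>g. path g \<and> pathstart g = x \<and> path_image g \<subseteq> - V - {z0} \<and> N \<le> \<bar>ln (norm (pathfinish g - z0))\<bar>"
    if x: "x \<in> inside \<Gamma>" "x \<noteq> z0" for x
  proof -
    obtain e where e: "e > 0" "ball z0 e \<subseteq> inside \<Gamma>" using jordan(1) z0 open_contains_ball by blast
    \<comment> \<open>exp (- N) brings ln d down to - N; e / 2 keeps z0 + d inside the
      curve.\<close>
    define d where "d = min (e / 2) (exp (- N))"
    have d: "d > 0" "d < e" "d \<le> exp (- N)" using e by (auto simp: d_def)
    have "ln d \<le> - N" using d ln_mono[of d "exp (- N)"] by simp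
    have zd: "z0 + of_real d \<in> inside \<Gamma> - {z0}" using e d by (auto simp: dist_norm)
    have "connected (inside \<Gamma> - {z0})"
      using connected_open_delete[OF jordan(1,2), of z0] by simp
    then have "path_connected (inside \<Gamma> - {z0})"
      using jordan(1) by (intro connected_open_path_connected open_delete)
    then obtain g where "path g" "path_image g \<subseteq> inside \<Gamma> - {z0}" "pathstart g = x" "pathfinish g = z0 + of_real d"
      using x zd unfolding path_connected_def by (metis DiffI singletonD)
    then show ?thesis using \<open>ln d \<le> - N\<close> d(1) in_nV by (intro exI[of _ g]) auto
  qed
  have "norm z \<ge> R \<or> z \<in> inside \<Gamma> \<or> z \<in> \<Gamma>" using z(1) sides(4)[of z] unfolding V_eq by (meson IntI mem_ball_0 not_less)
  then consider "norm z \<ge> R" | "z \<in> inside \<Gamma>" | "z \<in> \<Gamma>" by blast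
  then show thesis
  proof cases
    case 1
    have z0R: "norm z0 < R" using subsetD[OF in_disc subsetD[OF closure_subset z0]] by simp
    have Rp: "R > 0" using z0R norm_ge_zero[of z0] by linarith
    \<comment> \<open>Chosen so that T R = R + exp N + |z0|, hence |T z - z0| \<ge> exp N whenever
      |z| \<ge> R.\<close>
    define T where "T = 1 + (exp N + norm z0) / R"
    have T: "T \<ge> 1" using Rp by (simp add: T_def)
    let ?g = "linepath z (of_real T * z)"
    have "x \<notin> V \<and> x \<noteq> z0" if x: "x \<in> path_image ?g" for x
    proof -
      obtain u where u: "u \<in> {0..1}" "x = (1 - u) *\<^sub>R z + u *\<^sub>R (of_real T * z)"
        using x by (auto simp: path_image_linepath closed_segment_def)
      have "x = of_real (1 + u * (T - 1)) * z" using u(2) by (simp add: scaleR_conv_of_real algebra_simps)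
      then have nx: "norm x = (1 + u * (T - 1)) * norm z" using u(1) T by (simp add: norm_mult del: of_real_add of_real_mult)
      have "1 * norm z \<le> (1 + u * (T - 1)) * norm z" using u(1) T by (intro mult_right_mono) auto
      then have "norm x \<ge> R" using nx 1 by simp
      then show ?thesis using z0R by (auto simp: V_eq)
    qed
    moreover have "N \<le> \<bar>ln (norm (pathfinish ?g - z0))\<bar>"
    proof -
      have "T * R \<le> T * norm z" using 1 T by (intro mult_left_mono) auto
      moreover have "T * R = R + exp N + norm z0" using Rp by (simp add: T_def field_simps)
      moreover have "norm (of_real T * z - z0) \<ge> T * norm z - norm z0"
        using norm_triangle_ineq2[of "of_real T * z" z0] T by (simp add: norm_mult)
      ultimately have "norm (of_real T * z - z0) \<ge> exp N" using Rp by linarith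
      then have "ln (norm (of_real T * z - z0)) \<ge> N" using ln_mono[of "exp N"] by simp
      then show ?thesis by simp
    qed
    ultimately show thesis using that[of ?g] by (simp add: subset_iff)
  next
    case 2
    then show thesis using inside_case z(2) that by blast
  next
    case 3
    then obtain t where t: "t \<in> {0..1}" "z = c t" by blast
    obtain \<epsilon> \<sigma> where \<epsilon>: "\<epsilon> > 0" and \<sigma>: "\<sigma> = 1 \<or> \<sigma> = -1"
      and ins: "\<And>s t. 0 < s \<Longrightarrow> s < \<epsilon> \<Longrightarrow> t \<in> {0..1} \<Longrightarrow> offset (\<sigma> * s) t \<in> inside \<Gamma>"
      by (rule offset_sides) blast
    have dz: "dist z0 z > 0" using z(2) by simp
    have n1: "norm (c1 t) > 0" using nz by simp
    \<comment> \<open>The first bound keeps the step inside the curve, the second makes it too short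
      to reach z0.\<close>
    define s where "s = min (\<epsilon> / 2) (dist z0 z / (2 * norm (c1 t)))"
    have s: "s > 0" "s < \<epsilon>" "s * norm (c1 t) < dist z0 z"
    proof -
      show "s > 0" "s < \<epsilon>" using \<epsilon> dz n1 by (auto simp: s_def)
      have "s * norm (c1 t) \<le> dist z0 z / (2 * norm (c1 t)) * norm (c1 t)"
        using n1 by (intro mult_right_mono) (auto simp: s_def)
      also have "\<dots> < dist z0 z" using n1 dz by simp
      finally show "s * norm (c1 t) < dist z0 z" .
    qed
    define g1 where "g1 \<tau> = offset (\<sigma> * (s * \<tau>)) t" for \<tau>
    have g1p: "path g1" unfolding g1_def path_def offset_def by (intro continuous_intros)
    have g1s: "pathstart g1 = z" using t by (simp add: g1_def pathstart_def offset_0)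
    have g1m: "g1 \<tau> \<in> - V - {z0}" if \<tau>: "\<tau> \<in> {0..1}" for \<tau>
    proof -
      have "g1 \<tau> \<in> inside \<Gamma> \<union> \<Gamma>"
      proof (cases "\<tau> = 0")
        case True
        then show ?thesis using 3 t by (simp add: g1_def offset_0)
      next
        case False
        then have "0 < s * \<tau>" using s \<tau> by auto
        moreover have "s * \<tau> \<le> s * 1" using s \<tau> by (intro mult_left_mono) auto
        then have "s * \<tau> < \<epsilon>" using s by linarith
        ultimately show ?thesis using ins[of "s * \<tau>" t] t by (simp add: g1_def)
      qed
      moreover have "g1 \<tau> \<noteq> z0"
      proof
        assume "g1 \<tau> = z0"
        then have "z0 - z = - \<i> * of_real (\<sigma> * (s * \<tau>)) * c1 t" unfolding t(2) g1_def offset_def by auto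
        then have "norm (z0 - z) = norm (- \<i> * of_real (\<sigma> * (s * \<tau>)) * c1 t)" by simp
        also have "\<dots> = \<bar>\<sigma>\<bar> * (s * \<tau>) * norm (c1 t)" using s \<tau> by (simp add: norm_mult abs_mult del: of_real_mult)
        also have "\<dots> = s * norm (c1 t) * \<tau>" using \<sigma> by auto
        also have "\<dots> \<le> s * norm (c1 t) * 1" using \<tau> s n1 by (intro mult_left_mono) auto
        also have "\<dots> < dist z0 z" using s by simp
        finally show False by (simp add: dist_norm)
      qed
      ultimately show ?thesis using in_nV by blast
    qed
    have "pathfinish g1 \<in> inside \<Gamma>" using ins[OF s(1,2) t(1)] by (simp add: g1_def pathfinish_def)
    moreover have "pathfinish g1 \<noteq> z0" using g1m[of 1] by (simp add: pathfinish_def)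
    ultimately obtain g2 where g2: "path g2" "pathstart g2 = pathfinish g1" "path_image g2 \<subseteq> - V - {z0}" "N \<le> \<bar>ln (norm (pathfinish g2 - z0))\<bar>"
      using inside_case by blast
    show thesis
    proof (rule that[of "g1 +++ g2"])
      show "path (g1 +++ g2)" using g1p g2 by simp
      show "pathstart (g1 +++ g2) = z" using g1s by simp
      have "path_image g1 \<subseteq> - V - {z0}" unfolding path_image_def using g1m by blast
      then show "path_image (g1 +++ g2) \<subseteq> - V - {z0}" using g2(2,3) by (simp add: path_image_join)
      show "N \<le> \<bar>ln (norm (pathfinish (g1 +++ g2) - z0))\<bar>" using g2(4) by simp
    qed
  qed
qed

text \<open>An open connected plane set is simply connected if no component of its complement is
  bounded. The lift of an escape path stays in the component of its start, while its real part ln |z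
  - z0| exceeds any given bound.\<close>

lemma simply_connected_lifted:
  assumes z0: "z0 \<in> inside \<Gamma>"
  shows "simply_connected (lifted z0)"
proof -
  have "\<not> bounded C" if C: "C \<in> components (- lifted z0)" for C
  proof
    assume "bounded C"
    then obtain N where N: "N > 0" "\<And>w. w \<in> C \<Longrightarrow> norm w \<le> N" by (auto simp: bounded_pos)
    obtain w where w: "w \<in> C" using C in_components_nonempty by blast
    then have wU: "w \<notin> lifted z0" using C in_components_subset by blast
    obtain g where g: "path g" "pathstart g = z0 + exp w" "path_image g \<subseteq> - V - {z0}" "N + 1 \<le> \<bar>ln (norm (pathfinish g - z0))\<bar>"
      using escape_path[OF z0, of "z0 + exp w" "N + 1"] wU N by (auto simp: lifted_def)
    obtain h where h: "path h" "pathstart h = w" "\<And>t. t \<in> {0..1} \<Longrightarrow> z0 + exp (h t) = g t"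
      using exp_lift_path[OF g(1), of z0 w] g by (metis Diff_iff insertI1 subsetD)
    have "h t \<in> - lifted z0" if "t \<in> {0..1}" for t
      using h(3)[OF that] g(3) that unfolding lifted_def path_image_def
      by (metis (mono_tags, lifting) Compl_iff DiffD1 imageI mem_Collect_eq subsetD)
    then have hU: "path_image h \<subseteq> - lifted z0" by (auto simp: path_image_def)
    have "path_image h \<subseteq> C"
    proof (rule components_maximal[OF C connected_path_image[OF h(1)] hU])
      show "C \<inter> path_image h \<noteq> {}" using w h(2) pathstart_in_path_image by blast
    qed
    then have "pathfinish h \<in> C" by blast
    then have "norm (pathfinish h) \<le> N" by (rule N)
    moreover have "norm (pathfinish g - z0) = exp (Re (pathfinish h))"
    proof -
      have "g 1 - z0 = exp (h 1)" using h(3)[of 1] by (simp add: algebra_simps)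
      then show ?thesis by (simp add: pathfinish_def)
    qed
    then have "\<bar>Re (pathfinish h)\<bar> \<ge> N + 1" using g(4) by simp
    ultimately show False using abs_Re_le_cmod[of "pathfinish h"] by linarith
  qed
  then show ?thesis
    using connected_lifted[OF z0] simply_connected_eq_unbounded_complement_components[OF open_lifted] by blast
qed

text \<open>Loop integrals of the form are C times the winding number about z0. On offset loops
  approaching the curve the winding integral tends to that of the curve, which is nonzero, so zero
  flux there forces C = 0. Hence the flux vanishes over the circles of radius between r1 and R, and
  over the circle of radius R as their limit.\<close>

lemma exterior_flux_zero:
  assumes cf: "closed_form V A B" and cont: "continuous_on (closure V) A" "continuous_on (closure V) B"
    and zero: "integral {0..1} (\<lambda>t. A (c t) * Re (c1 t) + B (c t) * Im (c1 t)) = 0"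
  shows "integral {0..2*pi} (\<lambda>\<theta>. B (of_real R * cis \<theta>) * (R * cos \<theta>) - A (of_real R * cis \<theta>) * (R * sin \<theta>)) = 0"
proof -
  obtain z0 where z0: "z0 \<in> inside \<Gamma>" using jordan(10) by blast
  obtain r1 where r1: "0 < r1" "r1 < R" "closure (inside \<Gamma>) \<subseteq> ball 0 r1" by (rule inner_radius)
  have z0V: "z0 \<notin> V" using sides(1)[OF z0] by (simp add: V_eq)
  have z0r: "norm z0 < r1" using subsetD[OF r1(3) subsetD[OF closure_subset z0]] by simp
  have ne: "lifted z0 \<noteq> UNIV"
  proof
    assume U: "lifted z0 = UNIV"
    have "R > 0" using r1 by simp
    have "z0 + exp (Ln (of_real R - z0)) \<in> V" using U by (auto simp: lifted_def)
    moreover have "of_real R - z0 \<noteq> 0" using z0r r1 by (metis eq_iff_diff_eq_0 norm_of_real abs_of_pos less_trans less_irrefl \<open>R > 0\<close>)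
    ultimately show False using \<open>R > 0\<close> by (simp add: V_eq)
  qed
  obtain C where C: "\<And>g g'. \<lbrakk>\<And>t. t \<in> {0..1} \<Longrightarrow> (g has_vector_derivative g' t) (at t within {0..1});
       continuous_on {0..1} g'; \<And>t. t \<in> {0..1} \<Longrightarrow> g t \<in> V; g 1 = g 0\<rbrakk> \<Longrightarrow>
      complex_of_real (integral {0..1} (\<lambda>t. A (g t) * Re (g' t) + B (g t) * Im (g' t)))
        = of_real C * integral {0..1} (\<lambda>t. g' t / (g t - z0)) / (2 * of_real pi * \<i>)"
    using closed_form_period[OF cf open_V z0V simply_connected_lifted[OF z0, unfolded lifted_def] ne[unfolded lifted_def]] by blast
  obtain \<epsilon>0 \<sigma> where \<epsilon>0: "\<epsilon>0 > 0" and \<sigma>: "\<sigma> = 1 \<or> \<sigma> = -1"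
    and out: "\<And>s t. 0 < s \<Longrightarrow> s < \<epsilon>0 \<Longrightarrow> t \<in> {0..1} \<Longrightarrow> offset (- \<sigma> * s) t \<in> outside \<Gamma>"
    by (rule offset_sides) blast
  obtain M where M: "\<And>t. t \<in> {0..1} \<Longrightarrow> norm (c1 t) \<le> M"
    by (rule c1_bounds) blast
  have Mp: "M > 0" using M[of 0] nz[of 0] by (auto intro: less_le_trans[of _ "norm (c1 0)"])
  \<comment> \<open>The second entry keeps the offset curve, at distance at most s M from a curve in
    the disc of radius r1, inside the disc of radius R.\<close>
  define \<epsilon> where "\<epsilon> = min \<epsilon>0 ((R - r1) / M)"
  have \<epsilon>: "\<epsilon> > 0" using \<epsilon>0 r1 Mp by (simp add: \<epsilon>_def)
  have offV: "offset (- \<sigma> * s) t \<in> V" if "0 < s" "s < \<epsilon>" "t \<in> {0..1}" for s t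
  proof -
    have "norm (offset (- \<sigma> * s) t - c t) = s * norm (c1 t)"
      using \<sigma> that by (auto simp: offset_def norm_mult)
    also have "\<dots> \<le> s * M" using M that by (intro mult_left_mono) auto
    also have "\<dots> < R - r1" using that Mp by (simp add: \<epsilon>_def field_simps)
    finally have "norm (offset (- \<sigma> * s) t - c t) < R - r1" .
    moreover have "norm (c t) < r1"
    proof -
      have "c t \<in> closure (inside \<Gamma>)" using c_in_\<Gamma> unfolding closure_inside by blast
      then show ?thesis using r1(3) by auto
    qed
    ultimately have "norm (offset (- \<sigma> * s) t) < R"
      using norm_triangle_ineq[of "offset (- \<sigma> * s) t - c t" "c t"] by simp
    then show ?thesis using out[of s t] that by (simp add: V_eq \<epsilon>_def)
  qed
  have sc: "continuous_on S (\<lambda>s. offset (- \<sigma> * s) t)" for S t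
    unfolding offset_def by (intro continuous_intros)
  have offcl: "offset (- \<sigma> * s) t \<in> closure V" if "s \<in> {0..<\<epsilon>}" "t \<in> {0..1}" for s t
  proof (cases "s = 0")
    case True
    have "offset (- \<sigma> * 0) t \<in> closure V"
      by (rule limit_at_0_closure[OF sc \<epsilon>]) (use offV that in auto)
    then show ?thesis using True by simp
  next
    case False
    then show ?thesis using offV[of s t] that closure_subset by fastforce
  qed
  define W where "W s = integral {0..1} (\<lambda>t. offset1 s t / (offset s t - z0))" for s
  have oz: "offset (- \<sigma> * s) t \<noteq> z0" if "s \<in> {0..<\<epsilon>}" "t \<in> {0..1}" for s t
  proof (cases "s = 0")
    case True
    then show ?thesis using sides(2)[OF z0] c_in_\<Gamma>[of t] offset_0(1)[of t] by (metis mult_zero_right)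
  next
    case False
    then show ?thesis using offV[of s t] that z0V by force
  qed
  have W: "continuous_on {0..<\<epsilon>} (\<lambda>s. W (- \<sigma> * s))"
  proof -
    have s: "continuous_on ({0..<\<epsilon>} \<times> cbox 0 1) (\<lambda>x. (- \<sigma> * fst x, snd x))" by (intro continuous_intros)
    have "continuous_on ({0..<\<epsilon>} \<times> cbox 0 1) (\<lambda>(s, t). offset1 (- \<sigma> * s) t / (offset (- \<sigma> * s) t - z0))"
      using continuous_on_compose2[OF cont_offset(1)[of UNIV] s] continuous_on_compose2[OF cont_offset(2)[of UNIV] s] oz
      unfolding split_beta by (intro continuous_intros) auto
    from integral_continuous_on_param[OF this] show ?thesis by (simp add: W_def)
  qed
  have "of_real (line_integral A B (- \<sigma> * s)) - of_real C * W (- \<sigma> * s) / (2 * of_real pi * \<i>) = 0" if "0 < s" "s < \<epsilon>" for s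
    using C[of "offset (- \<sigma> * s)" "offset1 (- \<sigma> * s)"] offset_deriv cont_offset_t offV[OF that] offset_1
    by (simp add: line_integral_def W_def)
  moreover have "continuous_on {0..<\<epsilon>} (\<lambda>s. of_real (line_integral A B (- \<sigma> * s)) - of_real C * W (- \<sigma> * s) / (2 * of_real pi * \<i>))"
  proof -
    have "continuous_on {0..<\<epsilon>} (\<lambda>s. line_integral A B (- \<sigma> * s))"
      by (rule line_integral_continuous[OF cont offcl])
    moreover have "2 * of_real pi * \<i> \<noteq> 0" by simp
    ultimately show ?thesis by (intro continuous_intros W ballI)
  qed
  ultimately have "of_real (line_integral A B (- \<sigma> * 0)) - of_real C * W (- \<sigma> * 0) / (2 * of_real pi * \<i>) = 0"
    by (intro limit_at_0_const[OF _ \<epsilon>, of "\<lambda>s. of_real (line_integral A B (- \<sigma> * s)) - of_real C * W (- \<sigma> * s) / (2 * of_real pi * \<i>)"])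
  moreover have "line_integral A B (- \<sigma> * 0) = 0" using zero by (simp add: line_integral_def offset_0)
  ultimately have CW: "of_real C * W 0 = 0" by simp
  \<comment> \<open>About an inside point the winding number of a Jordan curve has modulus 1, for
    either orientation.\<close>
  have "W 0 \<noteq> 0"
  proof -
    have "c C1_differentiable_on {0..1}"
      unfolding C1_differentiable_on_def
    proof (intro exI[of _ c1] conjI ballI deriv)
      show "continuous_on {0..1} c1" using cont_offset_t[of "{0..1}" 0] by (simp add: offset1_def [abs_def])
    qed
    then have vp: "valid_path c" unfolding valid_path_def by (rule C1_differentiable_imp_piecewise)
    have nz0: "z0 \<notin> path_image c" using sides(2)[OF z0] simple_path_c(3) by simp
    have vd: "vector_derivative c (at t) = c1 t" for t using deriv by (rule vector_derivative_at)
    have "contour_integral c (\<lambda>w. 1 / (w - z0)) = W 0"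
      unfolding contour_integral_integral W_def offset_0 by (simp add: vd)
    then have "winding_number c z0 = 1 / (2 * pi * \<i>) * W 0"
      using winding_number_valid_path[OF vp nz0] by simp
    moreover have "norm (winding_number c z0) = 1"
      using simple_closed_path_norm_winding_number_inside[OF simple_path_c(1)] z0 simple_path_c(3) by simp
    ultimately show ?thesis by auto
  qed
  then have C0: "C = 0" using CW by simp
  define e where "e t = exp (2 * of_real pi * \<i> * of_real t)" for t
  have ne1: "norm (e t) = 1" for t by (simp add: e_def)
  define g where "g r t = of_real r * e t" for r t
  define g' where "g' r t = of_real r * (2 * of_real pi * \<i>) * e t" for r t
  have gd: "(g r has_vector_derivative g' r t) (at t within T)" for r t T
  proof -
    have "((\<lambda>z. of_real r * exp (2 * of_real pi * \<i> * z)) has_field_derivative g' r t) (at (of_real t))"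
      unfolding g'_def e_def by (auto intro!: derivative_eq_intros)
    from has_vector_derivative_real_field[OF this] show ?thesis
      unfolding g_def [abs_def] e_def by (rule has_vector_derivative_at_within)
  qed
  define J where "J r = integral {0..1} (\<lambda>t. A (g r t) * Re (g' r t) + B (g r t) * Im (g' r t))" for r
  have gV: "g r t \<in> V" if "r1 < r" "r < R" for r t
    using circle_in_V[OF r1(3), of "g r t"] that r1 by (simp add: g_def norm_mult ne1)
  have J0: "J (R - s) = 0" if "0 < s" "s < R - r1" for s
  proof -
    have "continuous_on {0..1} (g' (R - s))" unfolding g'_def e_def by (intro continuous_intros)
    moreover have "g (R - s) 1 = g (R - s) 0" by (simp add: g_def e_def)
    ultimately have "complex_of_real (J (R - s)) = 0"
      using C[of "g (R - s)" "g' (R - s)"] gd gV[of "R - s"] that C0 by (simp add: J_def)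
    then show ?thesis by simp
  qed
  have gcl: "g (R - s) t \<in> closure V" if "s \<in> {0..<R - r1}" for s t
  proof (cases "s = 0")
    case True
    have "g (R - 0) t \<in> closure V"
    proof (rule limit_at_0_closure[of "R - r1" "\<lambda>s. g (R - s) t"])
      show "continuous_on {0..<R - r1} (\<lambda>s. g (R - s) t)" unfolding g_def by (intro continuous_intros)
    qed (use r1 in \<open>auto intro!: gV\<close>)
    then show ?thesis using True by simp
  next
    case False
    then show ?thesis using gV[of "R - s" t] that closure_subset by fastforce
  qed
  have "continuous_on {0..<R - r1} (\<lambda>s. J (R - s))"
  proof -
    have o: "continuous_on ({0..<R - r1} \<times> cbox 0 1) (\<lambda>x. g (R - fst x) (snd x))"
      "continuous_on ({0..<R - r1} \<times> cbox 0 1) (\<lambda>x. g' (R - fst x) (snd x))"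
      unfolding g_def g'_def e_def by (intro continuous_intros)+
    have "continuous_on ({0..<R - r1} \<times> cbox 0 1) (\<lambda>(s, t). A (g (R - s) t) * Re (g' (R - s) t) + B (g (R - s) t) * Im (g' (R - s) t))"
      unfolding split_beta
      by (intro continuous_intros o continuous_on_compose2[OF cont(1) o(1)] continuous_on_compose2[OF cont(2) o(1)]) (auto intro!: gcl)
    from integral_continuous_on_param[OF this] show ?thesis by (simp add: J_def)
  qed
  from limit_at_0_const[OF this _ J0] have JR: "J R = 0" using r1 by simp
  define F where "F \<theta> = B (of_real R * cis \<theta>) * (R * cos \<theta>) - A (of_real R * cis \<theta>) * (R * sin \<theta>)" for \<theta>
  have Fc: "continuous_on {0..2*pi} F"
  proof -
    have i: "(\<lambda>\<theta>. of_real R * cis \<theta>) ` {0..2*pi} \<subseteq> closure V"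
    proof
      fix x assume "x \<in> (\<lambda>\<theta>. of_real R * cis \<theta>) ` {0..2*pi}"
      then obtain \<theta> where "x = of_real R * cis \<theta>" by blast
      then have "x = g (R - 0) (\<theta> / (2 * pi))" by (simp add: g_def e_def cis_conv_exp mult_ac)
      then show "x \<in> closure V" using gcl[of 0] r1 by simp
    qed
    have o: "continuous_on {0..2*pi} (\<lambda>\<theta>. of_real R * cis \<theta>)" by (intro continuous_intros continuous_on_cis)
    show ?thesis unfolding F_def
      by (intro continuous_intros continuous_on_compose2[OF cont(1) o i] continuous_on_compose2[OF cont(2) o i])
  qed
  have "(F has_integral integral {0..2*pi} F) {0..2*pi}" using Fc by (intro integrable_integral integrable_continuous_real)
  \<comment> \<open>Relates the parameter t in [0, 1] of the loop integrals to the angle 2 pi t of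
    the claim.\<close>
  from has_integral_stretch_real[OF this, of "2*pi"]
  have "((\<lambda>t. F (2 * pi * t)) has_integral (1 / (2 * pi)) * integral {0..2*pi} F) ((\<lambda>x. x / (2 * pi)) ` {0..2*pi})" by simp
  moreover have "(\<lambda>x. x / (2 * pi)) ` {0..2*pi} = {0..1}" by (simp add: image_divide_atLeastAtMost)
  ultimately have "((\<lambda>t. 2 * pi * F (2 * pi * t)) has_integral 2 * pi * ((1 / (2 * pi)) * integral {0..2*pi} F)) {0..1}"
    by (intro has_integral_mult_right) simp
  moreover have "2 * pi * F (2 * pi * t) = A (g R t) * Re (g' R t) + B (g R t) * Im (g' R t)" for t
  proof -
    have "e t = cis (2 * pi * t)" by (simp add: e_def cis_conv_exp mult_ac)
    then show ?thesis by (simp add: F_def g_def g'_def algebra_simps)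
  qed
  ultimately have "J R = integral {0..2*pi} F" by (simp add: J_def integral_unique)
  then show ?thesis using JR unfolding F_def [abs_def] by simp
qed

end

section \<open>Energy fluxes of the acoustic and elastic fields\<close>

definition vc :: "real^2 \<Rightarrow> complex" where "vc x = Complex (x$1) (x$2)"
definition cv :: "complex \<Rightarrow> real^2" where "cv z = vector [Re z, Im z]"

lemma vc_sel [simp]: "Re (vc x) = x$1" "Im (vc x) = x$2" by (simp_all add: vc_def)
lemma cv_nth [simp]: "cv z $ 1 = Re z" "cv z $ 2 = Im z" by (simp_all add: cv_def)
lemma vc_cv [simp]: "vc (cv z) = z" by (simp add: complex_eq_iff)
lemma cv_vc [simp]: "cv (vc x) = x" by (simp add: vec_eq_iff forall_2)

lemma linear_vc: "linear vc" by (rule linearI) (simp_all add: complex_eq_iff)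
lemma linear_cv: "linear cv" by (rule linearI) (simp_all add: vec_eq_iff forall_2)
lemma bounded_linear_vc: "bounded_linear vc" using linear_vc linear_conv_bounded_linear by blast
lemma bounded_linear_cv: "bounded_linear cv" using linear_cv linear_conv_bounded_linear by blast
lemma inj_vc: "inj vc" by (metis injI cv_vc)
lemma bij_vc: "bij vc" by (metis bijI inj_vc surjI vc_cv)
lemma norm_vc [simp]: "norm (vc x) = norm x" by (simp add: norm_vec2 cmod_def)

lemma cv_image_vc_image [simp]: "cv ` vc ` S = S" by (simp add: image_image)
lemma cv_in_iff: "z \<in> vc ` S \<longleftrightarrow> cv z \<in> S" by (metis cv_vc image_iff vc_cv)

lemma vc_closure: "vc ` closure S = closure (vc ` S)"
  by (rule closure_injective_linear_image[OF linear_vc inj_vc])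

lemma vc_frontier: "vc ` frontier S = frontier (vc ` S)"
  unfolding frontier_def vc_closure[symmetric] interior_bijective_linear_image[OF linear_vc bij_vc]
  by (rule image_set_diff[OF inj_vc])

lemma vc_ball: "vc ` ball 0 R = ball 0 R"
proof -
  have "z \<in> vc ` ball 0 R \<longleftrightarrow> z \<in> ball 0 R" for z
    unfolding cv_in_iff using norm_vc[of "cv z"] by simp
  then show ?thesis by blast
qed

text \<open>\<open>inside\<close> is determined by the boundedness of complementary components,
  which a linear isomorphism and its inverse preserve.\<close>

lemma inside_linear_image_subset:
  fixes f :: "'a::euclidean_space \<Rightarrow> 'b::euclidean_space"
  assumes f: "linear f" and g: "linear g" and fg: "\<And>x. f (g x) = x" and gf: "\<And>x. g (f x) = x"
  shows "f ` inside S \<subseteq> inside (f ` S)"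
proof
  fix y assume "y \<in> f ` inside S"
  then obtain x where x: "x \<in> inside S" "y = f x" by blast
  then have xS: "x \<notin> S" "bounded (connected_component_set (- S) x)" by (auto simp: inside_def)
  have yS: "y \<notin> f ` S" using xS x by (metis gf image_iff)
  let ?C = "connected_component_set (- (f ` S)) y"
  have "g ` ?C \<subseteq> connected_component_set (- S) x"
  proof (rule connected_component_maximal)
    have "y \<in> ?C" using yS by (simp add: connected_component_refl)
    then have "g y \<in> g ` ?C" by (rule imageI)
    then show "x \<in> g ` ?C" using x gf by simp
    show "connected (g ` ?C)" by (intro connected_linear_image g connected_connected_component)
    show "g ` ?C \<subseteq> - S"
    proof
      fix v assume "v \<in> g ` ?C"
      then obtain w where w: "w \<in> ?C" "v = g w" by blast
      then have "w \<notin> f ` S" using connected_component_subset[of "- (f ` S)" y] by blast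
      then show "v \<in> - S" using w fg[of w] by (metis ComplI imageI)
    qed
  qed
  then have "bounded (g ` ?C)" using xS(2) bounded_subset by blast
  then have "bounded (f ` g ` ?C)" using f by (rule bounded_linear_image[OF _ linear_conv_bounded_linear[THEN iffD1]])
  then have "bounded ?C" by (simp add: image_image fg)
  then show "y \<in> inside (f ` S)" using yS by (simp add: inside_def)
qed

lemma vc_inside: "vc ` inside S = inside (vc ` S)"
proof
  show "vc ` inside S \<subseteq> inside (vc ` S)"
    by (rule inside_linear_image_subset[OF linear_vc linear_cv]) auto
  have "cv ` inside (vc ` S) \<subseteq> inside (cv ` vc ` S)"
    by (rule inside_linear_image_subset[OF linear_cv linear_vc]) auto
  then have "vc ` cv ` inside (vc ` S) \<subseteq> vc ` inside S" by auto
  then show "inside (vc ` S) \<subseteq> vc ` inside S" by (simp add: image_image)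
qed

text \<open>Total differentiability together with the values of both partial derivatives. The
  calculus rules compose on this predicate, whereas an equation about \<open>pd\<close> carries no
  differentiability.\<close>

definition has_pds :: "(real^2 \<Rightarrow> complex) \<Rightarrow> real^2 \<Rightarrow> complex \<Rightarrow> complex \<Rightarrow> bool" where
  "has_pds f x a b \<longleftrightarrow> (f has_derivative (\<lambda>h. a * of_real (h$1) + b * of_real (h$2))) (at x)"

lemma has_pds_pd: "open S \<Longrightarrow> C1_on S f \<Longrightarrow> x \<in> S \<Longrightarrow> has_pds f x (pd 1 f x) (pd 2 f x)"
  unfolding has_pds_def by (rule C1_on_has_derivative)

lemma has_pds_unique: "has_pds f x a b \<Longrightarrow> pd 1 f x = a" "has_pds f x a b \<Longrightarrow> pd 2 f x = b"
  unfolding has_pds_def by (auto dest: pd_unique)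

lemma has_pds_add:
  assumes "has_pds f x a b" "has_pds g x a' b'"
  shows "has_pds (\<lambda>x. f x + g x) x (a + a') (b + b')"
  unfolding has_pds_def
  by (rule has_derivative_eq_rhs[OF has_derivative_add[OF assms[unfolded has_pds_def]]]) (auto simp: algebra_simps)

lemma has_pds_diff:
  assumes "has_pds f x a b" "has_pds g x a' b'"
  shows "has_pds (\<lambda>x. f x - g x) x (a - a') (b - b')"
  unfolding has_pds_def
  by (rule has_derivative_eq_rhs[OF has_derivative_diff[OF assms[unfolded has_pds_def]]]) (auto simp: algebra_simps)

lemma has_pds_cmult:
  assumes "has_pds f x a b"
  shows "has_pds (\<lambda>x. k * f x) x (k * a) (k * b)"
  unfolding has_pds_def
  by (rule has_derivative_eq_rhs[OF has_derivative_mult_right[OF assms[unfolded has_pds_def]]]) (auto simp: algebra_simps)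

lemma has_pds_mult:
  assumes "has_pds f x a b" "has_pds g x a' b'"
  shows "has_pds (\<lambda>x. f x * g x) x (a * g x + f x * a') (b * g x + f x * b')"
  unfolding has_pds_def
  by (rule has_derivative_eq_rhs[OF has_derivative_mult[OF assms[unfolded has_pds_def]]]) (auto simp: algebra_simps)

lemma has_pds_cnj:
  assumes "has_pds f x a b"
  shows "has_pds (\<lambda>x. cnj (f x)) x (cnj a) (cnj b)"
  unfolding has_pds_def
  by (rule has_derivative_eq_rhs[OF bounded_linear.has_derivative[OF bounded_linear_cnj assms[unfolded has_pds_def]]]) auto

lemma has_pds_transform:
  "has_pds f x a b \<Longrightarrow> open S \<Longrightarrow> x \<in> S \<Longrightarrow> (\<And>y. y \<in> S \<Longrightarrow> f y = g y) \<Longrightarrow> has_pds g x a b"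
  unfolding has_pds_def by (rule has_derivative_transform_within_open)

lemma pd_cong_open:
  assumes "open S" "x \<in> S" "\<And>y. y \<in> S \<Longrightarrow> f y = g y"
  shows "pd i f x = pd i g x"
proof -
  have "(f has_derivative D) (at x) \<longleftrightarrow> (g has_derivative D) (at x)" for D
    by (rule iffI; erule has_derivative_transform_within_open[OF _ assms(1,2)]; simp add: assms(3))
  then show ?thesis by (simp add: pd_def frechet_derivative_def)
qed

lemma C1_onI:
  assumes S: "open S" and d: "\<And>x. x \<in> S \<Longrightarrow> has_pds f x (a x) (b x)" and ab: "continuous_on S a" "continuous_on S b"
  shows "C1_on S f"
proof -
  have "f differentiable_on S"
    unfolding differentiable_on_def differentiable_def
    using d has_derivative_at_withinI unfolding has_pds_def by blast
  moreover have "continuous_on S (pd i f)" for i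
  proof -
    have "continuous_on S (pd 1 f)" "continuous_on S (pd 2 f)"
      by (rule continuous_on_eq[OF ab(1)], use d has_pds_unique(1) in fastforce,
          rule continuous_on_eq[OF ab(2)], use d has_pds_unique(2) in fastforce)
    then show ?thesis using exhaust_2[of i] by auto
  qed
  ultimately show ?thesis by (simp add: C1_on_def)
qed

lemma C1_on_cong:
  assumes S: "open S" and eq: "\<And>y. y \<in> S \<Longrightarrow> f y = g y" and f: "C1_on S f"
  shows "C1_on S g"
proof (rule C1_onI[OF S])
  show "has_pds g x (pd 1 f x) (pd 2 f x)" if "x \<in> S" for x
    by (rule has_pds_transform[OF has_pds_pd[OF S f that] S that eq])
qed (use f in \<open>auto simp: C1_on_def\<close>)

lemma pd_diff:
  assumes "open S" "C1_on S f" "C1_on S g" "x \<in> S"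
  shows "pd i (\<lambda>x. f x - g x) x = pd i f x - pd i g x"
  using has_pds_unique[OF has_pds_diff[OF has_pds_pd[OF assms(1,2,4)] has_pds_pd[OF assms(1,3,4)]]] exhaust_2[of i] by auto

lemma pd_add:
  assumes "open S" "C1_on S f" "C1_on S g" "x \<in> S"
  shows "pd i (\<lambda>x. f x + g x) x = pd i f x + pd i g x"
  using has_pds_unique[OF has_pds_add[OF has_pds_pd[OF assms(1,2,4)] has_pds_pd[OF assms(1,3,4)]]] exhaust_2[of i] by auto

lemma C1_on_diff:
  assumes "open S" "C1_on S f" "C1_on S g"
  shows "C1_on S (\<lambda>x. f x - g x)"
proof (rule C1_onI[OF assms(1)])
  show "has_pds (\<lambda>x. f x - g x) x (pd 1 f x - pd 1 g x) (pd 2 f x - pd 2 g x)" if "x \<in> S" for x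
    by (intro has_pds_diff has_pds_pd[OF assms(1)] assms that)
qed (use assms in \<open>auto simp: C1_on_def intro!: continuous_intros\<close>)

lemma C2_on_diff:
  assumes "open S" "C2_on S f" "C2_on S g"
  shows "C2_on S (\<lambda>x. f x - g x)"
proof -
  have C1: "C1_on S f" "C1_on S g" "\<And>i. C1_on S (pd i f)" "\<And>i. C1_on S (pd i g)"
    using assms by (auto simp: C2_on_def)
  have "C1_on S (pd i (\<lambda>x. f x - g x))" for i
    by (rule C1_on_cong[OF assms(1) _ C1_on_diff[OF assms(1) C1(3,4)]]) (simp add: pd_diff[OF assms(1) C1(1,2)])
  then show ?thesis using C1_on_diff[OF assms(1) C1(1,2)] by (simp add: C2_on_def)
qed

lemma pd_pd_diff:
  assumes "open S" "C2_on S f" "C2_on S g" "x \<in> S"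
  shows "pd j (pd i (\<lambda>x. f x - g x)) x = pd j (pd i f) x - pd j (pd i g) x"
proof -
  have C1: "C1_on S f" "C1_on S g" "\<And>i. C1_on S (pd i f)" "\<And>i. C1_on S (pd i g)"
    using assms by (auto simp: C2_on_def)
  have "pd j (pd i (\<lambda>x. f x - g x)) x = pd j (\<lambda>x. pd i f x - pd i g x) x"
    by (rule pd_cong_open[OF assms(1,4)]) (rule pd_diff[OF assms(1) C1(1,2)])
  also have "\<dots> = pd j (pd i f) x - pd j (pd i g) x"
    by (rule pd_diff[OF assms(1) C1(3,4) assms(4)])
  finally show ?thesis .
qed

lemma laplacian_diff:
  assumes "open S" "C2_on S f" "C2_on S g" "x \<in> S"
  shows "laplacian (\<lambda>x. f x - g x) x = laplacian f x - laplacian g x"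
  unfolding laplacian_def by (simp add: pd_pd_diff[OF assms] sum_subtractf)

text \<open>A single function on the closure, so that flux densities inside and on the boundary are
  given by the same formula.\<close>

definition ext_pd :: "(real^2) set \<Rightarrow> 2 \<Rightarrow> (real^2 \<Rightarrow> complex) \<Rightarrow> real^2 \<Rightarrow> complex" where
  "ext_pd S i f x = (if x \<in> S then pd i f x else bpd S i f x)"

text \<open>A point of the closure outside S is a limit point of S, so the filter is nontrivial and
  the \<open>Lim\<close> in \<open>bpd\<close> is the value of the continuous extension.\<close>

lemma bpd_tendsto:
  assumes "C1_closure S f" "x \<in> closure S" "x \<notin> S"
  obtains g where "continuous_on (closure S) g" "\<And>y. y \<in> S \<Longrightarrow> g y = pd i f y" "bpd S i f x = g x"
    "(pd i f \<longlongrightarrow> g x) (at x within S)" "at x within S \<noteq> bot"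
proof -
  obtain g where g: "continuous_on (closure S) g" "\<And>y. y \<in> S \<Longrightarrow> g y = pd i f y"
    using assms(1) unfolding C1_closure_def by blast
  have nb: "at x within S \<noteq> bot"
  proof -
    have "x islimpt S" using assms(2,3) unfolding closure_def by blast
    then show ?thesis by (simp add: trivial_limit_within)
  qed
  have "(g \<longlongrightarrow> g x) (at x within closure S)" using g(1) assms(2) by (simp add: continuous_on_def)
  then have "(g \<longlongrightarrow> g x) (at x within S)" by (rule tendsto_within_subset[OF _ closure_subset])
  moreover have "\<forall>\<^sub>F y in at x within S. g y = pd i f y"
    using g(2) by (auto simp: eventually_at_filter)
  ultimately have lim: "(pd i f \<longlongrightarrow> g x) (at x within S)" by (rule Lim_transform_eventually)
  then have b: "bpd S i f x = g x" unfolding bpd_def using nb by (intro tendsto_Lim)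
  show thesis by (rule that[OF g b lim nb])
qed

lemma continuous_on_ext_pd:
  assumes "C1_closure S f"
  shows "continuous_on (closure S) (ext_pd S i f)"
proof -
  obtain g where g: "continuous_on (closure S) g" "\<And>y. y \<in> S \<Longrightarrow> g y = pd i f y"
    using assms unfolding C1_closure_def by blast
  have "ext_pd S i f x = g x" if x: "x \<in> closure S" for x
  proof (cases "x \<in> S")
    case True
    then show ?thesis using g by (simp add: ext_pd_def)
  next
    case False
    obtain g' where g': "bpd S i f x = g' x" "(pd i f \<longlongrightarrow> g' x) (at x within S)" "at x within S \<noteq> bot"
      by (rule bpd_tendsto[OF assms x False, of i]) blast
    have "(g \<longlongrightarrow> g x) (at x within closure S)" using g(1) x by (simp add: continuous_on_def)
    then have "(g \<longlongrightarrow> g x) (at x within S)" by (rule tendsto_within_subset[OF _ closure_subset])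
    moreover have "\<forall>\<^sub>F y in at x within S. g y = pd i f y"
      using g(2) by (auto simp: eventually_at_filter)
    ultimately have "(pd i f \<longlongrightarrow> g x) (at x within S)" by (rule Lim_transform_eventually)
    then have "g x = g' x" using tendsto_unique[OF g'(3) _ g'(2)] by blast
    then show ?thesis using False g' by (simp add: ext_pd_def)
  qed
  then show ?thesis by (intro continuous_on_eq[OF g(1)]) simp
qed

lemma C1_closure_diff:
  assumes "open S" "C1_closure S f" "C1_closure S g"
  shows "C1_closure S (\<lambda>x. f x - g x)"
proof -
  have C1: "C1_on S f" "C1_on S g" using assms by (auto simp: C1_closure_def)
  have "\<exists>h. continuous_on (closure S) h \<and> (\<forall>x\<in>S. h x = pd i (\<lambda>x. f x - g x) x)" for i
  proof (intro exI[of _ "\<lambda>x. ext_pd S i f x - ext_pd S i g x"] conjI ballI)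
    show "continuous_on (closure S) (\<lambda>x. ext_pd S i f x - ext_pd S i g x)"
      by (intro continuous_intros continuous_on_ext_pd assms)
    show "ext_pd S i f x - ext_pd S i g x = pd i (\<lambda>x. f x - g x) x" if "x \<in> S" for x
      using that by (simp add: ext_pd_def pd_diff[OF assms(1) C1 that])
  qed
  moreover have "continuous_on (closure S) (\<lambda>x. f x - g x)"
    using assms by (auto simp: C1_closure_def intro!: continuous_intros)
  ultimately show ?thesis using C1_on_diff[OF assms(1) C1] by (simp add: C1_closure_def)
qed

lemma bpd_diff:
  assumes "open S" "C1_closure S f" "C1_closure S g" "x \<in> closure S" "x \<notin> S"
  shows "bpd S i (\<lambda>x. f x - g x) x = bpd S i f x - bpd S i g x"
proof -
  have C1: "C1_on S f" "C1_on S g" using assms by (auto simp: C1_closure_def)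
  obtain a where a: "bpd S i f x = a x" "(pd i f \<longlongrightarrow> a x) (at x within S)"
    by (rule bpd_tendsto[OF assms(2,4,5), of i]) blast
  obtain b where b: "bpd S i g x = b x" "(pd i g \<longlongrightarrow> b x) (at x within S)" "at x within S \<noteq> bot"
    by (rule bpd_tendsto[OF assms(3,4,5), of i]) blast
  have "((\<lambda>y. pd i f y - pd i g y) \<longlongrightarrow> a x - b x) (at x within S)" by (intro tendsto_intros a b)
  moreover have "\<forall>\<^sub>F y in at x within S. pd i f y - pd i g y = pd i (\<lambda>x. f x - g x) y"
    by (simp add: eventually_at_filter pd_diff[OF assms(1) C1])
  ultimately have "(pd i (\<lambda>x. f x - g x) \<longlongrightarrow> a x - b x) (at x within S)" by (rule Lim_transform_eventually)
  then show ?thesis unfolding a(1) b(1) unfolding bpd_def using b(3) by (intro tendsto_Lim)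
qed

text \<open>Schwarz's theorem. The increment f(X s t) - f(X 0 t) is the integral of the first
  partial derivative; differentiating it in t under the integral and then in s produces the two
  mixed derivatives.\<close>

lemma mixed_pd_eq:
  assumes S: "open S" and f: "C2_on S f" and x: "x \<in> S"
  shows "pd 1 (pd 2 f) x = pd 2 (pd 1 f) x"
proof -
  have C1: "C1_on S f" "\<And>i. C1_on S (pd i f)" using f by (auto simp: C2_on_def)
  obtain e where e: "e > 0" "ball x e \<subseteq> S" using S x open_contains_ball by blast
  define d where "d = e / 2"
  have d: "d > 0" using e by (simp add: d_def)
  define X where "X s t = x + vector [s, t]" for s t :: real
  have X0: "X 0 0 = x" by (simp add: X_def vec_eq_iff forall_2)
  have XS: "X s t \<in> S" if "\<bar>s\<bar> < d" "\<bar>t\<bar> < d" for s t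
  proof -
    have "norm (vector [s, t] :: real^2) \<le> \<bar>s\<bar> + \<bar>t\<bar>" unfolding norm_vec2 using sqrt_sum_squares_le_sum_abs by simp
    also have "\<dots> < e" using that by (simp add: d_def)
    finally show ?thesis using e by (auto simp: X_def dist_norm)
  qed
  have dX: "((\<lambda>s. X s t) has_vector_derivative axis 1 1) (at s within T)"
    "((\<lambda>t. X s t) has_vector_derivative axis 2 1) (at t within T)" for s t T
    unfolding X_def by (rule has_vector_derivative_vec2; auto intro!: derivative_eq_intros simp: axis_def)+
  have ds: "((\<lambda>s. h (X s t)) has_vector_derivative pd 1 h (X s t)) (at s within T)" if "C1_on S h" "\<bar>s\<bar> < d" "\<bar>t\<bar> < d" for h s t T
    using C1_on_chain[OF S that(1) XS[OF that(2,3)] dX(1)] by (simp add: axis_def)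
  have dt: "((\<lambda>t. h (X s t)) has_vector_derivative pd 2 h (X s t)) (at t within T)" if "C1_on S h" "\<bar>s\<bar> < d" "\<bar>t\<bar> < d" for h s t T
    using C1_on_chain[OF S that(1) _ dX(2), of s t] XS[OF that(2,3)] by (simp add: axis_def)
  have cX: "continuous_on T (\<lambda>y. h (X (a y) (b y)))"
    if "continuous_on S h" "continuous_on T a" "continuous_on T b" "\<And>y. y \<in> T \<Longrightarrow> \<bar>a y\<bar> < d \<and> \<bar>b y\<bar> < d"
    for h :: "real^2 \<Rightarrow> complex" and T :: "'c::t2_space set" and a b
    by (rule continuous_on_compose2[OF that(1)], unfold X_def, rule continuous_on_vec2)
       (use that XS in \<open>auto simp: X_def intro!: continuous_intros\<close>)
  have cont: "continuous_on S (pd i f)" "continuous_on S (pd j (pd i f))" for i j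
    using C1 by (auto simp: C1_on_def)
  have key: "integral {0..s} (\<lambda>\<sigma>. pd 2 (pd 1 f) (X \<sigma> 0)) = pd 2 f (X s 0) - pd 2 f (X 0 0)" if s: "s \<in> {0..d/2}" for s
  proof -
    let ?U = "{-d<..<d}"
    have in0: "\<bar>\<sigma>\<bar> < d" if "\<sigma> \<in> cbox 0 s" for \<sigma> using that s d by auto
    have "((\<lambda>t. integral (cbox 0 s) (\<lambda>\<sigma>. pd 1 f (X \<sigma> t))) has_vector_derivative
        integral (cbox 0 s) (\<lambda>\<sigma>. pd 2 (pd 1 f) (X \<sigma> 0))) (at 0 within ?U)"
    proof (rule leibniz_rule_vector_derivative)
      show "((\<lambda>t. pd 1 f (X \<sigma> t)) has_vector_derivative pd 2 (pd 1 f) (X \<sigma> t)) (at t within ?U)" if "t \<in> ?U" "\<sigma> \<in> cbox 0 s" for t \<sigma>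
        using that in0 by (intro dt C1) auto
      show "(\<lambda>\<sigma>. pd 1 f (X \<sigma> t)) integrable_on cbox 0 s" if "t \<in> ?U" for t
        by (intro integrable_continuous cX cont continuous_intros) (use that in0 in auto)
      show "continuous_on (?U \<times> cbox 0 s) (\<lambda>(t, \<sigma>). pd 2 (pd 1 f) (X \<sigma> t))"
        unfolding split_beta by (intro cX cont continuous_intros) (use in0 in auto)
    qed (use d in auto)
    moreover have "integral (cbox 0 s) (\<lambda>\<sigma>. pd 1 f (X \<sigma> t)) = f (X s t) - f (X 0 t)" if "t \<in> ?U" for t
    proof -
      have "((\<lambda>\<sigma>. pd 1 f (X \<sigma> t)) has_integral f (X s t) - f (X 0 t)) {0..s}"
        by (rule fundamental_theorem_of_calculus) (use s that in0 in \<open>auto intro!: ds C1\<close>)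
      then show ?thesis by (simp add: integral_unique)
    qed
    ultimately have "((\<lambda>t. f (X s t) - f (X 0 t)) has_vector_derivative integral (cbox 0 s) (\<lambda>\<sigma>. pd 2 (pd 1 f) (X \<sigma> 0))) (at 0 within ?U)"
      using has_vector_derivative_transform[of 0 ?U "\<lambda>t. f (X s t) - f (X 0 t)" "\<lambda>t. integral (cbox 0 s) (\<lambda>\<sigma>. pd 1 f (X \<sigma> t))"] d by simp
    moreover have "((\<lambda>t. f (X s t) - f (X 0 t)) has_vector_derivative pd 2 f (X s 0) - pd 2 f (X 0 0)) (at 0 within ?U)"
      by (intro has_vector_derivative_diff dt C1) (use s d in auto)
    moreover have "at 0 within ?U \<noteq> bot" using d by (simp add: at_within_open[of 0 ?U])
    ultimately have "integral (cbox 0 s) (\<lambda>\<sigma>. pd 2 (pd 1 f) (X \<sigma> 0)) = pd 2 f (X s 0) - pd 2 f (X 0 0)"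
      using vector_derivative_unique_within by blast
    then show ?thesis by simp
  qed
  have "continuous_on {0..d/2} (\<lambda>\<sigma>. pd 2 (pd 1 f) (X \<sigma> 0))"
    by (intro cX cont continuous_intros) (use d in auto)
  from integral_has_vector_derivative[OF this, of 0]
  have "((\<lambda>s. integral {0..s} (\<lambda>\<sigma>. pd 2 (pd 1 f) (X \<sigma> 0))) has_vector_derivative pd 2 (pd 1 f) (X 0 0)) (at 0 within {0..d/2})"
    using d by simp
  then have "((\<lambda>s. pd 2 f (X s 0) - pd 2 f (X 0 0)) has_vector_derivative pd 2 (pd 1 f) (X 0 0)) (at 0 within {0..d/2})"
    using has_vector_derivative_transform[of 0 "{0..d/2}" "\<lambda>s. pd 2 f (X s 0) - pd 2 f (X 0 0)" "\<lambda>s. integral {0..s} (\<lambda>\<sigma>. pd 2 (pd 1 f) (X \<sigma> 0))"]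
      key d by simp
  moreover have "((\<lambda>s. pd 2 f (X s 0) - pd 2 f (X 0 0)) has_vector_derivative pd 1 (pd 2 f) (X 0 0) - 0) (at 0 within {0..d/2})"
    by (intro has_vector_derivative_diff ds C1 has_vector_derivative_const) (use d in auto)
  moreover have "at 0 within {0..d/2} \<noteq> bot"
    using d at_within_Icc_at_right[of 0 "d/2"] by simp
  ultimately have "pd 2 (pd 1 f) (X 0 0) = pd 1 (pd 2 f) (X 0 0) - 0"
    using vector_derivative_unique_within by blast
  then show ?thesis by (simp add: X0)
qed

text \<open>The line integral of F1 dy - F2 dx along a curve is the flux of the field through it,
  and this form is closed exactly when the divergence vanishes; here this is applied to the
  imaginary parts.\<close>

lemma flux_closed_form:
  assumes S: "open S"
    and d: "\<And>x. x \<in> S \<Longrightarrow> has_pds F1 x (F11 x) (F12 x)" "\<And>x. x \<in> S \<Longrightarrow> has_pds F2 x (F21 x) (F22 x)"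
    and c: "continuous_on S F12" "continuous_on S F21" "continuous_on S F22"
    and div: "\<And>x. x \<in> S \<Longrightarrow> Im (F11 x + F22 x) = 0"
  shows "closed_form (vc ` S) (\<lambda>z. - Im (F2 (cv z))) (\<lambda>z. Im (F1 (cv z)))"
proof -
  have cc: "continuous_on (vc ` S) (\<lambda>z. F (cv z))" if "continuous_on S F" for F :: "real^2 \<Rightarrow> complex"
    by (rule continuous_on_compose2[OF that linear_continuous_on[OF bounded_linear_cv]]) auto
  have dcv: "(cv has_derivative cv) (at z)" for z
    using bounded_linear.has_derivative[OF bounded_linear_cv has_derivative_ident] by simp
  have dIm: "((\<lambda>z. Im (F (cv z))) has_derivative (\<lambda>h. Im a * Re h + Im b * Im h)) (at z)"
    if "has_pds F (cv z) a b" for F a b z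
    using bounded_linear.has_derivative[OF bounded_linear_Im has_derivative_compose[OF dcv that[unfolded has_pds_def]]]
    by (rule has_derivative_eq_rhs) auto
  show ?thesis
    unfolding closed_form_def
  proof (rule exI[of _ "\<lambda>z. - Im (F21 (cv z))"], rule exI[of _ "\<lambda>z. - Im (F22 (cv z))"],
      rule exI[of _ "\<lambda>z. Im (F12 (cv z))"], intro conjI ballI)
    fix z assume "z \<in> vc ` S"
    then have z: "cv z \<in> S" by (simp add: cv_in_iff)
    show "((\<lambda>z. - Im (F2 (cv z))) has_derivative (\<lambda>h. - Im (F21 (cv z)) * Re h + - Im (F22 (cv z)) * Im h)) (at z)"
      by (rule has_derivative_eq_rhs[OF has_derivative_minus[OF dIm[OF d(2)[OF z]]]]) auto
    show "((\<lambda>z. Im (F1 (cv z))) has_derivative (\<lambda>h. - Im (F22 (cv z)) * Re h + Im (F12 (cv z)) * Im h)) (at z)"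
    proof -
      have "Im (F11 (cv z)) = - Im (F22 (cv z))" using div[OF z] by (simp add: eq_neg_iff_add_eq_0)
      then show ?thesis using dIm[OF d(1)[OF z]] by simp
    qed
  qed (intro continuous_intros cc c)+
qed

section \<open>Radiating fields and energy identities\<close>

lemma dtn_term_eq:
  assumes "continuous_on UNIV (\<lambda>\<theta>. \<phi> (polar_pt R \<theta>))"
  shows "dtn_term k R \<phi> n \<theta> = of_real k * dtn_symbol n (k * R) * fourier_coeff (\<lambda>\<theta>. \<phi> (polar_pt R \<theta>)) n
            / of_real (2 * pi) * cis (of_int n * \<theta>)"
proof -
  have "integral {0..2*pi} (\<lambda>\<psi>. \<phi> (polar_pt R \<psi>) * cis (of_int n * (\<theta> - \<psi>)))
      = integral {0..2*pi} (\<lambda>\<psi>. cis (of_int n * \<theta>) * (\<phi> (polar_pt R \<psi>) * cis (- (of_int n * \<psi>))))"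
    by (intro integral_cong) (simp add: mult.left_commute[of "cis _"] cis_mult right_diff_distrib)
  also have "\<dots> = cis (of_int n * \<theta>) * fourier_coeff (\<lambda>\<theta>. \<phi> (polar_pt R \<theta>)) n"
    by (simp add: fourier_coeff_def)
  finally show ?thesis unfolding dtn_term_def dtn_symbol_def by (simp add: mult_ac)
qed

text \<open>The Helmholtz equation holds inside only, while the DtN condition sits on the circle,
  where p is merely C^1 from within. Modes and their derivatives are therefore formed with
  \<open>ext_pd\<close>, which makes them continuous up to s = ln R, where they supply the data for
  the differential equations.\<close>

lemma dtn_radiating_vanish:
  assumes V: "open V" "connected V" and reg: "C2_on V p" "C1_closure V p"
    and helmholtz: "\<And>x. x \<in> V \<Longrightarrow> laplacian p x + of_real (k^2) * p x = 0"
    and r1: "0 < r1" "r1 < R" and annulus: "\<And>x. r1 < norm x \<Longrightarrow> norm x < R \<Longrightarrow> x \<in> V"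
    and k: "k > 0"
    and lim: "\<And>\<theta>. (\<lambda>N. \<Sum>n\<in>{-int N..int N}. dtn_term k R p n \<theta>) \<longlonglongrightarrow>
        ext_pd V 1 p (polar_pt R \<theta>) * of_real (cos \<theta>) + ext_pd V 2 p (polar_pt R \<theta>) * of_real (sin \<theta>)"
    and flux: "integral {0..2*pi} (\<lambda>\<theta>. Im (cnj (p (polar_pt R \<theta>)) *
        (ext_pd V 1 p (polar_pt R \<theta>) * of_real (cos \<theta>) + ext_pd V 2 p (polar_pt R \<theta>) * of_real (sin \<theta>)))) = 0"
    and x: "x \<in> V"
  shows "p x = 0"
proof -
  have R: "R > 0" using r1 by simp
  define \<alpha> \<beta> where "\<alpha> = ln r1" and "\<beta> = ln R"
  have ab: "\<alpha> < \<beta>" using r1 by (simp add: \<alpha>_def \<beta>_def)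
  have e\<beta>: "exp \<beta> = R" using R by (simp add: \<beta>_def)
  have in_V: "polar_pt (exp s) \<theta> \<in> V" if "\<alpha> < s" "s < \<beta>" for s \<theta>
  proof -
    have "r1 < exp s" "exp s < R"
      using that r1 exp_less_mono[of \<alpha> s] exp_less_mono[of s \<beta>] by (auto simp: \<alpha>_def \<beta>_def)
    then show ?thesis by (intro annulus) auto
  qed
  interpret helmholtz_annulus V p 0 k \<alpha> \<beta>
    by unfold_locales (use V reg helmholtz in_V in auto)
  have in_cl: "polar_pt (exp s) \<theta> \<in> closure V" if "s \<in> {\<alpha><..\<beta>}" for s \<theta>
  proof (cases "s = \<beta>")
    case True
    have "polar_pt (exp (\<beta> - 0)) \<theta> \<in> closure V"
    proof (rule limit_at_0_closure[of "\<beta> - \<alpha>" "\<lambda>\<tau>. polar_pt (exp (\<beta> - \<tau>)) \<theta>"])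
      show "continuous_on {0..<\<beta> - \<alpha>} (\<lambda>\<tau>. polar_pt (exp (\<beta> - \<tau>)) \<theta>)" by (intro continuous_intros)
    qed (use ab in \<open>auto intro!: in_V\<close>)
    then show ?thesis using True by simp
  next
    case False
    then show ?thesis using in_V[of s \<theta>] that closure_subset by fastforce
  qed
  define e where "e i = ext_pd V i p" for i
  have ec: "continuous_on (closure V) (e i)" for i unfolding e_def by (rule continuous_on_ext_pd[OF reg(2)])
  have pc: "continuous_on (closure V) p" using reg(2) by (simp add: C1_closure_def)
  have comp: "continuous_on ({\<alpha><..\<beta>} \<times> UNIV) (\<lambda>x. f (polar_pt (exp (fst x)) (snd x)))" if "continuous_on (closure V) f" for f :: "real^2 \<Rightarrow> complex"
    by (rule continuous_on_compose2[OF that]) (auto intro!: continuous_intros in_cl)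
  have comp\<theta>: "continuous_on UNIV (\<lambda>\<theta>. f (polar_pt R \<theta>))" if "continuous_on (closure V) f" for f :: "real^2 \<Rightarrow> complex"
    by (rule continuous_on_compose2[OF that]) (use in_cl[of \<beta>] ab e\<beta> in \<open>auto intro!: continuous_intros\<close>)
  define rad where "rad s \<theta> = e 1 (polar_pt (exp s) \<theta>) * of_real (exp s * cos \<theta>) + e 2 (polar_pt (exp s) \<theta>) * of_real (exp s * sin \<theta>)" for s \<theta>
  define ang where "ang s \<theta> = e 2 (polar_pt (exp s) \<theta>) * of_real (exp s * cos \<theta>) - e 1 (polar_pt (exp s) \<theta>) * of_real (exp s * sin \<theta>)" for s \<theta>
  define db where "db n s = fourier_coeff (rad s) n" for n s
  have m_eq: "mode n = (\<lambda>s. fourier_coeff (\<lambda>\<theta>. p (polar_pt (exp s) \<theta>)) n)" for n by (simp add: mode_def [abs_def])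
  have cm: "continuous_on {\<alpha><..\<beta>} (mode n)" for n
    unfolding m_eq by (rule continuous_on_fourier_coeff_param) (use comp[OF pc] in \<open>simp add: split_beta\<close>)
  have cdb: "continuous_on {\<alpha><..\<beta>} (db n)" for n
    unfolding db_def [abs_def]
    by (rule continuous_on_fourier_coeff_param) (unfold rad_def split_beta, intro continuous_intros comp ec)
  have cang: "continuous_on {\<alpha><..\<beta>} (\<lambda>s. fourier_coeff (ang s) n)" for n
    by (rule continuous_on_fourier_coeff_param) (unfold ang_def split_beta, intro continuous_intros comp ec)
  have e_in: "e i (polar_pt (exp s) \<theta>) = pd i p (polar_pt (exp s) \<theta>)" if "\<alpha> < s" "s < \<beta>" for i s \<theta>
    using in_V[OF that] by (simp add: e_def ext_pd_def)
  have db_eq: "db n s = dmode n s" if "\<alpha> < s" "s < \<beta>" for n s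
    unfolding db_def dmode_def rad_def [abs_def] radial_pd_def [abs_def] by (simp add: e_in[OF that])
  have ang_eq: "fourier_coeff (ang s) n = \<i> * of_int n * mode n s" if s: "\<alpha> < s" "s < \<beta>" for n s
  proof -
    have sI: "s \<in> {\<alpha><..<\<beta>}" using s by simp
    have "ang s = angular_pd p 0 s"
      by (rule ext) (simp add: ang_def angular_pd_def e_in[OF s])
    moreover have "continuous_on UNIV (angular_pd p 0 s)"
      unfolding angular_pd_def [abs_def] by (intro continuous_intros cont_comp_angle contS sI)
    ultimately show ?thesis
      using fourier_coeff_deriv[OF angular_deriv[OF C1(1) sI], of n] by (simp add: polar_pt_2pi m_eq)
  qed
  \<comment> \<open>On the circle itself the entries of \<open>ang\<close> are boundary limits and
    not derivatives of p, so the relation between the Fourier coefficients is taken over from the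
    inner circles by continuity.\<close>
  have ang_\<beta>: "fourier_coeff (ang \<beta>) n = \<i> * of_int n * mode n \<beta>" for n
  proof -
    have "(\<lambda>\<tau>. fourier_coeff (ang (\<beta> - \<tau>)) n - \<i> * of_int n * mode n (\<beta> - \<tau>)) 0 = 0"
    proof (rule limit_at_0_const[where \<epsilon> = "\<beta> - \<alpha>"])
      have r: "continuous_on {0..<\<beta> - \<alpha>} (\<lambda>\<tau>. \<beta> - \<tau>)" by (intro continuous_intros)
      have i: "(\<lambda>\<tau>. \<beta> - \<tau>) ` {0..<\<beta> - \<alpha>} \<subseteq> {\<alpha><..\<beta>}" by auto
      show "continuous_on {0..<\<beta> - \<alpha>} (\<lambda>\<tau>. fourier_coeff (ang (\<beta> - \<tau>)) n - \<i> * of_int n * mode n (\<beta> - \<tau>))"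
        by (intro continuous_intros continuous_on_compose2[OF cang r i] continuous_on_compose2[OF cm r i])
    qed (use ab ang_eq in auto)
    then show ?thesis by simp
  qed
  define P where "P \<theta> = p (polar_pt R \<theta>)" for \<theta>
  define g where "g \<theta> = e 1 (polar_pt R \<theta>) * of_real (cos \<theta>) + e 2 (polar_pt R \<theta>) * of_real (sin \<theta>)" for \<theta>
  have cP: "continuous_on UNIV P" unfolding P_def by (rule comp\<theta>[OF pc])
  have cg: "continuous_on UNIV g" unfolding g_def by (intro continuous_intros comp\<theta> ec)
  have cQ: "continuous_on UNIV (ang \<beta>)" unfolding ang_def [abs_def] e\<beta> by (intro continuous_intros comp\<theta> ec)
  have mP: "mode n \<beta> = fourier_coeff P n" for n by (simp add: m_eq e\<beta> P_def [abs_def])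
  have kR: "k * R > 0" using k R by simp
  obtain C where C: "C \<ge> 0" "\<And>n. norm (dtn_symbol n (k * R)) \<le> C * (1 + \<bar>real_of_int n\<bar>)"
    using dtn_symbol_linear_bound[OF kR] by blast
  have terms: "dtn_term k R p n \<theta> = of_real k * dtn_symbol n (k * R) * fourier_coeff P n / of_real (2 * pi) * cis (of_int n * \<theta>)" for n \<theta>
    unfolding P_def by (rule dtn_term_eq[OF comp\<theta>[OF pc]])
  have P0: "fourier_coeff P n = 0" for n
  proof (rule dtn_coeffs_vanish[OF cP cQ cg, where d = "\<lambda>n. of_real k * dtn_symbol n (k * R)" and C = "k * C"])
    show "fourier_coeff (ang \<beta>) n = \<i> * of_int n * fourier_coeff P n" for n using ang_\<beta> mP by simp
    show "norm (of_real k * dtn_symbol n (k * R)) \<le> k * C * (1 + \<bar>real_of_int n\<bar>)" for n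
      using C(2)[of n] k by (simp add: norm_mult mult.assoc)
    show "Im (of_real k * dtn_symbol n (k * R)) > 0" for n using Im_dtn_symbol_pos[OF kR, of n] k by simp
    show "(\<lambda>N. \<Sum>n\<in>{-int N..int N}. of_real k * dtn_symbol n (k * R) * fourier_coeff P n / of_real (2 * pi) * cis (of_int n * \<theta>)) \<longlonglongrightarrow> g \<theta>" for \<theta>
      using lim[of \<theta>] unfolding terms g_def e_def .
    show "integral {0..2*pi} (\<lambda>\<theta>. Im (cnj (P \<theta>) * g \<theta>)) = 0" using flux unfolding P_def g_def e_def .
  qed
  \<comment> \<open>With all coefficients zero every partial sum of the DtN series is 0, and so is
    its pointwise limit, the normal derivative.\<close>
  have g0: "g \<theta> = 0" for \<theta>
  proof -
    have "(\<lambda>N::nat. 0) \<longlonglongrightarrow> g \<theta>" using lim[of \<theta>] unfolding terms P0 g_def e_def by simp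
    then show ?thesis by (simp add: LIMSEQ_const_iff)
  qed
  have rad0: "rad \<beta> = (\<lambda>\<theta>. 0)"
  proof
    fix \<theta>
    have "rad \<beta> \<theta> = of_real R * g \<theta>" by (simp add: rad_def g_def e\<beta> algebra_simps)
    then show "rad \<beta> \<theta> = 0" using g0 by simp
  qed
  have mode0: "mode n s = 0" if s: "\<alpha> < s" "s < \<beta>" for n s
  proof -
    have sub: "{s..\<beta>} \<subseteq> {\<alpha><..\<beta>}" using s by auto
    have "mode n s = 0 \<and> db n s = 0"
    proof (rule second_order_ode_unique[where \<alpha> = s and \<beta> = \<beta> and a = "mode n" and b = "db n"
        and q = "\<lambda>s. (of_int n)\<^sup>2 - k\<^sup>2 * exp (2 * s)" and M = "(of_int n)\<^sup>2 + k\<^sup>2 * exp (2 * \<beta>)"])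
      show "continuous_on {s..\<beta>} (mode n)" "continuous_on {s..\<beta>} (db n)"
        using continuous_on_subset[OF cm sub] continuous_on_subset[OF cdb sub] by auto
      show "(mode n has_vector_derivative db n \<tau>) (at \<tau>)" if "s < \<tau>" "\<tau> < \<beta>" for \<tau>
        using mode_deriv(1)[of \<tau> n] db_eq[of \<tau> n] that s by simp
      show "(db n has_vector_derivative of_real ((of_int n)\<^sup>2 - k\<^sup>2 * exp (2 * \<tau>)) * mode n \<tau>) (at \<tau>)" if \<tau>: "s < \<tau>" "\<tau> < \<beta>" for \<tau>
      proof (rule has_vector_derivative_transform_within_open[where S = "{s<..<\<beta>}"])
        show "(dmode n has_vector_derivative of_real ((of_int n)\<^sup>2 - k\<^sup>2 * exp (2 * \<tau>)) * mode n \<tau>) (at \<tau>)"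
          using \<tau> s by (intro mode_deriv(2)) auto
      qed (use \<tau> s db_eq in auto)
      show "\<bar>(real_of_int n)\<^sup>2 - k\<^sup>2 * exp (2 * \<tau>)\<bar> \<le> (real_of_int n)\<^sup>2 + k\<^sup>2 * exp (2 * \<beta>)" if "s < \<tau>" "\<tau> < \<beta>" for \<tau>
      proof -
        have "k\<^sup>2 * exp (2 * \<tau>) \<le> k\<^sup>2 * exp (2 * \<beta>)" using that by (intro mult_left_mono) auto
        moreover have "k\<^sup>2 * exp (2 * \<tau>) \<ge> 0" "(real_of_int n)\<^sup>2 \<ge> 0" by auto
        ultimately show ?thesis unfolding abs_le_iff by linarith
      qed
      have "mode n \<beta> = 0" by (simp add: mP P0)
      moreover have "db n \<beta> = 0" by (simp add: db_def rad0 fourier_coeff_def)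
      ultimately show "(mode n s = 0 \<and> db n s = 0) \<or> (mode n \<beta> = 0 \<and> db n \<beta> = 0)" by simp
    qed (use s in auto)
    then show ?thesis by simp
  qed
  have annulus0: "p z = 0" if z: "r1 < norm z" "norm z < R" for z
  proof -
    have "z \<noteq> 0"
    proof
      assume "z = 0"
      then have "r1 < 0" using z(1) by simp
      then show False using r1 by linarith
    qed
    from this obtain \<theta> where \<theta>: "z = polar_pt (norm z) \<theta>" by (rule polar_pt_exhaust)
    define s where "s = ln (norm z)"
    have es: "exp s = norm z" using \<open>z \<noteq> 0\<close> by (simp add: s_def)
    have s: "\<alpha> < s" "s < \<beta>" unfolding \<alpha>_def \<beta>_def s_def using z r1 by (auto intro!: ln_strict_mono)
    have "p (0 + polar_pt (exp s) \<theta>) = 0" by (rule vanish_of_modes) (use s mode0 in auto)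
    then show ?thesis using \<theta> es by simp
  qed
  \<comment> \<open>A point halfway across the annulus, so that a ball of radius (R - r1) / 2 around
    it fits.\<close>
  define a where "a = polar_pt ((r1 + R) / 2) 0"
  have na: "norm a = (r1 + R) / 2" using r1 by (simp add: a_def)
  show ?thesis
  proof (rule helmholtz_unique_continuation[OF V reg(1) helmholtz, of a "(R - r1) / 2"])
    show "p z = 0" if "z \<in> ball a ((R - r1) / 2)" for z
    proof (rule annulus0)
      have "norm (a - z) < (R - r1) / 2" using that by (simp add: dist_norm)
      then show "r1 < norm z" "norm z < R"
        using norm_triangle_ineq2[of a z] norm_triangle_ineq2[of z a] na norm_minus_commute[of a z] by argo+
    qed
    show "a \<in> V" using na r1 by (intro annulus) auto
  qed (use r1 x in auto)
qed

text \<open>By the Helmholtz equation the divergence of cnj p grad p is |grad p|^2 - k^2 |p|^2,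
  which is real.\<close>

lemma exterior_closed_form:
  assumes V: "open V" and p: "C2_on V p" "C1_closure V p"
    and helmholtz: "\<And>x. x \<in> V \<Longrightarrow> laplacian p x + of_real (k^2) * p x = 0"
  shows "closed_form (vc ` V) (\<lambda>z. - Im (cnj (p (cv z)) * ext_pd V 2 p (cv z))) (\<lambda>z. Im (cnj (p (cv z)) * ext_pd V 1 p (cv z)))"
proof -
  have C1: "C1_on V p" "\<And>i. C1_on V (pd i p)" using p by (auto simp: C2_on_def)
  have c: "continuous_on V p" "\<And>i. continuous_on V (pd i p)" "\<And>i j. continuous_on V (pd j (pd i p))"
    using C1 C1_on_continuous by (auto simp: C1_on_def)
  define e where "e i = ext_pd V i p" for i
  have ee: "e i x = pd i p x" if "x \<in> V" for i x using that by (simp add: e_def ext_pd_def)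
  have de: "has_pds (e i) x (pd 1 (pd i p) x) (pd 2 (pd i p) x)" if "x \<in> V" for i x
    by (rule has_pds_transform[OF has_pds_pd[OF V C1(2) that] V that]) (simp add: ee)
  have dp: "has_pds (\<lambda>x. cnj (p x)) x (cnj (pd 1 p x)) (cnj (pd 2 p x))" if "x \<in> V" for x
    by (rule has_pds_cnj[OF has_pds_pd[OF V C1(1) that]])
  have ce: "continuous_on V (e i)" for i by (rule continuous_on_eq[OF c(2)]) (simp add: ee)
  show ?thesis
    unfolding e_def[symmetric]
  proof (rule flux_closed_form[OF V has_pds_mult[OF dp de] has_pds_mult[OF dp de]])
    fix x assume x: "x \<in> V"
    have "pd 1 (pd 1 p) x + pd 2 (pd 2 p) x = - of_real (k^2) * p x"
      using helmholtz[OF x] by (simp add: laplacian_def sum_2 eq_neg_iff_add_eq_0)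
    then have p22: "pd 2 (pd 2 p) x = - of_real (k^2) * p x - pd 1 (pd 1 p) x" by (metis add_diff_cancel_left')
    have "cnj (pd 1 p x) * e 1 x + cnj (p x) * pd 1 (pd 1 p) x + (cnj (pd 2 p x) * e 2 x + cnj (p x) * pd 2 (pd 2 p) x)
      = of_real ((norm (pd 1 p x))\<^sup>2) + of_real ((norm (pd 2 p x))\<^sup>2) - of_real (k^2) * of_real ((norm (p x))\<^sup>2)"
      unfolding ee[OF x] complex_norm_square p22 by (simp add: algebra_simps)
    then show "Im (cnj (pd 1 p x) * e 1 x + cnj (p x) * pd 1 (pd 1 p) x + (cnj (pd 2 p x) * e 2 x + cnj (p x) * pd 2 (pd 2 p) x)) = 0"
      by (simp only:) simp
  qed (assumption | intro continuous_intros c ce)+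
qed

locale elastic_field =
  fixes lam mu \<kappa> :: real and \<Omega> :: "(real^2) set" and u :: "real^2 \<Rightarrow> complex^2"
  assumes \<Omega>: "open \<Omega>" and u: "vec_C2_C1bar \<Omega> u"
    and eq: "\<And>x. x \<in> \<Omega> \<Longrightarrow> lame lam mu u x + \<kappa> *\<^sub>R u x = 0"
begin

definition D where "D i j = ext_pd \<Omega> j (comp u i)"
text \<open>The stress tensor of Hooke's law; F1 and F2 below are the components of the stress
  applied to cnj u, whose imaginary part is the energy flux up to a constant.\<close>

definition sig11 where "sig11 x = of_real (2 * mu) * D 1 1 x + of_real lam * (D 1 1 x + D 2 2 x)"
definition sig22 where "sig22 x = of_real (2 * mu) * D 2 2 x + of_real lam * (D 1 1 x + D 2 2 x)"
definition sig12 where "sig12 x = of_real mu * (D 1 2 x + D 2 1 x)"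
definition F1 where "F1 x = sig11 x * cnj (comp u 1 x) + sig12 x * cnj (comp u 2 x)"
definition F2 where "F2 x = sig12 x * cnj (comp u 1 x) + sig22 x * cnj (comp u 2 x)"

lemma C2: "C2_on \<Omega> (comp u i)" and C1bar: "C1_closure \<Omega> (comp u i)"
  using u by (auto simp: vec_C2_C1bar_def)

lemma C1: "C1_on \<Omega> (comp u i)" "C1_on \<Omega> (pd j (comp u i))"
  using C2 by (auto simp: C2_on_def)

lemma cont_closure: "continuous_on (closure \<Omega>) F1" "continuous_on (closure \<Omega>) F2"
proof -
  have c: "continuous_on (closure \<Omega>) (D i j)" for i j unfolding D_def by (rule continuous_on_ext_pd[OF C1bar])
  have c': "continuous_on (closure \<Omega>) (comp u i)" for i using C1bar by (simp add: C1_closure_def)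
  show "continuous_on (closure \<Omega>) F1" "continuous_on (closure \<Omega>) F2"
    unfolding F1_def [abs_def] F2_def [abs_def] sig11_def sig12_def sig22_def by (intro continuous_intros c c')+
qed

text \<open>The divergence of the stress applied to cnj u is the Lame operator paired with cnj u
  plus a quadratic form in the gradient, that is - \<kappa> |u|^2 plus real squares. Mixed
  derivatives must commute because the divergence of the stress and the Lame operator order them
  differently.\<close>

lemma interior_closed_form:
  "closed_form (vc ` \<Omega>) (\<lambda>z. - Im (F2 (cv z))) (\<lambda>z. Im (F1 (cv z)))"
proof -
  define U where "U i j k x = pd k (pd j (comp u i)) x" for i j k x
  have DD: "D i j x = pd j (comp u i) x" if "x \<in> \<Omega>" for i j x using that by (simp add: D_def ext_pd_def)
  have dD: "has_pds (D i j) x (U i j 1 x) (U i j 2 x)" if "x \<in> \<Omega>" for i j x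
    unfolding U_def by (rule has_pds_transform[OF has_pds_pd[OF \<Omega> C1(2) that] \<Omega> that]) (simp add: DD)
  have du: "has_pds (\<lambda>x. cnj (comp u i x)) x (cnj (D i 1 x)) (cnj (D i 2 x))" if "x \<in> \<Omega>" for i x
    using has_pds_cnj[OF has_pds_pd[OF \<Omega> C1(1) that]] by (simp add: DD that)
  have s11: "has_pds sig11 x (of_real (2 * mu) * U 1 1 1 x + of_real lam * (U 1 1 1 x + U 2 2 1 x)) (of_real (2 * mu) * U 1 1 2 x + of_real lam * (U 1 1 2 x + U 2 2 2 x))" if "x \<in> \<Omega>" for x
    unfolding sig11_def [abs_def] by (intro has_pds_add has_pds_cmult dD that)
  have s22: "has_pds sig22 x (of_real (2 * mu) * U 2 2 1 x + of_real lam * (U 1 1 1 x + U 2 2 1 x)) (of_real (2 * mu) * U 2 2 2 x + of_real lam * (U 1 1 2 x + U 2 2 2 x))" if "x \<in> \<Omega>" for x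
    unfolding sig22_def [abs_def] by (intro has_pds_add has_pds_cmult dD that)
  have s12: "has_pds sig12 x (of_real mu * (U 1 2 1 x + U 2 1 1 x)) (of_real mu * (U 1 2 2 x + U 2 1 2 x))" if "x \<in> \<Omega>" for x
    unfolding sig12_def [abs_def] by (intro has_pds_add has_pds_cmult dD that)
  have cu: "continuous_on \<Omega> (comp u i)" for i using C1 C1_on_continuous by blast
  have cD: "continuous_on \<Omega> (D i j)" for i j
    by (rule continuous_on_eq[of _ "pd j (comp u i)"]) (use C1 in \<open>auto simp: C1_on_def DD\<close>)
  have cU: "continuous_on \<Omega> (U i j k)" for i j k unfolding U_def [abs_def] using C1(2) by (simp add: C1_on_def)
  note cont = cu cD cU
  have csig: "continuous_on \<Omega> sig11" "continuous_on \<Omega> sig12" "continuous_on \<Omega> sig22"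
    unfolding sig11_def [abs_def] sig12_def [abs_def] sig22_def [abs_def] by (intro continuous_intros cont)+
  show ?thesis
    unfolding F1_def F2_def
  proof (rule flux_closed_form[OF \<Omega> has_pds_add[OF has_pds_mult[OF s11 du] has_pds_mult[OF s12 du]] has_pds_add[OF has_pds_mult[OF s12 du] has_pds_mult[OF s22 du]]])
    fix x assume x: "x \<in> \<Omega>"
    have mix: "U 1 2 1 x = U 1 1 2 x" "U 2 1 2 x = U 2 2 1 x"
      unfolding U_def using mixed_pd_eq[OF \<Omega> C2 x] by auto
    have div: "pd i (divergence u) x = U 1 1 i x + U 2 2 i x" for i
    proof -
      have "divergence u = (\<lambda>x. pd 1 (comp u 1) x + pd 2 (comp u 2) x)" by (simp add: divergence_def [abs_def] sum_2)
      then show ?thesis unfolding U_def by (simp add: pd_add[OF \<Omega> C1(2) C1(2) x])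
    qed
    have e: "(lame lam mu u x + \<kappa> *\<^sub>R u x) $ i = 0" for i using eq[OF x] by simp
    have L1: "of_real mu * (U 1 1 1 x + U 1 2 2 x) + of_real (lam + mu) * (U 1 1 1 x + U 2 2 1 x) = - of_real \<kappa> * comp u 1 x"
      using e[of 1] by (simp add: lame_def laplacian_def sum_2 div comp_def U_def scaleR_conv_of_real[of _ "_::complex"] eq_neg_iff_add_eq_0)
    have L2: "of_real mu * (U 2 1 1 x + U 2 2 2 x) + of_real (lam + mu) * (U 1 1 2 x + U 2 2 2 x) = - of_real \<kappa> * comp u 2 x"
      using e[of 2] by (simp add: lame_def laplacian_def sum_2 div comp_def U_def scaleR_conv_of_real[of _ "_::complex"] eq_neg_iff_add_eq_0)
    let ?E = "(of_real (2 * mu) * U 1 1 1 x + of_real lam * (U 1 1 1 x + U 2 2 1 x)) * cnj (comp u 1 x) + sig11 x * cnj (D 1 1 x)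
      + (of_real mu * (U 1 2 1 x + U 2 1 1 x) * cnj (comp u 2 x) + sig12 x * cnj (D 2 1 x))
      + (of_real mu * (U 1 2 2 x + U 2 1 2 x) * cnj (comp u 1 x) + sig12 x * cnj (D 1 2 x)
      + ((of_real (2 * mu) * U 2 2 2 x + of_real lam * (U 1 1 2 x + U 2 2 2 x)) * cnj (comp u 2 x) + sig22 x * cnj (D 2 2 x)))"
    have "?E = (of_real mu * (U 1 1 1 x + U 1 2 2 x) + of_real (lam + mu) * (U 1 1 1 x + U 2 2 1 x)) * cnj (comp u 1 x)
       + (of_real mu * (U 2 1 1 x + U 2 2 2 x) + of_real (lam + mu) * (U 1 1 2 x + U 2 2 2 x)) * cnj (comp u 2 x)
       + (of_real (2 * mu) * (D 1 1 x * cnj (D 1 1 x) + D 2 2 x * cnj (D 2 2 x))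
       + of_real lam * ((D 1 1 x + D 2 2 x) * cnj (D 1 1 x + D 2 2 x))
       + of_real mu * ((D 1 2 x + D 2 1 x) * cnj (D 1 2 x + D 2 1 x)))"
      unfolding sig11_def sig12_def sig22_def mix by (simp add: algebra_simps)
    also have "\<dots> = of_real (- \<kappa> * (norm (comp u 1 x))\<^sup>2 - \<kappa> * (norm (comp u 2 x))\<^sup>2
       + (2 * mu * ((norm (D 1 1 x))\<^sup>2 + (norm (D 2 2 x))\<^sup>2) + lam * (norm (D 1 1 x + D 2 2 x))\<^sup>2 + mu * (norm (D 1 2 x + D 2 1 x))\<^sup>2))"
      unfolding L1 L2 by (simp add: complex_norm_square [symmetric] mult.assoc del: complex_cnj_add of_real_power)
    finally show "Im ?E = 0" by (simp only: Im_complex_of_real)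
  qed (assumption | intro continuous_intros cont csig)+
qed

text \<open>The given T u is the stress applied to n: adding mu n x curl u to 2 mu times the normal
  derivative exchanges one of its two copies of the gradient for the transpose, which leaves the
  symmetric gradient.\<close>

lemma boundary_flux:
  assumes x: "x \<notin> \<Omega>"
  shows "F1 x * of_real (n$1) + F2 x * of_real (n$2)
    = traction lam mu \<Omega> n u x $ 1 * cnj (u x $ 1) + traction lam mu \<Omega> n u x $ 2 * cnj (u x $ 2)"
proof -
  have "D i j x = bpd \<Omega> j (comp u i) x" for i j using x by (simp add: D_def ext_pd_def)
  then show ?thesis
    unfolding F1_def F2_def sig11_def sig12_def sig22_def traction_def Let_def
    by (simp add: sum_2 comp_def algebra_simps)
qed

end

section \<open>Uniqueness\<close>

lemma curve_transfer:
  assumes dom: "C2_curve_domain \<Omega> \<gamma> \<gamma>1 L"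
  defines "c \<equiv> \<lambda>t. vc (\<gamma> (L * t))" and "c1 \<equiv> \<lambda>t. L *\<^sub>R vc (\<gamma>1 (L * t))"
  shows "\<exists>c2. jordan_C2_curve c c1 c2" "vc ` \<Omega> = inside (c ` {0..1})" "open \<Omega>"
proof -
  obtain \<gamma>2 where L: "L > 0" and per: "\<And>t. \<gamma> (t + L) = \<gamma> t"
    and d: "\<And>t. (\<gamma> has_vector_derivative \<gamma>1 t) (at t)" "\<And>t. (\<gamma>1 has_vector_derivative \<gamma>2 t) (at t)"
    and c2: "continuous_on UNIV \<gamma>2" and nz: "\<And>t. \<gamma>1 t \<noteq> 0" and inj: "inj_on \<gamma> {0..<L}"
    and \<Omega>: "\<Omega> = inside (\<gamma> ` {0..L})"
    using dom unfolding C2_curve_domain_def by blast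
  have chain: "((\<lambda>t. vc (g (L * t))) has_vector_derivative L *\<^sub>R vc (g' (L * t))) (at t)"
    if "\<And>t. (g has_vector_derivative g' t) (at t)" for g g' t
  proof -
    have "((\<lambda>t. L * t) has_vector_derivative L) (at t)"
      by (auto intro!: derivative_eq_intros simp flip: has_real_derivative_iff_has_vector_derivative)
    from vector_diff_chain_at[OF this that] have "((\<lambda>t. g (L * t)) has_vector_derivative L *\<^sub>R g' (L * t)) (at t)"
      by (simp add: o_def)
    from bounded_linear.has_vector_derivative[OF bounded_linear_vc this] show ?thesis
      by (simp add: linear_scale[OF linear_vc])
  qed
  have "jordan_C2_curve c c1 (\<lambda>t. L *\<^sub>R (L *\<^sub>R vc (\<gamma>2 (L * t))))"
  proof
    show "(c has_vector_derivative c1 t) (at t)" for t unfolding c_def c1_def by (rule chain[OF d(1)])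
    show "(c1 has_vector_derivative L *\<^sub>R (L *\<^sub>R vc (\<gamma>2 (L * t)))) (at t)" for t
      unfolding c1_def by (rule bounded_linear.has_vector_derivative[OF bounded_linear_scaleR_right chain[OF d(2)]])
    have "continuous_on UNIV (\<lambda>t. \<gamma>2 (L * t))"
      by (rule continuous_on_compose2[OF c2]) (auto intro!: continuous_intros)
    then show "continuous_on UNIV (\<lambda>t. L *\<^sub>R (L *\<^sub>R vc (\<gamma>2 (L * t))))"
      by (intro continuous_intros bounded_linear.continuous_on[OF bounded_linear_vc])
    show "c1 t \<noteq> 0" for t
    proof
      assume "c1 t = 0"
      then have "vc (\<gamma>1 (L * t)) = 0" using L by (simp add: c1_def)
      then have "norm (\<gamma>1 (L * t)) = 0" by (metis norm_vc norm_zero)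
      then show False using nz by simp
    qed
    show "c (t + 1) = c t" for t using per[of "L * t"] by (simp add: c_def distrib_left)
    show "inj_on c {0..<1}"
    proof (rule inj_onI)
      fix s t assume st: "s \<in> {0..<1::real}" "t \<in> {0..<1}" "c s = c t"
      then have "\<gamma> (L * s) = \<gamma> (L * t)" using inj_vc by (simp add: c_def inj_eq)
      moreover have "L * s \<in> {0..<L}" "L * t \<in> {0..<L}" using st L by auto
      ultimately have "L * s = L * t" using inj by (meson inj_onD)
      then show "s = t" using L by simp
    qed
  qed
  then show "\<exists>c2. jordan_C2_curve c c1 c2" by blast
  have im: "(\<lambda>t. L * t) ` {0..1} = {0..L}"
    using L by (simp add: image_mult_atLeastAtMost)
  have "c ` {0..1} = vc ` \<gamma> ` (\<lambda>t. L * t) ` {0..1}" by (simp add: c_def image_image)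
  then show "vc ` \<Omega> = inside (c ` {0..1})" unfolding im \<Omega> vc_inside by simp
  have "continuous_on {0..L} \<gamma>"
    using d(1) by (meson continuous_at_imp_continuous_on has_vector_derivative_continuous)
  then have "compact (\<gamma> ` {0..L})" by (intro compact_continuous_image compact_Icc)
  then show "open \<Omega>" unfolding \<Omega> by (intro open_inside compact_imp_closed)
qed

text \<open>In the plane a vector orthogonal to n is a multiple of n turned by a right angle; the
  sign of \<tau> depends on the orientation of the curve.\<close>

lemma normal_parallel:
  fixes n v :: "real^2"
  assumes "norm n = 1" "n \<bullet> v = 0"
  obtains \<tau> where "v $ 2 = \<tau> * n $ 1" "- v $ 1 = \<tau> * n $ 2"
proof -
  have n: "(n$1)\<^sup>2 + (n$2)\<^sup>2 = 1" using assms(1) by (simp add: norm_vec2)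
  have o: "n$1 * v$1 + n$2 * v$2 = 0" using assms(2) by (simp add: inner_vec_def sum_2)
  show thesis
  proof (rule that[of "v$2 * n$1 - v$1 * n$2"])
    show "v $ 2 = (v$2 * n$1 - v$1 * n$2) * n $ 1" using n o by algebra
    show "- v $ 1 = (v$2 * n$1 - v$1 * n$2) * n $ 2" using n o by algebra
  qed
qed

section \<open>Differences of solutions\<close>

lemma pd_divergence:
  assumes "open S" "\<And>i. C2_on S (comp u i)" "x \<in> S"
  shows "pd i (divergence u) x = pd i (pd 1 (comp u 1)) x + pd i (pd 2 (comp u 2)) x"
proof -
  have "divergence u = (\<lambda>x. pd 1 (comp u 1) x + pd 2 (comp u 2) x)" by (simp add: divergence_def [abs_def] sum_2)
  moreover have "C1_on S (pd 1 (comp u 1))" "C1_on S (pd 2 (comp u 2))" using assms(2) by (auto simp: C2_on_def)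
  ultimately show ?thesis by (simp add: pd_add[OF assms(1) _ _ assms(3)])
qed

lemma comp_diff: "comp (\<lambda>x. u x - u' x) i = (\<lambda>x. comp u i x - comp u' i x)"
  by (simp add: comp_def fun_eq_iff)

lemma lame_diff:
  assumes "open S" "\<And>i. C2_on S (comp u i)" "\<And>i. C2_on S (comp u' i)" "x \<in> S"
  shows "lame lam mu (\<lambda>x. u x - u' x) x = lame lam mu u x - lame lam mu u' x"
proof -
  have C2: "\<And>i. C2_on S (comp (\<lambda>x. u x - u' x) i)" unfolding comp_diff by (intro C2_on_diff assms)
  have dv: "pd i (divergence (\<lambda>x. u x - u' x)) x = pd i (divergence u) x - pd i (divergence u') x" for i
    unfolding pd_divergence[OF assms(1) C2 assms(4)] pd_divergence[OF assms(1,2,4)] pd_divergence[OF assms(1,3,4)]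
    unfolding comp_diff pd_pd_diff[OF assms(1) assms(2) assms(3) assms(4)] by simp
  have lp: "laplacian (comp (\<lambda>x. u x - u' x) i) x = laplacian (comp u i) x - laplacian (comp u' i) x" for i
    unfolding comp_diff by (rule laplacian_diff[OF assms(1) assms(2) assms(3) assms(4)])
  show ?thesis
    unfolding lame_def dv lp by (simp add: vec_eq_iff algebra_simps)
qed

lemma traction_diff:
  assumes "open S" "\<And>i. C1_closure S (comp u i)" "\<And>i. C1_closure S (comp u' i)" "x \<in> closure S" "x \<notin> S"
  shows "traction lam mu S n (\<lambda>x. u x - u' x) x = traction lam mu S n u x - traction lam mu S n u' x"
  unfolding traction_def Let_def comp_diff bpd_diff[OF assms(1) assms(2) assms(3) assms(4) assms(5)]
  by (simp add: vec_eq_iff forall_2 sum_2 algebra_simps)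

theorem theorem3p2:
  fixes \<Omega> :: "(real^2) set" and \<gamma> \<gamma>1 :: "real \<Rightarrow> real^2" and L :: real
    and nv :: "real^2 \<Rightarrow> real^2"
    and lam mu \<rho> \<rho>f \<omega> k R :: real
    and pinc :: "real^2 \<Rightarrow> complex"
    and u u' :: "real^2 \<Rightarrow> complex^2" and p p' :: "real^2 \<Rightarrow> complex"
  assumes dom: "C2_curve_domain \<Omega> \<gamma> \<gamma>1 L"
    and bdd: "bounded \<Omega>" and sc: "simply_connected \<Omega>"
    and normal: "outward_unit_normal \<Omega> \<gamma> \<gamma>1 nv"
    and mu: "mu > 0" and lm: "lam + mu > 0"
    and pos: "\<rho> > 0" "\<rho>f > 0" "\<omega> > 0" "k > 0" "R > 0"
    and inB: "closure \<Omega> \<subseteq> ball 0 R"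
    and no_tf: "\<not> (\<exists>u0. traction_free_solution lam mu \<rho> \<omega> \<Omega> nv u0)"
    and sol1: "fsi_solution lam mu \<rho> \<rho>f \<omega> k R \<Omega> nv pinc u p"
    and sol2: "fsi_solution lam mu \<rho> \<rho>f \<omega> k R \<Omega> nv pinc u' p'"
  shows "(\<forall>x\<in>closure \<Omega>. u x = u' x) \<and> (\<forall>x\<in>closure (ball 0 R - closure \<Omega>). p x = p' x)"
proof -
  define c where "c = (\<lambda>t. vc (\<gamma> (L * t)))"
  define c1 where "c1 = (\<lambda>t. L *\<^sub>R vc (\<gamma>1 (L * t)))"
  obtain c2 where jc: "jordan_C2_curve c c1 c2" and inside: "vc ` \<Omega> = inside (c ` {0..1})" and \<Omega>: "open \<Omega>"
    using curve_transfer[OF dom] unfolding c_def c1_def by blast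
  interpret J: jordan_in_disc c c1 c2 R
  proof (intro jordan_in_disc.intro jc jordan_in_disc_axioms.intro)
    show "closure (inside (c ` {0..1})) \<subseteq> ball 0 R"
      unfolding inside[symmetric] vc_closure[symmetric] vc_ball[symmetric] using inB by (rule image_mono)
  qed
  define V where "V = ball 0 R - closure \<Omega>"
  have vcV: "vc ` V = J.V"
    unfolding J.V_def V_def inside[symmetric] vc_closure[symmetric] vc_ball[symmetric] by (rule image_set_diff[OF inj_vc])
  have Vop: "open V" unfolding V_def by (intro open_Diff open_ball closed_closure)
  have Vcon: "connected V"
  proof -
    have "connected (cv ` J.V)" by (intro connected_linear_image linear_cv J.connected_V)
    then show ?thesis unfolding vcV[symmetric] by simp
  qed
  obtain r1 where r1: "0 < r1" "r1 < R" "closure (inside (c ` {0..1})) \<subseteq> ball 0 r1" by (rule J.inner_radius)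
  have annulus: "x \<in> V" if "r1 < norm x" "norm x < R" for x
  proof -
    have "vc x \<in> J.V" using J.circle_in_V[OF r1(3), of "vc x"] that by simp
    then show ?thesis using inj_vc unfolding vcV[symmetric] by (simp add: inj_image_mem_iff)
  qed
  have circle_cl: "polar_pt R \<theta> \<in> closure V" for \<theta>
  proof -
    have "polar_pt (R - 0) \<theta> \<in> closure V"
    proof (rule limit_at_0_closure[of "R - r1" "\<lambda>s. polar_pt (R - s) \<theta>"])
      show "continuous_on {0..<R - r1} (\<lambda>s. polar_pt (R - s) \<theta>)" by (intro continuous_intros)
    qed (use r1 in \<open>auto intro!: annulus\<close>)
    then show ?thesis by simp
  qed
  have circle_nV: "polar_pt R \<theta> \<notin> V" for \<theta> using pos(5) by (simp add: V_def)
  \<comment> \<open>Points of the interface adhere to the fluid region as well as to the solid, so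
    boundary limits from both sides are meaningful there.\<close>
  have front: "x \<in> closure \<Omega>" "x \<notin> \<Omega>" "x \<in> closure V" "x \<notin> V" if x: "x \<in> frontier \<Omega>" for x
  proof -
    show 1: "x \<in> closure \<Omega>" "x \<notin> \<Omega>" using x \<Omega> by (auto simp: frontier_def interior_open)
    then show "x \<notin> V" by (simp add: V_def)
    have "vc x \<in> frontier (inside (c ` {0..1}))" unfolding inside[symmetric] vc_frontier[symmetric] using x by blast
    then obtain t where "vc x = c t" unfolding J.jordan(8) by blast
    then have "vc x \<in> closure J.V" using J.curve_in_closure_V by simp
    then show "x \<in> closure V" unfolding vcV[symmetric] vc_closure[symmetric] using inj_vc by (simp add: inj_image_mem_iff)
  qed
  have curve_front: "\<gamma> (L * t) \<in> frontier \<Omega>" for t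
  proof -
    have "c t \<in> vc ` frontier \<Omega>" unfolding vc_frontier inside J.jordan(8) by (rule J.c_in_\<Gamma>)
    then show ?thesis using inj_vc by (simp add: c_def inj_image_mem_iff)
  qed
  \<comment> \<open>Both solutions carry the same incident field, which cancels in the
    differences.\<close>
  define w where "w = (\<lambda>x. u x - u' x)"
  define q where "q = (\<lambda>x. p x - p' x)"
  have reg: "vec_C2_C1bar \<Omega> u" "C2_on V p" "C1_closure V p" "vec_C2_C1bar \<Omega> u'" "C2_on V p'" "C1_closure V p'"
    using sol1 sol2 by (auto simp: fsi_solution_def Let_def V_def)
  have lame: "\<And>x. x \<in> \<Omega> \<Longrightarrow> lame lam mu u x + (\<rho> * \<omega>^2) *\<^sub>R u x = 0" "\<And>x. x \<in> \<Omega> \<Longrightarrow> lame lam mu u' x + (\<rho> * \<omega>^2) *\<^sub>R u' x = 0"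
    and helm: "\<And>x. x \<in> V \<Longrightarrow> laplacian p x + of_real (k^2) * p x = 0" "\<And>x. x \<in> V \<Longrightarrow> laplacian p' x + of_real (k^2) * p' x = 0"
    using sol1 sol2 by (auto simp: fsi_solution_def Let_def V_def)
  have kin: "\<And>x. x \<in> frontier \<Omega> \<Longrightarrow> of_real (\<omega>^2 * \<rho>f) * ndot (u x) (nv x) = (\<Sum>j\<in>UNIV. of_real (nv x $ j) * (bpd V j p x + pd j pinc x))"
    "\<And>x. x \<in> frontier \<Omega> \<Longrightarrow> of_real (\<omega>^2 * \<rho>f) * ndot (u' x) (nv x) = (\<Sum>j\<in>UNIV. of_real (nv x $ j) * (bpd V j p' x + pd j pinc x))"
    using sol1 sol2 unfolding fsi_solution_def Let_def V_def by blast+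
  have dyn: "\<And>x. x \<in> frontier \<Omega> \<Longrightarrow> traction lam mu \<Omega> (nv x) u x = - (\<chi> j. of_real (nv x $ j) * (p x + pinc x))"
    "\<And>x. x \<in> frontier \<Omega> \<Longrightarrow> traction lam mu \<Omega> (nv x) u' x = - (\<chi> j. of_real (nv x $ j) * (p' x + pinc x))"
    using sol1 sol2 unfolding fsi_solution_def Let_def by blast+
  have dtn: "dtn_condition k R p (\<lambda>x. \<Sum>j\<in>UNIV. of_real (x $ j / R) * bpd V j p x)"
    "dtn_condition k R p' (\<lambda>x. \<Sum>j\<in>UNIV. of_real (x $ j / R) * bpd V j p' x)"
    using sol1 sol2 unfolding fsi_solution_def Let_def V_def by blast+
  have C2u: "\<And>i. C2_on \<Omega> (comp u i)" "\<And>i. C2_on \<Omega> (comp u' i)" and C1u: "\<And>i. C1_closure \<Omega> (comp u i)" "\<And>i. C1_closure \<Omega> (comp u' i)"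
    using reg by (auto simp: vec_C2_C1bar_def)
  have wreg: "vec_C2_C1bar \<Omega> w"
    unfolding vec_C2_C1bar_def w_def comp_diff by (intro allI conjI C2_on_diff C1_closure_diff \<Omega> C2u C1u)
  have qreg: "C2_on V q" "C1_closure V q"
    unfolding q_def by (intro C2_on_diff C1_closure_diff Vop reg)+
  have wlame: "lame lam mu w x + (\<rho> * \<omega>^2) *\<^sub>R w x = 0" if "x \<in> \<Omega>" for x
  proof -
    have "lame lam mu w x = lame lam mu u x - lame lam mu u' x" unfolding w_def by (rule lame_diff[OF \<Omega> C2u that])
    then have "lame lam mu w x + (\<rho> * \<omega>^2) *\<^sub>R w x = (lame lam mu u x + (\<rho> * \<omega>^2) *\<^sub>R u x) - (lame lam mu u' x + (\<rho> * \<omega>^2) *\<^sub>R u' x)"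
      by (simp add: w_def algebra_simps)
    then show ?thesis using lame that by simp
  qed
  have qhelm: "laplacian q x + of_real (k^2) * q x = 0" if "x \<in> V" for x
  proof -
    have "laplacian q x + of_real (k^2) * q x = (laplacian p x + of_real (k^2) * p x) - (laplacian p' x + of_real (k^2) * p' x)"
      unfolding q_def laplacian_diff[OF Vop reg(2,5) that] by (simp add: algebra_simps)
    then show ?thesis using helm that by simp
  qed
  have qkin: "of_real (\<omega>^2 * \<rho>f) * ndot (w x) (nv x) = of_real (nv x $ 1) * bpd V 1 q x + of_real (nv x $ 2) * bpd V 2 q x"
    if x: "x \<in> frontier \<Omega>" for x
  proof -
    have "ndot (w x) (nv x) = ndot (u x) (nv x) - ndot (u' x) (nv x)"
      by (simp add: ndot_def w_def sum_2 algebra_simps)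
    then have "of_real (\<omega>^2 * \<rho>f) * ndot (w x) (nv x) = of_real (\<omega>^2 * \<rho>f) * ndot (u x) (nv x) - of_real (\<omega>^2 * \<rho>f) * ndot (u' x) (nv x)"
      by (simp only: right_diff_distrib)
    also have "\<dots> = of_real (nv x $ 1) * bpd V 1 q x + of_real (nv x $ 2) * bpd V 2 q x"
      unfolding kin[OF x] q_def bpd_diff[OF Vop reg(3,6) front(3,4)[OF x]] by (simp add: sum_2 algebra_simps)
    finally show ?thesis .
  qed
  have wdyn: "traction lam mu \<Omega> (nv x) w x = - (\<chi> j. of_real (nv x $ j) * q x)" if x: "x \<in> frontier \<Omega>" for x
    unfolding w_def traction_diff[OF \<Omega> C1u front(1,2)[OF x]] dyn[OF x] q_def by (simp add: vec_eq_iff algebra_simps)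
  interpret E: elastic_field lam mu "\<rho> * \<omega>^2" \<Omega> w
    by unfold_locales (use \<Omega> wreg wlame in auto)
  define e where "e i = ext_pd V i q" for i
  \<comment> \<open>Coefficients of the flux forms F1 dy - F2 dx: i for the elastic field inside, e
    for the acoustic field outside.\<close>
  define Ai where "Ai z = - Im (E.F2 (cv z))" for z
  define Bi where "Bi z = Im (E.F1 (cv z))" for z
  define Ae where "Ae z = - Im (cnj (q (cv z)) * e 2 (cv z))" for z
  define Be where "Be z = Im (cnj (q (cv z)) * e 1 (cv z))" for z
  have cvc: "continuous_on (vc ` S) cv" for S by (rule linear_continuous_on[OF bounded_linear_cv])
  have comp_cv: "continuous_on (vc ` S) (\<lambda>z. F (cv z))" if "continuous_on S F" for F :: "real^2 \<Rightarrow> complex" and S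
    by (rule continuous_on_compose2[OF that cvc]) auto
  have qc: "continuous_on (closure V) q" using qreg(2) by (simp add: C1_closure_def)
  have ec: "continuous_on (closure V) (e i)" for i unfolding e_def by (rule continuous_on_ext_pd[OF qreg(2)])
  have int0: "integral {0..1} (\<lambda>t. Ai (c t) * Re (c1 t) + Bi (c t) * Im (c1 t)) = 0"
  proof (rule J.interior_flux_zero)
    show "closed_form (inside (c ` {0..1})) Ai Bi"
      unfolding inside[symmetric] Ai_def [abs_def] Bi_def [abs_def] by (rule E.interior_closed_form)
    show "continuous_on (closure (inside (c ` {0..1}))) Ai" "continuous_on (closure (inside (c ` {0..1}))) Bi"
      unfolding inside[symmetric] vc_closure[symmetric] Ai_def Bi_def by (intro continuous_intros comp_cv E.cont_closure)+
    show "simply_connected (inside (c ` {0..1}))"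
      unfolding inside[symmetric] using homeomorphic_simply_connected[OF linear_homeomorphic_image[OF linear_vc inj_vc] sc] .
  qed
  \<comment> \<open>The tangent is the normal turned by a right angle, times L \<tau>. This factor
    appears on both sides, so the flux densities can be compared without knowing the
    orientation.\<close>
  have pointwise: "Ae (c t) * Re (c1 t) + Be (c t) * Im (c1 t) = (\<omega>^2 * \<rho>f) * (Ai (c t) * Re (c1 t) + Bi (c t) * Im (c1 t))" for t
  proof -
    define x where "x = \<gamma> (L * t)"
    define n where "n = nv x"
    have xf: "x \<in> frontier \<Omega>" unfolding x_def by (rule curve_front)
    have ct: "cv (c t) = x" by (simp add: c_def x_def)
    have "norm n = 1" "n \<bullet> \<gamma>1 (L * t) = 0"
      using normal by (auto simp: outward_unit_normal_def n_def x_def)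
    then obtain \<tau> where \<tau>: "\<gamma>1 (L * t) $ 2 = \<tau> * n $ 1" "- \<gamma>1 (L * t) $ 1 = \<tau> * n $ 2" by (rule normal_parallel)
    have r: "Re (c1 t) = - (L * \<tau> * n $ 2)" "Im (c1 t) = L * \<tau> * n $ 1"
    proof -
      have "\<gamma>1 (L * t) $ 1 = - (\<tau> * n $ 2)" using \<tau>(2) by simp
      then show "Re (c1 t) = - (L * \<tau> * n $ 2)" "Im (c1 t) = L * \<tau> * n $ 1"
        using \<tau>(1) by (simp_all add: c1_def)
    qed
    have ee: "e i x = bpd V i q x" for i using front(4)[OF xf] by (simp add: e_def ext_pd_def)
    have "Ae (c t) * Re (c1 t) + Be (c t) * Im (c1 t) = L * \<tau> * Im (cnj (q x) * (of_real (n$1) * e 1 x + of_real (n$2) * e 2 x))"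
      unfolding Ae_def Be_def ct r by (simp add: algebra_simps)
    also have "\<dots> = L * \<tau> * Im (cnj (q x) * (of_real (\<omega>^2 * \<rho>f) * ndot (w x) n))"
      using qkin[OF xf] by (simp add: ee n_def)
    also have "\<dots> = (\<omega>^2 * \<rho>f) * (L * \<tau> * Im (cnj (q x) * ndot (w x) n))"
      by (simp add: algebra_simps del: of_real_mult of_real_power)
    \<comment> \<open>T w = - n q gives F . n = - q cnj (w . n), and Im (- z) = Im (cnj z) absorbs
      the minus sign.\<close>
    also have "Im (cnj (q x) * ndot (w x) n) = Im (E.F1 x * of_real (n$1) + E.F2 x * of_real (n$2))"
      unfolding E.boundary_flux[OF front(2)[OF xf]] wdyn[OF xf] n_def by (simp add: ndot_def sum_2 algebra_simps)
    also have "L * \<tau> * \<dots> = Ai (c t) * Re (c1 t) + Bi (c t) * Im (c1 t)"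
      unfolding Ai_def Bi_def ct r by (simp add: algebra_simps)
    finally show ?thesis .
  qed
  have ext0: "integral {0..1} (\<lambda>t. Ae (c t) * Re (c1 t) + Be (c t) * Im (c1 t)) = 0"
    unfolding pointwise by (simp add: int0)
  have "integral {0..2*pi} (\<lambda>\<theta>. Be (of_real R * cis \<theta>) * (R * cos \<theta>) - Ae (of_real R * cis \<theta>) * (R * sin \<theta>)) = 0"
  proof (rule J.exterior_flux_zero[OF _ _ _ ext0])
    show "closed_form J.V Ae Be"
      unfolding vcV[symmetric] Ae_def [abs_def] Be_def [abs_def] e_def by (rule exterior_closed_form[OF Vop qreg qhelm])
    show "continuous_on (closure J.V) Ae" "continuous_on (closure J.V) Be"
      unfolding vcV[symmetric] vc_closure[symmetric] Ae_def Be_def by (intro continuous_intros comp_cv qc ec)+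
  qed
  moreover have "Be (of_real R * cis \<theta>) * (R * cos \<theta>) - Ae (of_real R * cis \<theta>) * (R * sin \<theta>)
     = R * Im (cnj (q (polar_pt R \<theta>)) * (e 1 (polar_pt R \<theta>) * of_real (cos \<theta>) + e 2 (polar_pt R \<theta>) * of_real (sin \<theta>)))" for \<theta>
  proof -
    have "cv (of_real R * cis \<theta>) = polar_pt R \<theta>" by (simp add: vec_eq_iff forall_2)
    then show ?thesis unfolding Ae_def Be_def by (simp add: algebra_simps)
  qed
  ultimately have flux: "integral {0..2*pi} (\<lambda>\<theta>. Im (cnj (q (polar_pt R \<theta>)) * (e 1 (polar_pt R \<theta>) * of_real (cos \<theta>) + e 2 (polar_pt R \<theta>) * of_real (sin \<theta>)))) = 0"
    using pos(5) by (simp only: integral_mult_right) simp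
  have comp_circle: "continuous_on UNIV (\<lambda>\<theta>. f (polar_pt R \<theta>))" if "continuous_on (closure V) f" for f :: "real^2 \<Rightarrow> complex"
    by (rule continuous_on_compose2[OF that]) (auto intro!: continuous_intros circle_cl)
  have lim: "(\<lambda>N. \<Sum>n\<in>{-int N..int N}. dtn_term k R q n \<theta>) \<longlonglongrightarrow>
      e 1 (polar_pt R \<theta>) * of_real (cos \<theta>) + e 2 (polar_pt R \<theta>) * of_real (sin \<theta>)" for \<theta>
  proof -
    have cp: "continuous_on UNIV (\<lambda>\<theta>. p (polar_pt R \<theta>))" "continuous_on UNIV (\<lambda>\<theta>. p' (polar_pt R \<theta>))"
      using reg by (auto intro!: comp_circle simp: C1_closure_def)
    have "dtn_term k R q n \<theta> = dtn_term k R p n \<theta> - dtn_term k R p' n \<theta>" for n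
      unfolding dtn_term_eq[OF cp(1)] dtn_term_eq[OF cp(2)] dtn_term_eq[OF comp_circle[OF qc]]
      unfolding q_def fourier_coeff_diff[OF cp] by (simp add: algebra_simps diff_divide_distrib)
    moreover have "(\<lambda>N. (\<Sum>n\<in>{-int N..int N}. dtn_term k R p n \<theta>) - (\<Sum>n\<in>{-int N..int N}. dtn_term k R p' n \<theta>)) \<longlonglongrightarrow>
       (\<Sum>j\<in>UNIV. of_real (polar_pt R \<theta> $ j / R) * bpd V j p (polar_pt R \<theta>)) - (\<Sum>j\<in>UNIV. of_real (polar_pt R \<theta> $ j / R) * bpd V j p' (polar_pt R \<theta>))"
      using dtn unfolding dtn_condition_def by (intro tendsto_diff) auto
    moreover have "(\<Sum>j\<in>UNIV. of_real (polar_pt R \<theta> $ j / R) * bpd V j p (polar_pt R \<theta>)) - (\<Sum>j\<in>UNIV. of_real (polar_pt R \<theta> $ j / R) * bpd V j p' (polar_pt R \<theta>))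
      = e 1 (polar_pt R \<theta>) * of_real (cos \<theta>) + e 2 (polar_pt R \<theta>) * of_real (sin \<theta>)"
    proof -
      have ep: "e i (polar_pt R \<theta>) = bpd V i p (polar_pt R \<theta>) - bpd V i p' (polar_pt R \<theta>)" for i
        unfolding e_def ext_pd_def q_def using circle_nV[of \<theta>] bpd_diff[OF Vop reg(3,6) circle_cl circle_nV] by simp
      show ?thesis unfolding ep using pos(5) by (simp add: sum_2 algebra_simps)
    qed
    ultimately show ?thesis by (simp add: sum_subtractf)
  qed
  have q0: "q x = 0" if "x \<in> V" for x
    using dtn_radiating_vanish[OF Vop Vcon qreg qhelm r1(1,2) annulus pos(4) lim[unfolded e_def] flux[unfolded e_def] that] by blast
  have q0c: "q x = 0" if "x \<in> closure V" for x
    using continuous_constant_on_closure[OF qc q0 that] by blast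
  \<comment> \<open>The boundary derivatives of q on the interface are limits from V, where q is
    identically 0.\<close>
  have e0: "e i x = 0" if "x \<in> closure V" for i x
  proof -
    have "e i y = 0" if y: "y \<in> V" for y
    proof -
      have "has_pds (\<lambda>x. 0) y 0 0" unfolding has_pds_def by simp
      then have "has_pds q y 0 0" by (rule has_pds_transform[OF _ Vop y]) (simp add: q0)
      then have "pd i q y = 0" using has_pds_unique exhaust_2[of i] by metis
      then show ?thesis using y by (simp add: e_def ext_pd_def)
    qed
    then show ?thesis using continuous_constant_on_closure[OF ec _ that] by blast
  qed
  have w0: "w x = 0" if x: "x \<in> \<Omega>" for x
  proof (rule ccontr)
    assume "w x \<noteq> 0"
    moreover have "traction lam mu \<Omega> (nv y) w y = 0" if y: "y \<in> frontier \<Omega>" for y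
      unfolding wdyn[OF y] using q0c[OF front(3)[OF y]] by (simp add: vec_eq_iff)
    \<comment> \<open>The kinematic condition with zero fluid data, divided by the positive factor
      \<open>\<omega>^2 * \<rho>f\<close>.\<close>
    moreover have "ndot (w y) (nv y) = 0" if y: "y \<in> frontier \<Omega>" for y
    proof -
      have "bpd V i q y = 0" for i using e0[OF front(3)[OF y], of i] front(4)[OF y] by (simp add: e_def ext_pd_def)
      then show ?thesis using qkin[OF y] pos by simp
    qed
    ultimately have "traction_free_solution lam mu \<rho> \<omega> \<Omega> nv w"
      unfolding traction_free_solution_def using wreg wlame x by blast
    then show False using no_tf by blast
  qed
  have "w x = 0" if x: "x \<in> closure \<Omega>" for x
  proof -
    have "comp w i x = 0" for i
    proof (rule continuous_constant_on_closure[OF _ _ x])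
      show "continuous_on (closure \<Omega>) (comp w i)" using wreg by (auto simp: vec_C2_C1bar_def C1_closure_def)
    qed (simp add: comp_def w0)
    then show ?thesis by (simp add: comp_def vec_eq_iff)
  qed
  then show ?thesis using q0c by (auto simp: w_def q_def V_def)
qed

end
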